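(* Let $d\ge2$, let $u\in L^2(-1,1)$ and let $\eta\in\mathbb R_+$ be given. Then $u\in V^\eta(-1,1)$ if and only if $$\sum_{\ell=0}^\infty u_\ell^2\,\ell^{d-2+2\eta}<+\infty ;$$ that is, $$\|u\|_{V^\eta(-1,1)}^2\simeq\sum_{\ell=0}^\infty u_\ell^2\,(1+\ell^{d-2+2\eta})$$ is an equivalent norm in $V^\eta(-1,1)$. For $k_I\in V^n(-1,1)$, $n\in\mathbb N_0$, where $k_I$ is the covariance kernel, as a function of the inner product, of a centered, mean square continuous, isotropic random field on $\mathbb S^{d-1}$ with angular power spectrum $(A_\ell,\ell\in\mathbb N_0)$, this simplifies to the equivalence that the sequence $(\ell^{d/2-1+n}A_\ell,\ \ell\ge n)$ is in $\ell^2(\mathbb N_0)$ if and only if the function $(1-\mu^2)^{(d-3)/4+n/2}\frac{\partial^n}{\partial\mu^n}k_I(\mu)$, $\mu\in(-1,1)$, is in $L^2(-1,1)$.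
   Context: $\mathbb S^{d-1}$ is the unit sphere in $\mathbb R^d$. $G_\ell=C_\ell^{(d-2)/2}/C_\ell^{(d-2)/2}(1)$ is the Gegenbauer polynomial of degree $\ell$ normalized to $G_\ell(1)=1$ (for $d=2$ understood as the Chebyshev polynomial $T_\ell$), and $h(\ell,d)=(2\ell+d-2)\frac{(\ell+d-3)!}{(d-2)!\,\ell!}$ (with $h(0,2)=1$). The numbers $u_\ell=\int_{-1}^1u(\mu)\,G_\ell(\mu)\,(1-\mu^2)^{(d-3)/2}\,d\mu$, $\ell\in\mathbb N_0$, are the Gegenbauer coefficients of $u$, so that $u=c_d^{-1}\sum_{\ell=0}^\infty u_\ell\,h(\ell,d)\,G_\ell$ with $c_d=\int_{-1}^1(1-\mu^2)^{(d-3)/2}d\mu$. The symbol $\simeq$ denotes two-sided bounds with constants independent of $u$. For $n\in\mathbb N_0$, $V^n(-1,1)$ is the completion of the standard Sobolev space $H^n(-1,1)$ with respect to the weighted norm $$\|u\|_{V^n(-1,1)}^2=\sum_{j=0}^n\int_{-1}^1\Bigl(\frac{\partial^j}{\partial\mu^j}u(\mu)\Bigr)^2(1-\mu^2)^{(d-3)/2+j}\,d\mu .$$ For $n<\eta<n+1$, $V^\eta(-1,1)=(V^n(-1,1),V^{n+1}(-1,1))_{\eta-n,2}$ is defined by real interpolation, with norm $\|u\|_{V^\eta(-1,1)}^2=\int_0^\infty t^{-2(\eta-n)}|K(t,u)|^2\frac{dt}{t}$, $K(t,u)=\inf_{u=v+w}(\|v\|_{V^n(-1,1)}+t\|w\|_{V^{n+1}(-1,1)})$.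 A centered isotropic random field $T$ on $\mathbb S^{d-1}$ is a jointly measurable mean-zero square-integrable random field whose covariance $\mathbb E(T(x)T(y))$ depends only on the geodesic distance of $x$ and $y$ (Gaussian fields are the main example). Its angular power spectrum is the sequence of nonnegative reals $(A_\ell,\ell\in\mathbb N_0)$ with $\sum_\ell A_\ell h(\ell,d)<\infty$ and $\mathbb E(T(x)T(y))=k_I(\langle x,y\rangle_{\mathbb R^d})$, where $k_I(\mu)=\frac1{\omega_d}\sum_{\ell=0}^\infty A_\ell\,h(\ell,d)\,G_\ell(\mu)$ and $\omega_d=2\pi^{d/2}/\Gamma(d/2)$ is the total area of $\mathbb S^{d-1}$. *)

theory Defs
  imports "HOL-Probability.Probability"
begin

section \<open>Gegenbauer polynomials and coefficients\<close>

fun chebyshev :: "nat \<Rightarrow> real \<Rightarrow> real" where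
  "chebyshev 0 x = 1"
| "chebyshev (Suc 0) x = x"
| "chebyshev (Suc (Suc l)) x = 2 * x * chebyshev (Suc l) x - chebyshev l x"

fun gegenbauer :: "real \<Rightarrow> nat \<Rightarrow> real \<Rightarrow> real" where
  "gegenbauer a 0 x = 1"
| "gegenbauer a (Suc 0) x = 2 * a * x"
| "gegenbauer a (Suc (Suc l)) x =
     (2 * x * (real l + 1 + a) * gegenbauer a (Suc l) x - (real l + 2 * a) * gegenbauer a l x)
       / (real l + 2)"

definition gegenbauer_normalized :: "nat \<Rightarrow> nat \<Rightarrow> real \<Rightarrow> real" where
  "gegenbauer_normalized d l x =
     (if d = 2 then chebyshev l x
      else gegenbauer ((real d - 2) / 2) l x / gegenbauer ((real d - 2) / 2) l 1)"

text \<open>The case distinction replaces the undefined factorial of \<open>-1\<close> at \<open>l = 0\<close>, \<open>d = 2\<close>.\<close>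

definition harmonic_dim :: "nat \<Rightarrow> nat \<Rightarrow> real" where
  "harmonic_dim l d =
     (if l = 0 \<and> d = 2 then 1
      else (2 * real l + real d - 2) * (fact (l + d - 3) / (fact (d - 2) * fact l)))"

abbreviation leb11 :: "real measure" where
  "leb11 \<equiv> lebesgue_on {-1<..<1}"

definition gegenbauer_integrand :: "nat \<Rightarrow> (real \<Rightarrow> real) \<Rightarrow> nat \<Rightarrow> real \<Rightarrow> real" where
  "gegenbauer_integrand d u l \<mu> =
     u \<mu> * gegenbauer_normalized d l \<mu> * (1 - \<mu>\<^sup>2) powr ((real d - 3) / 2)"

definition gegenbauer_coeff :: "nat \<Rightarrow> (real \<Rightarrow> real) \<Rightarrow> nat \<Rightarrow> real" where
  "gegenbauer_coeff d u l = (\<integral>\<mu>. gegenbauer_integrand d u l \<mu> \<partial>leb11)"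

text \<open>If \<open>d = 2\<close>, the integral defining a coefficient of a function in \<open>L\<^sup>2(-1,1)\<close> need not
  converge, and \<open>gegenbauer_coeff\<close> is then the default value 0 of the Bochner integral.\<close>

definition gegenbauer_coeffs_exist :: "nat \<Rightarrow> (real \<Rightarrow> real) \<Rightarrow> bool" where
  "gegenbauer_coeffs_exist d u \<longleftrightarrow> (\<forall>l. integrable leb11 (gegenbauer_integrand d u l))"


section \<open>Weak derivatives and Sobolev spaces on \<open>(-1,1)\<close>\<close>

text \<open>Elements of the function spaces below are represented by functions on the real line, of which
  only the values almost everywhere on \<open>(-1,1)\<close> matter.\<close>

definition L2_11 :: "(real \<Rightarrow> real) set" where
  "L2_11 = {u. u \<in> borel_measurable leb11 \<and> integrable leb11 (\<lambda>x. (u x)\<^sup>2)}"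

definition locally_integrable_11 :: "(real \<Rightarrow> real) \<Rightarrow> bool" where
  "locally_integrable_11 u \<longleftrightarrow>
     (\<forall>K. compact K \<and> K \<subseteq> {-1<..<1} \<longrightarrow> integrable (lebesgue_on K) u)"

definition test_fun_11 :: "(real \<Rightarrow> real) \<Rightarrow> bool" where
  "test_fun_11 \<phi> \<longleftrightarrow>
     (\<forall>k x. (deriv ^^ k) \<phi> field_differentiable (at x)) \<and> closure {x. \<phi> x \<noteq> 0} \<subseteq> {-1<..<1}"

definition has_weak_deriv :: "nat \<Rightarrow> (real \<Rightarrow> real) \<Rightarrow> (real \<Rightarrow> real) \<Rightarrow> bool" where
  "has_weak_deriv j u v \<longleftrightarrow>
     locally_integrable_11 u \<and> locally_integrable_11 v \<and>
     (\<forall>\<phi>. test_fun_11 \<phi> \<longrightarrow>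
        (\<integral>x. u x * (deriv ^^ j) \<phi> x \<partial>leb11) = (-1) ^ j * (\<integral>x. v x * \<phi> x \<partial>leb11))"

text \<open>Weak derivatives are unique almost everywhere on \<open>(-1,1)\<close>.\<close>

definition weak_deriv :: "nat \<Rightarrow> (real \<Rightarrow> real) \<Rightarrow> real \<Rightarrow> real" where
  "weak_deriv j u = (SOME v. has_weak_deriv j u v)"

definition sobolev_H :: "nat \<Rightarrow> (real \<Rightarrow> real) set" where
  "sobolev_H n = {u. \<forall>j\<le>n. \<exists>v\<in>L2_11. has_weak_deriv j u v}"


section \<open>The weighted spaces\<close>

definition V_nat_norm2 :: "nat \<Rightarrow> nat \<Rightarrow> (real \<Rightarrow> real) \<Rightarrow> ennreal" where
  "V_nat_norm2 d n u =
     (if \<forall>j\<le>n. \<exists>v. has_weak_deriv j u v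
      then \<Sum>j\<le>n. \<integral>\<^sup>+ \<mu>. ennreal ((weak_deriv j u \<mu>)\<^sup>2
                              * (1 - \<mu>\<^sup>2) powr ((real d - 3) / 2 + real j)) \<partial>leb11
      else \<infinity>)"

text \<open>The functions \<open>u\<close> with finite \<open>V_nat_norm2 d n u\<close> form (up to equality almost everywhere) a
  Hilbert space. The completion of \<open>sobolev_H n\<close> is therefore realized as its closure in this
  space. Members of \<open>sobolev_H n\<close> of infinite weighted norm (which exist only for
  \<open>d = 2\<close>, \<open>n = 0\<close>) cannot be close to \<open>u\<close> and play no role.\<close>

definition V_nat :: "nat \<Rightarrow> nat \<Rightarrow> (real \<Rightarrow> real) set" where
  "V_nat d n =
     {u. V_nat_norm2 d n u < \<infinity> \<and>
         (\<exists>f :: nat \<Rightarrow> real \<Rightarrow> real. (\<forall>k. f k \<in> sobolev_H n) \<and>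
            (\<lambda>k. V_nat_norm2 d n (\<lambda>\<mu>. f k \<mu> - u \<mu>)) \<longlonglongrightarrow> 0)}"

definition V_nat_norm :: "nat \<Rightarrow> nat \<Rightarrow> (real \<Rightarrow> real) \<Rightarrow> real" where
  "V_nat_norm d n u = sqrt (enn2real (V_nat_norm2 d n u))"

text \<open>The infimum over the empty set is \<open>\<infinity>\<close>, so the K-functional is infinite for functions
  outside the sum of the two spaces, and such functions have infinite interpolation norm.\<close>

definition K_functional :: "nat \<Rightarrow> nat \<Rightarrow> real \<Rightarrow> (real \<Rightarrow> real) \<Rightarrow> ennreal" where
  "K_functional d n t u =
     (INF (v, w) \<in> {(v, w). v \<in> V_nat d n \<and> w \<in> V_nat d (Suc n) \<and> (AE \<mu> in leb11. u \<mu> = v \<mu> + w \<mu>)}.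
        ennreal (V_nat_norm d n v + t * V_nat_norm d (Suc n) w))"

definition V_interp_norm2 :: "nat \<Rightarrow> nat \<Rightarrow> real \<Rightarrow> (real \<Rightarrow> real) \<Rightarrow> ennreal" where
  "V_interp_norm2 d n \<theta> u =
     (\<integral>\<^sup>+ t\<in>{0<..}. ennreal (t powr (- 2 * \<theta>)) * (K_functional d n t u)\<^sup>2 * ennreal (1 / t) \<partial>lborel)"

text \<open>In the next two definitions \<open>\<eta> \<ge> 0\<close> is the real order of the space and \<open>nat \<lfloor>\<eta>\<rfloor>\<close> is
  the largest natural number not exceeding it.\<close>

definition V_norm2 :: "nat \<Rightarrow> real \<Rightarrow> (real \<Rightarrow> real) \<Rightarrow> ennreal" where
  "V_norm2 d \<eta> u =
     (if \<eta> \<in> \<nat> then V_nat_norm2 d (nat \<lfloor>\<eta>\<rfloor>) u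
      else V_interp_norm2 d (nat \<lfloor>\<eta>\<rfloor>) (\<eta> - real (nat \<lfloor>\<eta>\<rfloor>)) u)"

definition V_space :: "nat \<Rightarrow> real \<Rightarrow> (real \<Rightarrow> real) set" where
  "V_space d \<eta> = (if \<eta> \<in> \<nat> then V_nat d (nat \<lfloor>\<eta>\<rfloor>) else {u. V_norm2 d \<eta> u < \<infinity>})"


section \<open>Isotropic random fields on the sphere\<close>

text \<open>The geodesic distance of points \<open>x\<close>, \<open>y\<close> of the unit sphere is \<open>arccos (x \<bullet> y)\<close>.\<close>

definition centered_isotropic_field ::
    "'b measure \<Rightarrow> (real ^ 'n \<Rightarrow> 'b \<Rightarrow> real) \<Rightarrow> bool" where
  "centered_isotropic_field M T \<longleftrightarrow>
     prob_space M \<and>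
     (\<lambda>(x, \<omega>). T x \<omega>) \<in> borel_measurable (restrict_space borel (sphere 0 1) \<Otimes>\<^sub>M M) \<and>
     (\<forall>x\<in>sphere 0 1. integrable M (\<lambda>\<omega>. (T x \<omega>)\<^sup>2)) \<and>
     (\<forall>x\<in>sphere 0 1. (\<integral>\<omega>. T x \<omega> \<partial>M) = 0) \<and>
     (\<exists>\<rho>. \<forall>x\<in>sphere 0 1. \<forall>y\<in>sphere 0 1. (\<integral>\<omega>. T x \<omega> * T y \<omega> \<partial>M) = \<rho> (arccos (x \<bullet> y)))"

definition mean_square_continuous ::
    "'b measure \<Rightarrow> (real ^ 'n \<Rightarrow> 'b \<Rightarrow> real) \<Rightarrow> bool" where
  "mean_square_continuous M T \<longleftrightarrow>
     (\<forall>x\<in>sphere 0 1. ((\<lambda>y. \<integral>\<omega>. (T y \<omega> - T x \<omega>)\<^sup>2 \<partial>M) \<longlongrightarrow> 0) (at x within sphere 0 1))"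

definition sphere_area :: "nat \<Rightarrow> real" where
  "sphere_area d = 2 * pi powr (real d / 2) / Gamma (real d / 2)"

definition covariance_kernel :: "nat \<Rightarrow> (nat \<Rightarrow> real) \<Rightarrow> real \<Rightarrow> real" where
  "covariance_kernel d A \<mu> =
     1 / sphere_area d * (\<Sum>l. A l * harmonic_dim l d * gegenbauer_normalized d l \<mu>)"

definition angular_power_spectrum ::
    "'b measure \<Rightarrow> (real ^ 'n \<Rightarrow> 'b \<Rightarrow> real) \<Rightarrow> (nat \<Rightarrow> real) \<Rightarrow> bool" where
  "angular_power_spectrum M T A \<longleftrightarrow>
     (\<forall>l. 0 \<le> A l) \<and>
     summable (\<lambda>l. A l * harmonic_dim l CARD('n)) \<and>
     (\<forall>x\<in>sphere 0 1. \<forall>y\<in>sphere 0 1.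
        (\<integral>\<omega>. T x \<omega> * T y \<omega> \<partial>M) = covariance_kernel CARD('n) A (x \<bullet> y))"

end

theory Submission
  imports Defs
begin

text \<open>
Everything is diagonal in the Gegenbauer polynomials. Put \<open>\<alpha> = (d - 2) / 2\<close>, let \<open>P\<^sub>l\<close> be the Gegenbauer
polynomial of degree \<open>l\<close> with \<open>P\<^sub>l(1) = 1\<close>, and let \<open>w\<^sub>j = (1 - x\<^sup>2)\<^bsup>\<alpha> - 1/2 + j\<^esup>\<close>, which is the weight of
order \<open>j\<close> in the norms. The differential equation of \<open>P\<^sub>l\<close>, differentiated \<open>j\<close> times
(\<open>gderiv_ODE\<close>), says that \<open>w\<^bsub>j+1\<^esub> P\<^sub>l\<^bsup>(j+1)\<^esup>\<close> has the derivative \<open>- \<lambda>\<^bsub>l,j\<^esub> w\<^sub>j P\<^sub>l\<^bsup>(j)\<^esup>\<close> with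
\<open>\<lambda>\<^bsub>l,j\<^esub> = (l - j) (l + j + 2 \<alpha>)\<close>. If \<open>v\<^sub>j\<close> and \<open>v\<^bsub>j+1\<^esub>\<close> are weak derivatives of \<open>u\<close> that are integrable for
the weights \<open>w\<^sub>j\<close> and \<open>w\<^bsub>j+1\<^esub>\<close>, then integration by parts produces no boundary term
(\<open>weighted_integration_by_parts\<close>), and so the \<open>l\<close>-th coefficient of \<open>v\<^bsub>j+1\<^esub>\<close> with respect to \<open>P\<^sub>l\<^bsup>(j+1)\<^esup>\<close> is
\<open>\<lambda>\<^bsub>l,j\<^esub>\<close> times that of \<open>v\<^sub>j\<close> with respect to \<open>P\<^sub>l\<^bsup>(j)\<^esup>\<close>. Applied to polynomials, the same formula shows that for
each \<open>j\<close> the polynomials \<open>P\<^sub>l\<^bsup>(j)\<^esup>\<close> are orthogonal for \<open>w\<^sub>j\<close> with squared norms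
\<open>\<lambda>\<^bsub>l,0\<^esub> \<cdots> \<lambda>\<^bsub>l,j-1\<^esub> N\<^sub>l\<close>, where \<open>N\<^sub>l\<close> is the squared norm of \<open>P\<^sub>l\<close>. They are complete because they span all
polynomials (\<open>orthogonal_system_gderiv\<close>).

Parseval's identity at every order \<open>j \<le> n\<close> therefore gives the exact formula
\<open>\<parallel>u\<parallel>\<^sup>2 = \<Sum>\<^sub>l u\<^sub>l\<^sup>2 W\<^sub>n(l)\<close> for the norm of order \<open>n\<close>, with \<open>W\<^sub>n(l) = \<Sum>\<^bsub>j\<le>n\<^esub> \<lambda>\<^bsub>l,0\<^esub> \<cdots> \<lambda>\<^bsub>l,j-1\<^esub> / N\<^sub>l\<close>
(\<open>V_nat_norm2_finite\<close>, \<open>V_nat_norm2_eq\<close>). Conversely, if this sum is finite, the Riesz-Fischer theorem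
produces the weak derivatives from the coefficients, and the partial sums, which are polynomials,
converge to \<open>u\<close> in the norm, so that \<open>u\<close> lies in the closure of the Sobolev space (\<open>V_nat_iff\<close>). The
three-term recurrence shows that \<open>h(l,d) N\<^sub>l\<close> does not depend on \<open>l \<ge> 1\<close>; hence \<open>1 / N\<^sub>l\<close> grows like
\<open>l\<^bsup>d-2\<^esup>\<close> and \<open>W\<^sub>n(l)\<close> like \<open>l\<^bsup>d-2+2n\<^esup>\<close> (\<open>vweight_bounds\<close>).

For a non-integer order \<open>n + \<theta>\<close> the spaces to be interpolated are thus weighted sequence spaces.
The square of the K-functional is comparable to \<open>\<Sum>\<^sub>l u\<^sub>l\<^sup>2 min (W\<^sub>n(l), t\<^sup>2 W\<^bsub>n+1\<^esub>(l))\<close>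
(\<open>K_functional_lower\<close>, \<open>K_functional_upper\<close>), and integrating over \<open>t\<close> turns each minimum into a
multiple of \<open>W\<^sub>n(l)\<^bsup>1-\<theta>\<^esup> W\<^bsub>n+1\<^esub>(l)\<^bsup>\<theta>\<^esup>\<close>, which grows like \<open>l\<^bsup>d-2+2(n+\<theta>)\<^esup>\<close>.

The series of the covariance kernel converges uniformly because \<open>\<bar>P\<^sub>l\<bar> \<le> 1\<close> (\<open>gpoly_bounded\<close>), so its
coefficients can be read off; for \<open>l \<ge> 1\<close> they are a fixed multiple of \<open>A\<^sub>l\<close>. For a kernel in the space of
order \<open>n\<close>, the coefficient criterion gives the summability of the weighted spectrum, and the
definition of the norm gives the square integrability of the weighted derivative.
\<close>

section \<open>Smooth functions and cutoffs\<close>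

text \<open>Derivatives are existentially quantified instead of given by \<open>deriv\<close>, which makes the rules for sums,
products and compositions simple inductions; on open sets the two versions agree
(\<open>Ck_on_Suc_deriv\<close>). The set \<open>S\<close> is kept as a parameter because powers \<open>x powr s\<close> are smooth only on
the positive half-line; their products with a cutoff are extended by \<open>0\<close> afterwards.\<close>

primrec Ck_on :: "nat \<Rightarrow> real set \<Rightarrow> (real \<Rightarrow> real) \<Rightarrow> bool" where
  "Ck_on 0 S f = True"
| "Ck_on (Suc n) S f =
     (\<exists>f'. (\<forall>x\<in>S. (f has_field_derivative f' x) (at x)) \<and> Ck_on n S f')"

lemma Ck_on_cong:
  assumes "open S" "\<And>x. x \<in> S \<Longrightarrow> f x = g x" "Ck_on n S f"
  shows "Ck_on n S g"
proof (cases n)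
  case (Suc m)
  then obtain f' where f': "\<And>x. x \<in> S \<Longrightarrow> (f has_field_derivative f' x) (at x)" "Ck_on m S f'"
    using assms by auto
  have "(g has_field_derivative f' x) (at x)" if "x \<in> S" for x
    using has_field_derivative_transform_within_open[OF f'(1)[OF that] assms(1) that, of g] assms(2)
    by auto
  then show ?thesis using f' Suc by auto
qed auto

lemma Ck_on_Suc_deriv:
  assumes "open S"
  shows "Ck_on (Suc n) S f \<longleftrightarrow>
    (\<forall>x\<in>S. f field_differentiable (at x)) \<and> Ck_on n S (deriv f)"
proof
  assume "Ck_on (Suc n) S f"
  then obtain f' where f': "\<And>x. x \<in> S \<Longrightarrow> (f has_field_derivative f' x) (at x)" "Ck_on n S f'"
    by auto
  have "Ck_on n S (deriv f)"
    by (rule Ck_on_cong[OF assms _ f'(2)]) (use f'(1) DERIV_imp_deriv in fastforce)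
  then show "(\<forall>x\<in>S. f field_differentiable (at x)) \<and> Ck_on n S (deriv f)"
    using f' unfolding field_differentiable_def by auto
next
  assume "(\<forall>x\<in>S. f field_differentiable (at x)) \<and> Ck_on n S (deriv f)"
  then show "Ck_on (Suc n) S f"
    by (auto simp: field_differentiable_derivI intro!: exI[of _ "deriv f"])
qed

lemma Ck_on_mono: "Ck_on n S f \<Longrightarrow> m \<le> n \<Longrightarrow> Ck_on m S f"
proof (induction n arbitrary: f m)
  case (Suc n)
  then show ?case by (cases m) auto
qed auto

lemma Ck_on_Suc_imp: "Ck_on (Suc n) S f \<Longrightarrow> Ck_on n S f"
  by (rule Ck_on_mono[where n="Suc n"]) auto

lemma Ck_on_const: "Ck_on n S (\<lambda>x. c)"
proof (induction n arbitrary: c)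
  case (Suc n)
  then show ?case by (auto intro!: exI[of _ "\<lambda>x. 0"] derivative_eq_intros)
qed auto

lemma Ck_on_ident: "Ck_on n S (\<lambda>x. x)"
  by (cases n) (auto intro!: exI[of _ "\<lambda>x. 1"] derivative_eq_intros Ck_on_const)

lemma Ck_on_add: "Ck_on n S f \<Longrightarrow> Ck_on n S g \<Longrightarrow> Ck_on n S (\<lambda>x. f x + g x)"
proof (induction n arbitrary: f g)
  case (Suc n)
  then obtain f' g' where
    "\<forall>x\<in>S. (f has_field_derivative f' x) (at x)" "Ck_on n S f'"
    "\<forall>x\<in>S. (g has_field_derivative g' x) (at x)" "Ck_on n S g'" by auto
  with Suc.IH show ?case
    by (auto intro!: exI[of _ "\<lambda>x. f' x + g' x"] derivative_eq_intros)
qed auto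

lemma Ck_on_mult: "Ck_on n S f \<Longrightarrow> Ck_on n S g \<Longrightarrow> Ck_on n S (\<lambda>x. f x * g x)"
proof (induction n arbitrary: f g)
  case (Suc n)
  then obtain f' g' where
    *: "\<forall>x\<in>S. (f has_field_derivative f' x) (at x)" "Ck_on n S f'"
    "\<forall>x\<in>S. (g has_field_derivative g' x) (at x)" "Ck_on n S g'" by auto
  have "Ck_on n S (\<lambda>x. f' x * g x + g' x * f x)"
    using * Suc.prems[THEN Ck_on_Suc_imp] by (intro Ck_on_add Suc.IH)
  with * show ?case
    by (auto intro!: exI[of _ "\<lambda>x. f' x * g x + g' x * f x"] DERIV_mult)
qed auto

lemma Ck_on_minus: "Ck_on n S f \<Longrightarrow> Ck_on n S (\<lambda>x. - f x)"
  using Ck_on_mult[OF Ck_on_const[of n S "-1"], of f] by simp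

lemma Ck_on_poly: "Ck_on n S (poly p)"
proof (induction n arbitrary: p)
  case (Suc n)
  then show ?case by (auto intro!: exI[of _ "poly (pderiv p)"] poly_DERIV)
qed auto

lemma Ck_on_inverse:
  "Ck_on n S f \<Longrightarrow> (\<And>x. x \<in> S \<Longrightarrow> f x \<noteq> 0) \<Longrightarrow> Ck_on n S (\<lambda>x. inverse (f x))"
proof (induction n arbitrary: f)
  case (Suc n)
  then obtain f' where
    *: "\<forall>x\<in>S. (f has_field_derivative f' x) (at x)" "Ck_on n S f'" by auto
  have "Ck_on n S (\<lambda>x. - (inverse (f x) * f' x * inverse (f x)))"
    using * Suc.prems(1)[THEN Ck_on_Suc_imp] Suc.prems(2) by (intro Ck_on_minus Ck_on_mult Suc.IH)
  with * Suc.prems show ?case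
    by (auto intro!: exI[of _ "\<lambda>x. - (inverse (f x) * f' x * inverse (f x))"] DERIV_inverse')
qed auto

lemma Ck_on_compose:
  "Ck_on n T f \<Longrightarrow> Ck_on n S g \<Longrightarrow> g ` S \<subseteq> T \<Longrightarrow> Ck_on n S (\<lambda>x. f (g x))"
proof (induction n arbitrary: f g)
  case (Suc n)
  then obtain f' g' where
    *: "\<forall>x\<in>T. (f has_field_derivative f' x) (at x)" "Ck_on n T f'"
    "\<forall>x\<in>S. (g has_field_derivative g' x) (at x)" "Ck_on n S g'" by auto
  have "Ck_on n S (\<lambda>x. f' (g x) * g' x)"
    by (rule Ck_on_mult[OF Suc.IH[OF *(2) Suc.prems(2)[THEN Ck_on_Suc_imp] Suc.prems(3)] *(4)])
  moreover have "((\<lambda>x. f (g x)) has_field_derivative f' (g x) * g' x) (at x)" if "x \<in> S" for x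
    using * Suc.prems(3) that by (intro DERIV_chain2) auto
  ultimately show ?case
    unfolding Ck_on.simps by (intro exI[of _ "\<lambda>x. f' (g x) * g' x"] conjI ballI)
qed auto

lemma Ck_on_Un:
  assumes "open S" "open T"
  shows "Ck_on n S f \<Longrightarrow> Ck_on n T f \<Longrightarrow> Ck_on n (S \<union> T) f"
proof (induction n arbitrary: f)
  case (Suc n)
  then show ?case using assms
    by (auto simp: Ck_on_Suc_deriv open_Un simp del: Ck_on.simps)
qed auto

lemma Ck_on_powr: "Ck_on n {0<..} (\<lambda>x. x powr s)"
proof (induction n arbitrary: s)
  case (Suc n)
  have "Ck_on n {0<..} (\<lambda>x. s * x powr (s - 1))"
    by (intro Ck_on_mult Ck_on_const Suc)
  then show ?case
    by (auto intro!: exI[of _ "\<lambda>x. s * x powr (s - 1)"] has_real_derivative_powr)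
qed auto

definition smooth :: "(real \<Rightarrow> real) \<Rightarrow> bool" where
  "smooth f \<longleftrightarrow> (\<forall>n. Ck_on n UNIV f)"

lemma smoothI: "(\<And>n. Ck_on n UNIV f) \<Longrightarrow> smooth f"
  by (simp add: smooth_def)

lemma smoothD: "smooth f \<Longrightarrow> Ck_on n UNIV f"
  by (simp add: smooth_def)

lemma smooth_deriv_iter:
  assumes "smooth f"
  shows "smooth ((deriv ^^ k) f)"
  using assms
proof (induction k arbitrary: f)
  case (Suc k)
  have "smooth (deriv f)"
    unfolding smooth_def
  proof
    fix n
    have "Ck_on (Suc n) UNIV f" using Suc.prems unfolding smooth_def by blast
    then show "Ck_on n UNIV (deriv f)" by (simp add: Ck_on_Suc_deriv del: Ck_on.simps)
  qed
  then show ?case using Suc.IH by (simp add: funpow_swap1)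
qed auto

lemma smooth_DERIV:
  assumes "smooth f"
  shows "(f has_field_derivative deriv f x) (at x)"
proof -
  have "Ck_on (Suc 0) UNIV f" using assms unfolding smooth_def by blast
  then show ?thesis by (auto simp: Ck_on_Suc_deriv field_differentiable_derivI simp del: Ck_on.simps)
qed

lemma smooth_iff_deriv_iter:
  "smooth f \<longleftrightarrow> (\<forall>k x. (deriv ^^ k) f field_differentiable (at x))"
proof
  show "smooth f \<Longrightarrow> \<forall>k x. (deriv ^^ k) f field_differentiable (at x)"
    unfolding field_differentiable_def
    by (intro allI exI) (rule smooth_DERIV, rule smooth_deriv_iter)
next
  assume *: "\<forall>k x. (deriv ^^ k) f field_differentiable (at x)"
  have "Ck_on n UNIV ((deriv ^^ k) f)" for n k
  proof (induction n arbitrary: k)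
    case (Suc n)
    from Suc[of "Suc k"] have "Ck_on n UNIV (deriv ((deriv ^^ k) f))" by simp
    then show ?case using * by (simp add: Ck_on_Suc_deriv del: Ck_on.simps)
  qed auto
  from this[where k = 0] show "smooth f" unfolding smooth_def funpow_0 by blast
qed

lemma smooth_continuous:
  assumes "smooth f"
  shows "continuous_on S f"
proof -
  have "isCont f x" for x by (rule DERIV_isCont[OF smooth_DERIV[OF assms]])
  then show ?thesis by (simp add: continuous_at_imp_continuous_on)
qed

lemma smooth_mult: "smooth f \<Longrightarrow> smooth g \<Longrightarrow> smooth (\<lambda>x. f x * g x)"
  by (rule smoothI, rule Ck_on_mult; erule smoothD)

lemma smooth_poly: "smooth (poly p)"
  by (simp add: smooth_def Ck_on_poly)

lemma smooth_compose: "smooth f \<Longrightarrow> smooth g \<Longrightarrow> smooth (\<lambda>x. f (g x))"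
  by (rule smoothI, rule Ck_on_compose[where T=UNIV]) (simp_all add: smoothD)

lemma smooth_affine: "smooth (\<lambda>x. a * x + b)"
  by (intro smoothI Ck_on_add Ck_on_mult Ck_on_const Ck_on_ident)

lemma smooth_glue:
  assumes "c < e" "\<And>n. Ck_on n {c<..} f" "\<And>x. x < e \<Longrightarrow> f x = 0"
  shows "smooth f"
  unfolding smooth_def
proof
  fix n
  have "Ck_on n {..<e} f"
    by (rule Ck_on_cong[OF _ _ Ck_on_const[of n _ 0]]) (use assms in auto)
  then have "Ck_on n ({c<..} \<union> {..<e}) f" using assms by (intro Ck_on_Un) auto
  moreover have "{c<..} \<union> {..<e} = UNIV" using assms by auto
  ultimately show "Ck_on n UNIV f" by simp
qed

text \<open>The family \<open>p(1/x) exp(-1/x)\<close>, extended by \<open>0\<close> to \<open>x \<le> 0\<close>, is closed under differentiation, since the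
derivative belongs to the polynomial \<open>X\<^sup>2 (p - p')\<close>. All its members are therefore smooth.\<close>

definition flat_exp :: "real poly \<Rightarrow> real \<Rightarrow> real" where
  "flat_exp p x = (if x > 0 then poly p (1 / x) * exp (- (1 / x)) else 0)"

lemma tendsto_poly_times_exp_minus:
  "((\<lambda>x::real. poly p x * exp (- x)) \<longlongrightarrow> 0) at_top"
proof -
  have "((\<lambda>x::real. \<Sum>i\<le>degree p. coeff p i * (x ^ i * exp (- x))) \<longlongrightarrow> (\<Sum>i\<le>degree p. coeff p i * 0)) at_top"
  proof (intro tendsto_sum tendsto_mult tendsto_const)
    fix i
    have "((\<lambda>x::real. x ^ i / exp x) \<longlongrightarrow> 0) at_top" by (rule tendsto_power_div_exp_0)
    then show "((\<lambda>x::real. x ^ i * exp (- x)) \<longlongrightarrow> 0) at_top"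
      by (simp add: exp_minus divide_inverse)
  qed
  then show ?thesis by (simp add: poly_altdef sum_distrib_right mult.assoc)
qed

lemma DERIV_flat_exp:
  "(flat_exp p has_field_derivative flat_exp ([:0, 0, 1:] * (p - pderiv p)) x) (at x)"
proof -
  consider "x > 0" | "x < 0" | "x = 0" by linarith
  then show ?thesis
  proof cases
    case 1
    have "((\<lambda>x. poly p (1 / x) * exp (- (1 / x))) has_field_derivative
        flat_exp ([:0, 0, 1:] * (p - pderiv p)) x) (at x)"
      using 1 by (auto simp: flat_exp_def field_simps power2_eq_square
        intro!: derivative_eq_intros DERIV_chain2[OF poly_DERIV])
    then show ?thesis
      by (rule has_field_derivative_transform_within_open[where S="{0<..}"])
         (use 1 in \<open>auto simp: flat_exp_def\<close>)
  next
    case 2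
    have "((\<lambda>x. 0) has_field_derivative 0) (at x)" by auto
    then have "(flat_exp p has_field_derivative 0) (at x)"
      by (rule has_field_derivative_transform_within_open[where S="{..<0}"])
         (use 2 in \<open>auto simp: flat_exp_def\<close>)
    then show ?thesis using 2 by (simp add: flat_exp_def)
  next
    case 3
    have "((\<lambda>h. flat_exp p h / h) \<longlongrightarrow> 0) (at_right 0)"
    proof -
      have "((\<lambda>h::real. poly ([:0,1:] * p) (inverse h) * exp (- inverse h)) \<longlongrightarrow> 0) (at_right 0)"
        using filterlim_compose[OF tendsto_poly_times_exp_minus filterlim_inverse_at_top_right] .
      then show ?thesis
        by (rule Lim_transform_eventually)
           (auto simp: eventually_at_filter flat_exp_def field_simps)
    qed
    moreover have "((\<lambda>h. flat_exp p h / h) \<longlongrightarrow> 0) (at_left 0)"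
      by (rule Lim_transform_eventually[OF tendsto_const])
         (auto simp: eventually_at_filter flat_exp_def)
    ultimately have "((\<lambda>h. flat_exp p h / h) \<longlongrightarrow> 0) (at 0)"
      by (simp add: filterlim_split_at)
    then show ?thesis using 3 by (simp add: DERIV_def flat_exp_def)
  qed
qed

lemma smooth_flat_exp: "smooth (flat_exp p)"
proof -
  have "Ck_on n UNIV (flat_exp p)" for n p
  proof (induction n arbitrary: p)
    case (Suc n)
    then show ?case using DERIV_flat_exp by (metis Ck_on.simps(2))
  qed auto
  then show ?thesis by (simp add: smooth_def)
qed

definition smooth_step :: "real \<Rightarrow> real" where
  "smooth_step y = flat_exp 1 (y - 1) / (flat_exp 1 (y - 1) + flat_exp 1 (2 - y))"

lemma flat_exp_1: "flat_exp 1 x \<ge> 0" "x > 0 \<Longrightarrow> flat_exp 1 x > 0" "x \<le> 0 \<Longrightarrow> flat_exp 1 x = 0"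
  by (auto simp: flat_exp_def)

lemma smooth_step_denominator: "flat_exp 1 (y - 1) + flat_exp 1 (2 - y) > 0"
  using flat_exp_1(1)[of "y - 1"] flat_exp_1(1)[of "2 - y"]
    flat_exp_1(2)[of "y - 1"] flat_exp_1(2)[of "2 - y"]
  by (cases "y > 1") auto

lemma smooth_step_bounds: "0 \<le> smooth_step y" "smooth_step y \<le> 1"
  using flat_exp_1(1)[of "y - 1"] flat_exp_1(1)[of "2 - y"] smooth_step_denominator[of y]
  by (auto simp: smooth_step_def)

lemma smooth_step_0: "y \<le> 1 \<Longrightarrow> smooth_step y = 0"
  by (simp add: smooth_step_def flat_exp_1)

lemma smooth_step_1: "y \<ge> 2 \<Longrightarrow> smooth_step y = 1"
  using flat_exp_1(2)[of "y - 1"] by (simp add: smooth_step_def flat_exp_1(3))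

lemma smooth_smooth_step: "smooth smooth_step"
proof -
  have 1: "smooth (\<lambda>y. flat_exp 1 (y - 1))"
    using smooth_compose[OF smooth_flat_exp smooth_affine[of 1 "-1"], of 1] by simp
  have "(\<lambda>y. flat_exp 1 (-1 * y + 2)) = (\<lambda>y. flat_exp 1 (2 - y))" by (simp add: algebra_simps)
  then have 2: "smooth (\<lambda>y. flat_exp 1 (2 - y))"
    using smooth_compose[OF smooth_flat_exp smooth_affine[of "-1" 2], of 1] by metis
  have nz: "flat_exp 1 (y - 1) + flat_exp 1 (2 - y) \<noteq> 0" for y
    using smooth_step_denominator[of y] by linarith
  have "Ck_on n UNIV (\<lambda>y. flat_exp 1 (y - 1) * inverse (flat_exp 1 (y - 1) + flat_exp 1 (2 - y)))" for n
  proof (rule Ck_on_mult[OF smoothD[OF 1] Ck_on_inverse])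
    show "Ck_on n UNIV (\<lambda>y. flat_exp 1 (y - 1) + flat_exp 1 (2 - y))"
      by (rule Ck_on_add[OF smoothD[OF 1] smoothD[OF 2]])
  qed (rule nz)
  then show ?thesis unfolding smooth_step_def[abs_def] divide_inverse by (rule smoothI)
qed

lemma deriv_smooth_step_eq_0:
  assumes "y < 1 \<or> y > 2"
  shows "deriv smooth_step y = 0"
proof -
  have "(smooth_step has_field_derivative 0) (at y)"
  proof (cases "y < 1")
    case True
    then show ?thesis
      by (intro has_field_derivative_transform_within_open[where S="{..<1}", OF DERIV_const])
         (auto simp: smooth_step_0)
  next
    case False
    then show ?thesis using assms
      by (intro has_field_derivative_transform_within_open[where S="{2<..}", OF DERIV_const])
         (auto simp: smooth_step_1)
  qed
  then show ?thesis by (rule DERIV_imp_deriv)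
qed

text \<open>For a cutoff \<open>\<chi>(x) = smooth_step (k (1 - x\<^sup>2))\<close> this bounds \<open>(1 - x\<^sup>2) \<chi>'(x)\<close> independently of \<open>k\<close>.\<close>

lemma deriv_smooth_step_bound: "\<exists>C\<ge>0. \<forall>y. \<bar>y * deriv smooth_step y\<bar> \<le> C"
proof -
  have "continuous_on {1..2} (\<lambda>y. y * deriv smooth_step y)"
    using smooth_continuous[OF smooth_deriv_iter[OF smooth_smooth_step, of 1]]
    by (intro continuous_intros) auto
  then have "bounded ((\<lambda>y. y * deriv smooth_step y) ` {1..2})"
    by (intro compact_imp_bounded compact_continuous_image) auto
  then obtain C where C: "C > 0" "\<And>y. y \<in> {1..2} \<Longrightarrow> \<bar>y * deriv smooth_step y\<bar> \<le> C"
    by (auto simp: bounded_pos)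
  have "\<bar>y * deriv smooth_step y\<bar> \<le> C" for y
    using C(1) C(2)[of y] deriv_smooth_step_eq_0[of y] by (cases "y \<in> {1..2}") auto
  then show ?thesis using C(1) by (intro exI[of _ C]) auto
qed

subsection \<open>Test functions\<close>

lemma compact_subset_11:
  fixes K :: "real set"
  assumes "compact K" "K \<subseteq> {-1<..<1}"
  obtains r where "0 \<le> r" "r < 1" "K \<subseteq> {-r..r}"
proof (cases "K = {}")
  case False
  obtain z where z: "z \<in> K" "\<And>x. x \<in> K \<Longrightarrow> \<bar>x\<bar> \<le> \<bar>z\<bar>"
    using continuous_attains_sup[OF assms(1) False continuous_on_rabs[OF continuous_on_id]] by blast
  have "K \<subseteq> {-\<bar>z\<bar>..\<bar>z\<bar>}"
  proof
    fix x assume "x \<in> K"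
    then have "\<bar>x\<bar> \<le> \<bar>z\<bar>" by (rule z(2))
    then show "x \<in> {-\<bar>z\<bar>..\<bar>z\<bar>}" unfolding abs_le_iff[of x] by simp
  qed
  moreover have "\<bar>z\<bar> < 1" using subsetD[OF assms(2) z(1)] by (simp add: abs_less_iff)
  ultimately show thesis using that[of "\<bar>z\<bar>"] by simp
next
  case True
  then show thesis using that[of 0] by simp
qed

lemma test_fun_11_iff:
  "test_fun_11 \<phi> \<longleftrightarrow> smooth \<phi> \<and> (\<exists>r<1. 0 \<le> r \<and> (\<forall>x. r < \<bar>x\<bar> \<longrightarrow> \<phi> x = 0))"
proof -
  have "closure {x. \<phi> x \<noteq> 0} \<subseteq> {-1<..<1} \<longleftrightarrow> (\<exists>r<1. 0 \<le> r \<and> (\<forall>x. r < \<bar>x\<bar> \<longrightarrow> \<phi> x = 0))"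
  proof
    let ?K = "closure {x. \<phi> x \<noteq> 0}"
    assume K: "?K \<subseteq> {-1<..<1}"
    have "bounded ?K" using K by (intro bounded_subset[OF bounded_ball[of 0 1]]) (fastforce simp: dist_real_def)
    then have cK: "compact ?K" by (simp add: compact_eq_bounded_closed)
    obtain r where r: "0 \<le> r" "r < 1" "?K \<subseteq> {-r..r}" by (rule compact_subset_11[OF cK K])
    have "\<phi> x = 0" if "r < \<bar>x\<bar>" for x
    proof (rule ccontr)
      assume "\<phi> x \<noteq> 0"
      then have "x \<in> {-r..r}" using closure_subset[of "{x. \<phi> x \<noteq> 0}"] r(3) by blast
      then show False using that by auto
    qed
    then show "\<exists>r<1. 0 \<le> r \<and> (\<forall>x. r < \<bar>x\<bar> \<longrightarrow> \<phi> x = 0)" using r by blast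
  next
    assume "\<exists>r<1. 0 \<le> r \<and> (\<forall>x. r < \<bar>x\<bar> \<longrightarrow> \<phi> x = 0)"
    then obtain r where r: "r < 1" "\<And>x. r < \<bar>x\<bar> \<Longrightarrow> \<phi> x = 0" by auto
    have "{x. \<phi> x \<noteq> 0} \<subseteq> {-r..r}"
    proof
      fix x assume "x \<in> {x. \<phi> x \<noteq> 0}"
      then have "\<not> r < \<bar>x\<bar>" using r(2) by auto
      then show "x \<in> {-r..r}" by auto
    qed
    then have "closure {x. \<phi> x \<noteq> 0} \<subseteq> {-r..r}" by (intro closure_minimal) auto
    then show "closure {x. \<phi> x \<noteq> 0} \<subseteq> {-1<..<1}" using r(1) by auto
  qed
  then show ?thesis unfolding test_fun_11_def smooth_iff_deriv_iter by auto
qed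

lemma test_fun_11_deriv:
  assumes "test_fun_11 \<phi>"
  shows "test_fun_11 (deriv \<phi>)"
proof -
  obtain r where r: "smooth \<phi>" "r < 1" "0 \<le> r" "\<And>x. r < \<bar>x\<bar> \<Longrightarrow> \<phi> x = 0"
    using assms by (auto simp: test_fun_11_iff)
  have "deriv \<phi> x = 0" if "r < \<bar>x\<bar>" for x
  proof -
    have "open {x::real. r < \<bar>x\<bar>}" by (intro open_Collect_less continuous_intros)
    then have "(\<phi> has_field_derivative 0) (at x)"
      by (rule has_field_derivative_transform_within_open[where f="\<lambda>x. 0", rotated])
         (use that r in auto)
    then show ?thesis by (rule DERIV_imp_deriv)
  qed
  then show ?thesis
    using r smooth_deriv_iter[OF r(1), of 1] by (auto simp: test_fun_11_iff intro!: exI[of _ r])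
qed

lemma test_fun_11_deriv_iter: "test_fun_11 \<phi> \<Longrightarrow> test_fun_11 ((deriv ^^ k) \<phi>)"
  by (induction k) (auto intro: test_fun_11_deriv)

text \<open>The step vanishes where \<open>1 - x\<^sup>2 \<le> 1/k\<close>, hence near the points \<open>\<plusminus>1\<close> at which the power is not smooth.\<close>

lemma test_fun_11_cutoff_powr:
  assumes "k > 0"
  shows "test_fun_11 (\<lambda>x. smooth_step (k * (1 - x\<^sup>2)) * (1 - x\<^sup>2) powr s * poly q x)"
proof -
  have "smooth (\<lambda>y. smooth_step (k * y) * y powr s)"
  proof (rule smooth_glue)
    show "0 < 1 / k" using assms by simp
    show "Ck_on n {0<..} (\<lambda>y. smooth_step (k * y) * y powr s)" for n
    proof (rule Ck_on_mult[OF _ Ck_on_powr])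
      have "Ck_on n {0<..} (\<lambda>y. k * y)" by (rule Ck_on_mult[OF Ck_on_const Ck_on_ident])
      then show "Ck_on n {0<..} (\<lambda>y. smooth_step (k * y))"
        by (rule Ck_on_compose[OF smoothD[OF smooth_smooth_step]]) auto
    qed
    show "smooth_step (k * y) * y powr s = 0" if "y < 1 / k" for y
      using that assms by (simp add: smooth_step_0 field_simps)
  qed
  from smooth_compose[OF this smooth_poly[of "[:1, 0, -1:]"]]
  have "smooth (\<lambda>x. smooth_step (k * (1 - x\<^sup>2)) * (1 - x\<^sup>2) powr s)"
    by (simp add: power2_eq_square)
  then have "smooth (\<lambda>x. smooth_step (k * (1 - x\<^sup>2)) * (1 - x\<^sup>2) powr s * poly q x)"
    by (rule smooth_mult[OF _ smooth_poly])
  moreover have "smooth_step (k * (1 - x\<^sup>2)) * (1 - x\<^sup>2) powr s * poly q x = 0"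
    if "sqrt (max 0 (1 - 1 / k)) < \<bar>x\<bar>" for x
  proof -
    have "sqrt (max 0 (1 - 1 / k)) < sqrt (x\<^sup>2)" using that by simp
    then have "1 - 1 / k < x\<^sup>2" unfolding real_sqrt_less_iff by simp
    then have "k * (1 - x\<^sup>2) \<le> 1" using assms by (simp add: field_simps)
    then show ?thesis by (simp add: smooth_step_0)
  qed
  ultimately show ?thesis
    using assms by (auto simp: test_fun_11_iff intro!: exI[of _ "sqrt (max 0 (1 - 1 / k))"])
qed

section \<open>Weak derivatives\<close>

lemma borel_measurable_leb11I: "f \<in> borel_measurable borel \<Longrightarrow> f \<in> borel_measurable leb11"
  by (rule measurable_restrict_space1, rule measurable_completion) simp

lemma one_minus_square_pos: "x \<in> {-1<..<1} \<Longrightarrow> 0 < 1 - x\<^sup>2" for x :: real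
  by (simp add: abs_square_less_1 abs_less_iff)

lemma space_leb11 [simp]: "space leb11 = {-1<..<1}"
  by (simp add: space_restrict_space)

lemma integrable_times_bounded:
  fixes f g :: "'a \<Rightarrow> real"
  assumes "integrable M f" "g \<in> borel_measurable M" "\<And>x. x \<in> space M \<Longrightarrow> \<bar>g x\<bar> \<le> B"
  shows "integrable M (\<lambda>x. f x * g x)"
proof (rule Bochner_Integration.integrable_bound)
  show "integrable M (\<lambda>x. B * f x)" using assms(1) by simp
  show "(\<lambda>x. f x * g x) \<in> borel_measurable M" using assms by measurable
  show "AE x in M. norm (f x * g x) \<le> norm (B * f x)"
  proof (rule AE_I2)
    fix x assume "x \<in> space M"
    then have "\<bar>f x\<bar> * \<bar>g x\<bar> \<le> \<bar>f x\<bar> * \<bar>B\<bar>" using assms(3)[of x] by (intro mult_left_mono) auto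
    then show "norm (f x * g x) \<le> norm (B * f x)" by (simp add: abs_mult mult.commute)
  qed
qed

lemma poly_measurable_leb11: "poly p \<in> borel_measurable leb11"
  by (intro borel_measurable_leb11I borel_measurable_continuous_onI continuous_on_poly continuous_on_id)

lemma poly_bounded_11: "\<exists>B\<ge>0. \<forall>x::real. \<bar>x\<bar> \<le> 1 \<longrightarrow> \<bar>poly p x\<bar> \<le> B"
proof -
  have "bounded (poly p ` {-1..1::real})"
    by (intro compact_imp_bounded compact_continuous_image continuous_on_poly continuous_on_id) auto
  then obtain B where "B > 0" "\<And>x. x \<in> {-1..1} \<Longrightarrow> \<bar>poly p x\<bar> \<le> B"
    by (auto simp: bounded_pos)
  then show ?thesis by (intro exI[of _ B]) (auto simp: abs_le_iff)
qed

text \<open>The positive and the negative part of \<open>g\<close> are densities of two finite measures that agree on all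
half-lines and are therefore equal.\<close>

lemma AE_zero_if_half_line_integrals_zero:
  fixes g :: "real \<Rightarrow> real"
  assumes g: "integrable lborel g"
    and zero: "\<And>c. (\<integral>x. indicator {c<..} x * g x \<partial>lborel) = 0"
  shows "AE x in lborel. g x = 0"
proof -
  have [measurable]: "g \<in> borel_measurable borel" using g by auto
  define p where "p = (\<lambda>x. max 0 (g x))"
  define m where "m = (\<lambda>x. max 0 (- g x))"
  have [measurable]: "p \<in> borel_measurable borel" "m \<in> borel_measurable borel"
    unfolding p_def m_def by measurable
  have int: "integrable lborel p" "integrable lborel m"
    using g unfolding p_def m_def by auto
  have ipm: "integrable lborel (\<lambda>x. indicator {c<..} x * p x)"
    "integrable lborel (\<lambda>x. indicator {c<..} x * m x)" for c
    using integrable_mult_indicator[of "{c<..}" lborel p] integrable_mult_indicator[of "{c<..}" lborel m] int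
    by simp_all
  have eq: "(\<integral>x. indicator {c<..} x * p x \<partial>lborel) = (\<integral>x. indicator {c<..} x * m x \<partial>lborel)" for c
  proof -
    have "0 = (\<integral>x. indicator {c<..} x * p x - indicator {c<..} x * m x \<partial>lborel)"
      unfolding zero[of c, symmetric] by (intro Bochner_Integration.integral_cong) (auto simp: p_def m_def max_def split: split_indicator)
    then show ?thesis using ipm[of c] by simp
  qed
  have em: "emeasure (density lborel (\<lambda>x. ennreal (f x))) {c<..} = ennreal (\<integral>x. indicator {c<..} x * f x \<partial>lborel)"
    if "integrable lborel (\<lambda>x. indicator {c<..} x * f x)" "\<And>x. 0 \<le> f x" "f \<in> borel_measurable borel" for f :: "real \<Rightarrow> real" and c
  proof -
    have "emeasure (density lborel (\<lambda>x. ennreal (f x))) {c<..} = (\<integral>\<^sup>+x. ennreal (f x) * indicator {c<..} x \<partial>lborel)"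
      using that by (subst emeasure_density) simp_all
    also have "\<dots> = (\<integral>\<^sup>+x. ennreal (indicator {c<..} x * f x) \<partial>lborel)"
      by (intro nn_integral_cong) (auto split: split_indicator)
    also have "\<dots> = ennreal (\<integral>x. indicator {c<..} x * f x \<partial>lborel)"
      using that by (intro nn_integral_eq_integral) auto
    finally show ?thesis .
  qed
  have "density lborel (\<lambda>x. ennreal (p x)) = density lborel (\<lambda>x. ennreal (m x))"
  proof (rule measure_eqI_lessThan)
    fix c
    show "emeasure (density lborel (\<lambda>x. ennreal (p x))) {c<..} < \<infinity>"
      by (subst em[OF ipm(1)]) (auto simp: p_def)
    show "emeasure (density lborel (\<lambda>x. ennreal (p x))) {c<..} = emeasure (density lborel (\<lambda>x. ennreal (m x))) {c<..}"
      by (subst em[OF ipm(1)], simp add: p_def, simp, subst em[OF ipm(2)], simp add: m_def, simp) (simp add: eq)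
  qed auto
  then have "AE x in lborel. ennreal (p x) = ennreal (m x)"
    by (intro sigma_finite_measure.density_unique_iff[OF sigma_finite_lborel, THEN iffD1]) auto
  then show ?thesis
    by eventually_elim (auto simp: p_def m_def max_def split: if_splits)
qed

lemma integrable_leb11_iff: "integrable leb11 f \<longleftrightarrow> integrable lebesgue (\<lambda>x. indicator {-1<..<1} x * f x)"
  for f :: "real \<Rightarrow> real"
  by (subst integrable_restrict_space) auto

lemma integral_leb11: "(\<integral>x. f x \<partial>leb11) = (\<integral>x. indicator {-1<..<1} x * f x \<partial>lebesgue)"
  for f :: "real \<Rightarrow> real"
  by (subst integral_restrict_space) auto

text \<open>It is enough to test the symmetric intervals \<open>{-r..r}\<close>, because each compact subset of \<open>(-1,1)\<close> lies in one.\<close>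

lemma locally_integrable_11_iff:
  "locally_integrable_11 u \<longleftrightarrow> u \<in> borel_measurable leb11 \<and>
     (\<forall>r<1. integrable leb11 (\<lambda>x. indicator {-r..r} x * u x))"
proof safe
  assume u: "locally_integrable_11 u"
  have 1: "integrable lebesgue (\<lambda>x. indicator K x * u x)" if "compact K" "K \<subseteq> {-1<..<1}" for K
    using u that integrable_restrict_space[of K lebesgue u] fmeasurableD[OF lmeasurable_compact[OF that(1)]]
    unfolding locally_integrable_11_def by auto
  show "integrable leb11 (\<lambda>x. indicator {-r..r} x * u x)" if "r < 1" for r
  proof -
    have "integrable lebesgue (\<lambda>x. indicator {-r..r} x * u x)"
      using that by (intro 1) auto
    also have "(\<lambda>x. indicator {-r..r} x * u x) = (\<lambda>x. indicator {-1<..<1} x * (indicator {-r..r} x * u x))"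
      using that by (auto simp: fun_eq_iff split: split_indicator)
    finally show ?thesis by (subst integrable_leb11_iff)
  qed
  note 2 = this
  show "u \<in> borel_measurable leb11"
  proof (rule borel_measurable_LIMSEQ_metric)
    fix i :: nat
    show "(\<lambda>x. indicator {-(1 - 1 / Suc i)..1 - 1 / Suc i} x * u x) \<in> borel_measurable leb11"
      using 2[of "1 - 1 / Suc i"] by auto
  next
    fix x assume "x \<in> space leb11"
    then have x: "\<bar>x\<bar> < 1" by (auto simp: space_restrict_space)
    obtain N where N: "inverse (real (Suc N)) < 1 - \<bar>x\<bar>" using reals_Archimedean[of "1 - \<bar>x\<bar>"] x by auto
    have "\<forall>\<^sub>F i in sequentially. indicator {-(1 - 1 / Suc i)..1 - 1 / Suc i} x * u x = u x"
      using eventually_ge_at_top[of N]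
    proof eventually_elim
      case (elim i)
      have "1 / real (Suc i) \<le> 1 / real (Suc N)" using elim by (intro divide_left_mono) auto
      then have "1 / real (Suc i) \<le> 1 - \<bar>x\<bar>" using N by (simp add: inverse_eq_divide)
      then show ?case by (auto simp: indicator_def)
    qed
    then show "(\<lambda>i. indicator {-(1 - 1 / Suc i)..1 - 1 / Suc i} x * u x) \<longlonglongrightarrow> u x"
      by (rule tendsto_eventually)
  qed
next
  assume u: "u \<in> borel_measurable leb11" "\<forall>r<1. integrable leb11 (\<lambda>x. indicator {-r..r} x * u x)"
  show "locally_integrable_11 u"
    unfolding locally_integrable_11_def
  proof safe
    fix K :: "real set" assume K: "compact K" "K \<subseteq> {-1<..<1}"
    have Ks: "K \<in> sets lebesgue" using K by (simp add: lmeasurable_compact fmeasurableD)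
    obtain r where r: "r < 1" "K \<subseteq> {-r..r}" by (rule compact_subset_11[OF K])
    have "integrable lebesgue (\<lambda>x. indicator {-1<..<1} x * (indicator {-r..r} x * u x))"
      using u(2)[rule_format, OF r(1)] by (subst (asm) integrable_leb11_iff)
    from integrable_mult_indicator[OF Ks this]
    have "integrable lebesgue (\<lambda>x. indicator K x * (indicator {-1<..<1} x * (indicator {-r..r} x * u x)))" by simp
    also have "(\<lambda>x. indicator K x * (indicator {-1<..<1} x * (indicator {-r..r} x * u x))) = (\<lambda>x. indicator K x *\<^sub>R u x)"
      using K r by (auto simp: fun_eq_iff split: split_indicator)
    finally show "integrable (lebesgue_on K) u"
      by (subst integrable_restrict_space) (use Ks in auto)
  qed
qed

lemma locally_integrable_11_measurable: "locally_integrable_11 u \<Longrightarrow> u \<in> borel_measurable leb11"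
  by (simp add: locally_integrable_11_iff)

lemma test_fun_11_measurable: "test_fun_11 \<phi> \<Longrightarrow> \<phi> \<in> borel_measurable leb11"
  by (rule borel_measurable_leb11I, rule borel_measurable_continuous_onI)
     (auto simp: test_fun_11_iff intro: smooth_continuous)

lemma test_fun_11_bounded:
  assumes "test_fun_11 \<phi>"
  shows "\<exists>B r. 0 \<le> r \<and> r < 1 \<and> 0 \<le> B \<and> (\<forall>x. \<bar>\<phi> x\<bar> \<le> B * indicator {-r..r} x)"
proof -
  obtain r where r: "smooth \<phi>" "r < 1" "0 \<le> r" "\<And>x. r < \<bar>x\<bar> \<Longrightarrow> \<phi> x = 0"
    using assms by (auto simp: test_fun_11_iff)
  have "bounded (\<phi> ` {-r..r})"
    by (intro compact_imp_bounded compact_continuous_image smooth_continuous r) auto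
  then obtain B where B: "B > 0" "\<And>x. x \<in> {-r..r} \<Longrightarrow> \<bar>\<phi> x\<bar> \<le> B"
    by (auto simp: bounded_pos)
  have "\<bar>\<phi> x\<bar> \<le> B * indicator {-r..r} x" for x
    using B r(4)[of x] by (auto simp: indicator_def)
  then show ?thesis using r B by (intro exI[of _ B] exI[of _ r]) auto
qed

lemma integrable_times_test_fun:
  assumes "locally_integrable_11 u" "test_fun_11 \<phi>"
  shows "integrable leb11 (\<lambda>x. u x * \<phi> x)"
proof -
  obtain B r where B: "r < 1" "0 \<le> B" "\<And>x. \<bar>\<phi> x\<bar> \<le> B * indicator {-r..r} x"
    using test_fun_11_bounded[OF assms(2)] by blast
  have [measurable]: "u \<in> borel_measurable leb11" "\<phi> \<in> borel_measurable leb11"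
    using assms locally_integrable_11_measurable test_fun_11_measurable by auto
  have "integrable leb11 (\<lambda>x. B * (indicator {-r..r} x * u x))"
    using assms(1) B(1) by (simp add: locally_integrable_11_iff)
  then show ?thesis
  proof (rule Bochner_Integration.integrable_bound)
    show "AE x in leb11. norm (u x * \<phi> x) \<le> norm (B * (indicator {-r..r} x * u x))"
    proof (rule AE_I2)
      fix x
      have "\<bar>u x\<bar> * \<bar>\<phi> x\<bar> \<le> \<bar>u x\<bar> * (B * indicator {-r..r} x)"
        by (intro mult_left_mono B) auto
      then show "norm (u x * \<phi> x) \<le> norm (B * (indicator {-r..r} x * u x))"
        using B(2) by (simp add: abs_mult mult_ac)
    qed
  qed simp
qed

text \<open>The continuous functions \<open>min 1 (max 0 (k (x - c)))\<close> tend to the indicator function of the half-line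
beyond \<open>c\<close>.\<close>

lemma AE_zero_if_orthogonal_to_continuous:
  fixes f :: "real \<Rightarrow> real"
  assumes f: "integrable leb11 f"
    and zero: "\<And>h. continuous_on UNIV h \<Longrightarrow> (\<integral>x. f x * h x \<partial>leb11) = 0"
  shows "AE x in leb11. f x = 0"
proof -
  define g where "g = (\<lambda>x. indicator {-1<..<1} x * f x)"
  have g: "integrable lebesgue g" using f unfolding g_def by (simp add: integrable_leb11_iff)
  then obtain g' where g'[measurable]: "g' \<in> borel_measurable lborel" and gg': "AE x in lborel. g x = g' x"
    using completion_ex_borel_measurable_real[of g lborel] by auto
  have gg'2: "AE x in lebesgue. g x = g' x" using gg' by (rule AE_completion)
  have g'm: "g' \<in> borel_measurable lebesgue" using g' by (rule measurable_completion)
  have "integrable lebesgue g'" using g gg'2 g'm integrable_cong_AE[of g lebesgue g'] by auto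
  then have g'i: "integrable lborel g'" using g' integrable_completion by blast
  have "AE x in lborel. g' x = 0"
  proof (rule AE_zero_if_half_line_integrals_zero[OF g'i])
    fix c :: real
    define h where "h = (\<lambda>k x. min 1 (max 0 (real k * (x - c))))"
    have h: "continuous_on UNIV (h k)" for k unfolding h_def by (intro continuous_intros)
    have hm: "h k \<in> borel_measurable leb11" for k
      by (rule borel_measurable_leb11I[OF borel_measurable_continuous_onI[OF h]])
    have lim: "(\<lambda>k. h k x) \<longlonglongrightarrow> indicator {c<..} x" for x
    proof (cases "x > c")
      case True
      have "\<forall>\<^sub>F k in sequentially. h k x = 1"
        using eventually_ge_at_top[of "nat \<lceil>1 / (x - c)\<rceil>"]
      proof eventually_elim
        case (elim k)
        then have "1 / (x - c) \<le> real k" by linarith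
        then have "1 \<le> real k * (x - c)" using True by (simp add: field_simps)
        then show ?case by (simp add: h_def)
      qed
      then show ?thesis using True by (simp add: tendsto_eventually)
    next
      case False
      have "h k x = 0" for k
      proof -
        have "real k * (x - c) \<le> 0" using False by (simp add: mult_le_0_iff)
        then show ?thesis by (simp add: h_def)
      qed
      then show ?thesis using False by simp
    qed
    have "(\<lambda>k. \<integral>x. f x * h k x \<partial>leb11) \<longlonglongrightarrow> (\<integral>x. f x * indicator {c<..} x \<partial>leb11)"
    proof (rule integral_dominated_convergence[where w="\<lambda>x. \<bar>f x\<bar>"])
      show "AE x in leb11. (\<lambda>k. f x * h k x) \<longlonglongrightarrow> f x * indicator {c<..} x"
        by (intro AE_I2 tendsto_mult_left lim)
      show "AE x in leb11. norm (f x * h k x) \<le> \<bar>f x\<bar>" for k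
        by (intro AE_I2) (simp add: h_def abs_mult mult_left_le)
      show "(\<lambda>x. f x * indicator {c<..} x) \<in> borel_measurable leb11"
        by (rule borel_measurable_times[OF borel_measurable_integrable[OF f] borel_measurable_leb11I]) simp
      show "(\<lambda>x. f x * h k x) \<in> borel_measurable leb11" for k
        by (rule borel_measurable_times[OF borel_measurable_integrable[OF f] hm])
    qed (use f in simp)
    then have 0: "(\<integral>x. f x * indicator {c<..} x \<partial>leb11) = 0"
      unfolding zero[OF h] by (simp add: LIMSEQ_const_iff)
    have "(\<integral>x. indicator {c<..} x * g' x \<partial>lborel) = (\<integral>x. indicator {c<..} x * g' x \<partial>lebesgue)"
      by (rule integral_completion[symmetric]) simp
    also have "\<dots> = (\<integral>x. indicator {c<..} x * g x \<partial>lebesgue)"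
    proof (rule integral_cong_AE)
      show "(\<lambda>x. indicator {c<..} x * g' x) \<in> borel_measurable lebesgue"
        by (rule measurable_completion) simp
      have "integrable lebesgue (\<lambda>x. indicator {c<..} x *\<^sub>R g x)"
        by (intro integrable_mult_indicator g) auto
      then show "(\<lambda>x. indicator {c<..} x * g x) \<in> borel_measurable lebesgue" by auto
      show "AE x in lebesgue. indicator {c<..} x * g' x = indicator {c<..} x * g x"
        using gg'2 by eventually_elim simp
    qed
    also have "\<dots> = (\<integral>x. f x * indicator {c<..} x \<partial>leb11)"
      unfolding integral_leb11 g_def by (simp add: mult_ac)
    finally show "(\<integral>x. indicator {c<..} x * g' x \<partial>lborel) = 0" unfolding 0 .
  qed
  then have "AE x in lebesgue. g' x = 0" by (rule AE_completion)
  with gg'2 have "AE x in lebesgue. x \<in> {-1<..<1} \<longrightarrow> f x = 0"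
    by eventually_elim (auto simp: g_def)
  then show ?thesis by (subst AE_restrict_space_iff) auto
qed

text \<open>By the Weierstrass theorem \<open>f\<close> is orthogonal to all continuous functions. The error
\<open>sup \<bar>\<phi> - p\<bar>\<close> is multiplied by the integral \<open>A\<close> of \<open>\<bar>f\<bar>\<close>.\<close>

lemma AE_zero_if_orthogonal_to_polys:
  fixes f :: "real \<Rightarrow> real"
  assumes f: "integrable leb11 f" and zero: "\<And>p. (\<integral>x. f x * poly p x \<partial>leb11) = 0"
  shows "AE x in leb11. f x = 0"
proof (rule AE_zero_if_orthogonal_to_continuous[OF f])
  fix \<phi> :: "real \<Rightarrow> real" assume \<phi>: "continuous_on UNIV \<phi>"
  have c\<phi>: "continuous_on {-1..1} \<phi>" using \<phi> by (rule continuous_on_subset) simp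
  define A where "A = (\<integral>x. \<bar>f x\<bar> \<partial>leb11)"
  have A: "A \<ge> 0" by (simp add: A_def)
  have "\<bar>\<integral>x. f x * \<phi> x \<partial>leb11\<bar> \<le> s * A" if s: "s > 0" for s
  proof -
    obtain h where h: "real_polynomial_function h" "\<And>x. x \<in> {-1..1} \<Longrightarrow> \<bar>\<phi> x - h x\<bar> < s"
      using Stone_Weierstrass_real_polynomial_function[OF compact_Icc c\<phi> s] by blast
    obtain a n where an: "h = (\<lambda>x. \<Sum>i\<le>n. a i * x ^ i)" using h(1) real_polynomial_function_iff_sum by blast
    define p where "p = (\<Sum>i\<le>n. monom (a i) i)"
    have hp: "h x = poly p x" for x by (simp add: an p_def poly_sum poly_monom)
    have b: "\<bar>\<phi> x - poly p x\<bar> \<le> s" if "x \<in> space leb11" for x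
      using h(2)[of x] that unfolding hp by auto
    have m: "(\<lambda>x. \<phi> x - poly p x) \<in> borel_measurable leb11"
      using borel_measurable_leb11I[OF borel_measurable_continuous_onI[OF \<phi>]] poly_measurable_leb11 by simp
    obtain B where B: "\<And>x::real. \<bar>x\<bar> \<le> 1 \<Longrightarrow> \<bar>poly p x\<bar> \<le> B" using poly_bounded_11 by blast
    have i1: "integrable leb11 (\<lambda>x. f x * (\<phi> x - poly p x))" by (rule integrable_times_bounded[OF f m b])
    have i2: "integrable leb11 (\<lambda>x. f x * poly p x)"
      by (rule integrable_times_bounded[OF f poly_measurable_leb11 B]) (auto simp: abs_le_iff)
    have "(\<integral>x. f x * \<phi> x \<partial>leb11) = (\<integral>x. f x * (\<phi> x - poly p x) + f x * poly p x \<partial>leb11)"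
      by (simp add: algebra_simps)
    also have "\<dots> = (\<integral>x. f x * (\<phi> x - poly p x) \<partial>leb11)" using i1 i2 zero by simp
    finally have "\<bar>\<integral>x. f x * \<phi> x \<partial>leb11\<bar> \<le> (\<integral>x. \<bar>f x * (\<phi> x - poly p x)\<bar> \<partial>leb11)"
      using integral_norm_bound[of leb11 "\<lambda>x. f x * (\<phi> x - poly p x)"] by simp
    also have "\<dots> \<le> (\<integral>x. s * \<bar>f x\<bar> \<partial>leb11)"
    proof (rule integral_mono)
      fix x assume "x \<in> space leb11"
      then have "\<bar>f x\<bar> * \<bar>\<phi> x - poly p x\<bar> \<le> \<bar>f x\<bar> * s" by (intro mult_left_mono b) auto
      then show "\<bar>f x * (\<phi> x - poly p x)\<bar> \<le> s * \<bar>f x\<bar>" by (simp add: abs_mult mult.commute)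
    qed (use i1 f in auto)
    finally show ?thesis by (simp add: A_def)
  qed
  then have *: "\<bar>\<integral>x. f x * \<phi> x \<partial>leb11\<bar> \<le> s * A" if "s > 0" for s using that by blast
  show "(\<integral>x. f x * \<phi> x \<partial>leb11) = 0"
  proof (rule ccontr)
    assume "(\<integral>x. f x * \<phi> x \<partial>leb11) \<noteq> 0"
    then have pos: "\<bar>\<integral>x. f x * \<phi> x \<partial>leb11\<bar> > 0" by simp
    have "\<bar>\<integral>x. f x * \<phi> x \<partial>leb11\<bar> \<le> \<bar>\<integral>x. f x * \<phi> x \<partial>leb11\<bar> / (2 * (A + 1)) * A"
      by (rule *) (use pos A in simp)
    also have "\<dots> = \<bar>\<integral>x. f x * \<phi> x \<partial>leb11\<bar> * (A / (2 * (A + 1)))" by simp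
    also have "\<dots> < \<bar>\<integral>x. f x * \<phi> x \<partial>leb11\<bar> * 1"
      using pos A by (intro mult_strict_left_mono) (auto simp: field_simps)
    finally show False by simp
  qed
qed

text \<open>A cutoff times a polynomial is a test function, so the product of \<open>v\<close> with a cutoff is orthogonal to
all polynomials. The cutoffs are eventually \<open>1\<close> at every point of \<open>(-1,1)\<close>. This fundamental lemma makes weak
derivatives unique, so that the representative chosen by \<open>weak_deriv\<close> can be replaced by any other.\<close>

lemma AE_zero_if_orthogonal_to_test_funs:
  assumes v: "locally_integrable_11 v"
    and zero: "\<And>\<phi>. test_fun_11 \<phi> \<Longrightarrow> (\<integral>x. v x * \<phi> x \<partial>leb11) = 0"
  shows "AE x in leb11. v x = 0"
proof -
  define cut where "cut = (\<lambda>k x. smooth_step (real (Suc k) * (1 - x\<^sup>2)) * (1 - x\<^sup>2) powr 0)"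
  have test: "test_fun_11 (\<lambda>x. cut k x * poly p x)" for k p
    unfolding cut_def by (rule test_fun_11_cutoff_powr) simp
  have "AE x in leb11. v x * cut k x = 0" for k
  proof (rule AE_zero_if_orthogonal_to_polys)
    show "integrable leb11 (\<lambda>x. v x * cut k x)"
      using integrable_times_test_fun[OF v test[of k 1]] by simp
    show "(\<integral>x. v x * cut k x * poly p x \<partial>leb11) = 0" for p
      using zero[OF test] by (simp add: mult.assoc)
  qed
  then have "AE x in leb11. \<forall>k. v x * cut k x = 0" unfolding AE_all_countable by (rule allI)
  with AE_space show ?thesis
  proof eventually_elim
    case (elim x)
    have x: "1 - x\<^sup>2 > 0" using elim(1) one_minus_square_pos[of x] by simp
    define k where "k = nat \<lceil>2 / (1 - x\<^sup>2)\<rceil>"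
    have "2 / (1 - x\<^sup>2) \<le> real (Suc k)" unfolding k_def by linarith
    then have "2 \<le> real (Suc k) * (1 - x\<^sup>2)" using x by (simp add: field_simps)
    then have "cut k x = 1" using x by (simp add: cut_def smooth_step_1 del: of_nat_Suc)
    then show ?case using elim(2) by (metis mult_1_right)
  qed
qed

lemma locally_integrable_11_lincomb:
  assumes "locally_integrable_11 u" "locally_integrable_11 v"
  shows "locally_integrable_11 (\<lambda>x. a * u x + b * v x)"
  unfolding locally_integrable_11_iff
proof (intro conjI allI impI)
  show "(\<lambda>x. a * u x + b * v x) \<in> borel_measurable leb11"
    by (intro borel_measurable_add borel_measurable_times borel_measurable_const
      locally_integrable_11_measurable assms)
  fix r :: real assume r: "r < 1"
  have "integrable leb11 (\<lambda>x. a * (indicator {-r..r} x * u x) + b * (indicator {-r..r} x * v x))"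
    using assms r unfolding locally_integrable_11_iff
    by (intro Bochner_Integration.integrable_add Bochner_Integration.integrable_mult_right) simp_all
  then show "integrable leb11 (\<lambda>x. indicator {-r..r} x * (a * u x + b * v x))"
    by (simp add: algebra_simps)
qed

lemma has_weak_deriv_lincomb:
  assumes "has_weak_deriv j u v" "has_weak_deriv j u' v'"
  shows "has_weak_deriv j (\<lambda>x. a * u x + b * u' x) (\<lambda>x. a * v x + b * v' x)"
  unfolding has_weak_deriv_def
proof (intro conjI allI impI)
  have loc: "locally_integrable_11 u" "locally_integrable_11 v"
    "locally_integrable_11 u'" "locally_integrable_11 v'"
    using assms by (auto simp: has_weak_deriv_def)
  show "locally_integrable_11 (\<lambda>x. a * u x + b * u' x)" "locally_integrable_11 (\<lambda>x. a * v x + b * v' x)"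
    by (rule locally_integrable_11_lincomb; fact loc)+
  fix \<phi> assume \<phi>: "test_fun_11 \<phi>"
  have *: "(\<integral>x. (a * f x + b * g x) * \<psi> x \<partial>leb11) = a * (\<integral>x. f x * \<psi> x \<partial>leb11) + b * (\<integral>x. g x * \<psi> x \<partial>leb11)"
    if "locally_integrable_11 f" "locally_integrable_11 g" "test_fun_11 \<psi>" for f g \<psi>
    using integrable_times_test_fun[OF that(1,3)] integrable_times_test_fun[OF that(2,3)]
    by (simp add: distrib_right mult.assoc)
  show "(\<integral>x. (a * u x + b * u' x) * (deriv ^^ j) \<phi> x \<partial>leb11) =
      (-1) ^ j * (\<integral>x. (a * v x + b * v' x) * \<phi> x \<partial>leb11)"
    using assms \<phi> unfolding *[OF loc(1,3) test_fun_11_deriv_iter[OF \<phi>]] *[OF loc(2,4) \<phi>]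
    by (simp add: has_weak_deriv_def algebra_simps)
qed

lemma has_weak_deriv_unique:
  assumes "has_weak_deriv j u v" "has_weak_deriv j u w"
  shows "AE x in leb11. v x = w x"
proof -
  have "AE x in leb11. 1 * v x + (-1) * w x = 0"
  proof (rule AE_zero_if_orthogonal_to_test_funs)
    have *: "has_weak_deriv j (\<lambda>x. 1 * u x + (-1) * u x) (\<lambda>x. 1 * v x + (-1) * w x)"
      by (intro has_weak_deriv_lincomb assms)
    then show "locally_integrable_11 (\<lambda>x. 1 * v x + (-1) * w x)" by (simp add: has_weak_deriv_def)
    show "(\<integral>x. (1 * v x + (-1) * w x) * \<phi> x \<partial>leb11) = 0" if "test_fun_11 \<phi>" for \<phi>
      using * that by (simp add: has_weak_deriv_def)
  qed
  then show ?thesis by simp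
qed

lemma has_weak_deriv_weak_deriv:
  "has_weak_deriv j u v \<Longrightarrow> has_weak_deriv j u (weak_deriv j u)"
  unfolding weak_deriv_def by (rule someI[of "has_weak_deriv j u" v])

lemma weak_deriv_AE_eq:
  "has_weak_deriv j u v \<Longrightarrow> AE x in leb11. weak_deriv j u x = v x"
  using has_weak_deriv_unique has_weak_deriv_weak_deriv by blast

text \<open>Weak derivatives of order \<open>j\<close> are defined by \<open>j\<close>-fold differentiation of the test function; this
lemma makes it possible to argue one order at a time.\<close>

lemma has_weak_deriv_Suc_0:
  assumes "has_weak_deriv j u v" "has_weak_deriv (Suc j) u w"
  shows "has_weak_deriv (Suc 0) v w"
  using assms unfolding has_weak_deriv_def
proof (intro conjI allI impI)
  fix \<phi> assume \<phi>: "test_fun_11 \<phi>"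
  have "(\<integral>x. u x * (deriv ^^ j) (deriv \<phi>) x \<partial>leb11) = (-1) ^ j * (\<integral>x. v x * deriv \<phi> x \<partial>leb11)"
    using assms(1) test_fun_11_deriv[OF \<phi>] by (auto simp: has_weak_deriv_def)
  moreover have "(\<integral>x. u x * (deriv ^^ Suc j) \<phi> x \<partial>leb11) = (-1) ^ Suc j * (\<integral>x. w x * \<phi> x \<partial>leb11)"
    using assms(2) \<phi> by (auto simp: has_weak_deriv_def)
  ultimately show "(\<integral>x. v x * (deriv ^^ Suc 0) \<phi> x \<partial>leb11) = (-1) ^ Suc 0 * (\<integral>x. w x * \<phi> x \<partial>leb11)"
    by (cases "even j") (auto simp: funpow_swap1)
qed auto

lemma has_weak_deriv_0: "locally_integrable_11 u \<Longrightarrow> has_weak_deriv 0 u u"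
  by (simp add: has_weak_deriv_def)

lemma locally_integrable_11_AE_cong:
  assumes "locally_integrable_11 u" "u' \<in> borel_measurable leb11" "AE x in leb11. u x = u' x"
  shows "locally_integrable_11 u'"
proof -
  have "integrable leb11 (\<lambda>x. indicator {-r..r} x * u' x)" if "r < 1" for r
  proof -
    have 1: "integrable leb11 (\<lambda>x. indicator {-r..r} x * u x)" using assms that by (simp add: locally_integrable_11_iff)
    have "(\<lambda>x. indicator {-r..r} x * u' x) \<in> borel_measurable leb11"
      by (intro borel_measurable_times borel_measurable_leb11I assms) simp
    moreover have "AE x in leb11. indicator {-r..r} x * u x = indicator {-r..r} x * u' x"
      using assms(3) by eventually_elim simp
    ultimately show ?thesis
      using integrable_cong_AE[OF borel_measurable_integrable[OF 1]] 1 by blast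
  qed
  then show ?thesis using assms by (simp add: locally_integrable_11_iff)
qed

lemma has_weak_deriv_AE_cong:
  assumes "has_weak_deriv j u v" "u' \<in> borel_measurable leb11" "AE x in leb11. u x = u' x"
  shows "has_weak_deriv j u' v"
proof -
  have loc: "locally_integrable_11 u" "locally_integrable_11 v" using assms by (auto simp: has_weak_deriv_def)
  have loc': "locally_integrable_11 u'" by (rule locally_integrable_11_AE_cong[OF loc(1) assms(2,3)])
  have "(\<integral>x. u' x * \<psi> x \<partial>leb11) = (\<integral>x. u x * \<psi> x \<partial>leb11)" if "test_fun_11 \<psi>" for \<psi>
    using integrable_times_test_fun[OF loc(1) that] integrable_times_test_fun[OF loc' that] assms(3)
    by (intro integral_cong_AE) auto
  then show ?thesis using assms(1) loc loc' test_fun_11_deriv_iter unfolding has_weak_deriv_def by simp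
qed

lemma locally_integrable_11_continuous:
  assumes "continuous_on {-1..1} f"
  shows "locally_integrable_11 f"
  unfolding locally_integrable_11_def
proof safe
  fix K :: "real set" assume K: "compact K" "K \<subseteq> {-1<..<1}"
  have "K \<subseteq> {-1..1}" using K by auto
  then have "continuous_on K f" using assms continuous_on_subset by blast
  then have "integrable lborel (\<lambda>x. indicator K x *\<^sub>R f x)"
    by (rule borel_integrable_compact[OF K(1)])
  then have "integrable lebesgue (\<lambda>x. indicator K x *\<^sub>R f x)"
    using integrable_completion by blast
  then show "integrable (lebesgue_on K) f"
    using fmeasurableD[OF lmeasurable_compact[OF K(1)]] by (subst integrable_restrict_space) auto
qed

lemma integral_deriv_test_fun:
  assumes f: "\<And>x. (f has_field_derivative f' x) (at x)" "continuous_on UNIV f'"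
    and \<phi>: "test_fun_11 \<phi>"
  shows "(\<integral>x. f x * deriv \<phi> x \<partial>leb11) = - (\<integral>x. f' x * \<phi> x \<partial>leb11)"
proof -
  have sm: "smooth \<phi>" and z: "\<phi> (-1) = 0" "\<phi> 1 = 0" using \<phi> by (auto simp: test_fun_11_iff)
  have cf: "continuous_on {-1..1} f" "continuous_on {-1..1} f'"
    using DERIV_isCont[OF f(1)] continuous_on_subset[OF f(2)]
    by (auto intro: continuous_at_imp_continuous_on)
  have "((\<lambda>x. f x * deriv \<phi> x + f' x * \<phi> x) has_integral (f 1 * \<phi> 1 - f (-1) * \<phi> (-1))) {-1..1}"
  proof (rule fundamental_theorem_of_calculus)
    fix x :: real
    show "((\<lambda>x. f x * \<phi> x) has_vector_derivative f x * deriv \<phi> x + f' x * \<phi> x) (at x within {-1..1})"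
      using DERIV_mult[OF f(1) smooth_DERIV[OF sm]]
      by (auto simp: has_real_derivative_iff_has_vector_derivative[symmetric] mult_ac add_ac
          intro: has_field_derivative_at_within)
  qed simp
  then have 0: "((\<lambda>x. f x * deriv \<phi> x + f' x * \<phi> x) has_integral 0) {-1<..<1}"
    using z by (simp add: has_integral_Icc_iff_Ioo)
  have int: "integrable leb11 (\<lambda>x. f x * deriv \<phi> x)" "integrable leb11 (\<lambda>x. f' x * \<phi> x)"
    using cf \<phi> test_fun_11_deriv by (auto intro!: integrable_times_test_fun locally_integrable_11_continuous)
  have "(\<integral>x. f x * deriv \<phi> x + f' x * \<phi> x \<partial>leb11) = 0"
    using 0 lebesgue_integral_eq_integral[OF Bochner_Integration.integrable_add[OF int]]
    by (simp add: integral_unique)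
  then show ?thesis using int by simp
qed

lemma has_weak_deriv_poly: "has_weak_deriv j (poly p) (poly ((pderiv ^^ j) p))"
proof -
  have loc: "locally_integrable_11 (poly q)" for q
    by (intro locally_integrable_11_continuous continuous_on_poly continuous_on_id)
  have "(\<integral>x. poly p x * (deriv ^^ j) \<phi> x \<partial>leb11) = (-1) ^ j * (\<integral>x. poly ((pderiv ^^ j) p) x * \<phi> x \<partial>leb11)"
    if "test_fun_11 \<phi>" for \<phi>
    using that
  proof (induction j arbitrary: \<phi>)
    case (Suc j)
    have "(\<integral>x. poly p x * (deriv ^^ Suc j) \<phi> x \<partial>leb11) = (-1) ^ j * (\<integral>x. poly ((pderiv ^^ j) p) x * deriv \<phi> x \<partial>leb11)"
      using Suc.IH[OF test_fun_11_deriv[OF Suc.prems]] by (simp add: funpow_swap1)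
    also have "(\<integral>x. poly ((pderiv ^^ j) p) x * deriv \<phi> x \<partial>leb11) = - (\<integral>x. poly (pderiv ((pderiv ^^ j) p)) x * \<phi> x \<partial>leb11)"
      by (intro integral_deriv_test_fun Suc.prems poly_DERIV continuous_on_poly continuous_on_id)
    finally show ?case by simp
  qed auto
  then show ?thesis using loc by (simp add: has_weak_deriv_def)
qed

section \<open>Normalized Gegenbauer polynomials\<close>

text \<open>The three-term recurrence of the Gegenbauer polynomials after division by their values at \<open>1\<close>. In
this normalization the parameter \<open>\<alpha> = 0\<close> needs no special treatment: it yields the Chebyshev
polynomials.\<close>

fun gpoly :: "real \<Rightarrow> nat \<Rightarrow> real poly" where
  "gpoly \<alpha> 0 = 1"
| "gpoly \<alpha> (Suc 0) = [:0, 1:]"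
| "gpoly \<alpha> (Suc (Suc n)) = smult (1 / (real n + 1 + 2 * \<alpha>))
     (smult (2 * (real n + 1 + \<alpha>)) ([:0, 1:] * gpoly \<alpha> (Suc n)) - smult (real n + 1) (gpoly \<alpha> n))"

lemma gpoly_rec:
  assumes "\<alpha> \<ge> 0"
  shows "(real n + 1 + 2 * \<alpha>) * poly (gpoly \<alpha> (Suc (Suc n))) x =
    2 * (real n + 1 + \<alpha>) * x * poly (gpoly \<alpha> (Suc n)) x - (real n + 1) * poly (gpoly \<alpha> n) x"
  using assms by (simp add: field_simps)

lemma gpoly_at_1:
  assumes "\<alpha> \<ge> 0"
  shows "poly (gpoly \<alpha> n) 1 = 1"
  using assms
proof (induction \<alpha> n rule: gpoly.induct)
  case (3 \<alpha> n)
  have "(real n + 1 + 2 * \<alpha>) * poly (gpoly \<alpha> (Suc (Suc n))) 1 = (real n + 1 + 2 * \<alpha>) * 1"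
    using 3 gpoly_rec[OF 3(3), of n 1] by (simp add: algebra_simps)
  moreover have "real n + 1 + 2 * \<alpha> \<noteq> 0" using 3(3) by simp
  ultimately show ?case by (metis mult_left_cancel)
qed auto

lemma gpoly_chebyshev: "poly (gpoly 0 n) x = chebyshev n x"
proof (induction n x rule: chebyshev.induct)
  case (3 n x)
  have "(real n + 1) * poly (gpoly 0 (Suc (Suc n))) x = (real n + 1) * chebyshev (Suc (Suc n)) x"
    using gpoly_rec[of 0 n x] 3 by (simp add: algebra_simps)
  then show ?case by (metis mult_left_cancel of_nat_Suc of_nat_neq_0 add.commute)
qed auto

text \<open>The last conjunct, the recurrence for the values at \<open>1\<close>, converts one three-term recurrence into the
other and has to be carried along in the induction.\<close>

lemma gegenbauer_eq_gpoly:
  assumes "\<alpha> > 0"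
  shows "gegenbauer \<alpha> n 1 > 0 \<and> (\<forall>x. gegenbauer \<alpha> n x = gegenbauer \<alpha> n 1 * poly (gpoly \<alpha> n) x) \<and>
    (real n + 1) * gegenbauer \<alpha> (Suc n) 1 = (real n + 2 * \<alpha>) * gegenbauer \<alpha> n 1"
proof (induction n rule: less_induct)
  case (less n)
  consider "n = 0" | "n = Suc 0" | m where "n = Suc (Suc m)"
    using not0_implies_Suc by blast
  then show ?case
  proof cases
    case (3 m)
    let ?g = "gegenbauer \<alpha>"
    have IH0: "?g m 1 > 0" "\<And>x. ?g m x = ?g m 1 * poly (gpoly \<alpha> m) x"
        "(real m + 1) * ?g (Suc m) 1 = (real m + 2 * \<alpha>) * ?g m 1"
      using less[of m] 3 by - (blast intro: lessI less_SucI)+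
    have IH1: "?g (Suc m) 1 > 0" "\<And>x. ?g (Suc m) x = ?g (Suc m) 1 * poly (gpoly \<alpha> (Suc m)) x"
        "(real (Suc m) + 1) * ?g (Suc (Suc m)) 1 = (real (Suc m) + 2 * \<alpha>) * ?g (Suc m) 1"
      using less[of "Suc m"] 3 by - (blast intro: lessI less_SucI)+
    have IH13: "(real m + 2) * ?g (Suc (Suc m)) 1 = (real m + 1 + 2 * \<alpha>) * ?g (Suc m) 1"
      using IH1(3) by (simp add: add_ac del: gegenbauer.simps)
    have pos: "?g (Suc (Suc m)) 1 > 0"
    proof -
      have "?g (Suc (Suc m)) 1 = (real m + 1 + 2 * \<alpha>) * ?g (Suc m) 1 / (real m + 2)"
        using IH13 by (simp add: field_simps del: gegenbauer.simps)
      then show ?thesis using IH1(1) assms by simp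
    qed
    have rec: "(real m + 2) * ?g (Suc (Suc m)) x = 2 * x * (real m + 1 + \<alpha>) * ?g (Suc m) x - (real m + 2 * \<alpha>) * ?g m x" for x
      by simp
    have eq: "?g (Suc (Suc m)) x = ?g (Suc (Suc m)) 1 * poly (gpoly \<alpha> (Suc (Suc m))) x" for x
    proof -
      have "(real m + 2) * ?g (Suc (Suc m)) x
          = 2 * x * (real m + 1 + \<alpha>) * (?g (Suc m) 1 * poly (gpoly \<alpha> (Suc m)) x) - (real m + 2 * \<alpha>) * (?g m 1 * poly (gpoly \<alpha> m) x)"
        unfolding rec using IH0(2)[of x] IH1(2)[of x] by simp
      also have "\<dots> = 2 * x * (real m + 1 + \<alpha>) * (?g (Suc m) 1 * poly (gpoly \<alpha> (Suc m)) x) - (real m + 1) * ?g (Suc m) 1 * poly (gpoly \<alpha> m) x"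
        using IH0(3) by (simp add: mult.assoc[symmetric] del: gegenbauer.simps gpoly.simps)
      also have "\<dots> = ?g (Suc m) 1 * ((real m + 1 + 2 * \<alpha>) * poly (gpoly \<alpha> (Suc (Suc m))) x)"
        unfolding gpoly_rec[OF less_imp_le[OF assms]] by (simp add: algebra_simps del: gegenbauer.simps gpoly.simps)
      also have "\<dots> = (real m + 2) * (?g (Suc (Suc m)) 1 * poly (gpoly \<alpha> (Suc (Suc m))) x)"
        using arg_cong[OF IH13, of "\<lambda>t. t * poly (gpoly \<alpha> (Suc (Suc m))) x"]
        by (simp only: mult_ac)
      finally show ?thesis by (simp del: gegenbauer.simps gpoly.simps)
    qed
    have "(real m + 3) * ?g (Suc (Suc (Suc m))) 1 = 2 * (real m + 2 + \<alpha>) * ?g (Suc (Suc m)) 1 - (real m + 1 + 2 * \<alpha>) * ?g (Suc m) 1"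
    proof -
      have "real (Suc m) + 2 \<noteq> 0" by simp
      then have "?g (Suc (Suc (Suc m))) 1 * (real (Suc m) + 2) =
          2 * 1 * (real (Suc m) + 1 + \<alpha>) * ?g (Suc (Suc m)) 1 - (real (Suc m) + 2 * \<alpha>) * ?g (Suc m) 1"
        unfolding gegenbauer.simps(3)[of \<alpha> "Suc m"] by (rule nonzero_eq_divide_eq[THEN iffD1, OF _ refl])
      then show ?thesis by (simp add: algebra_simps del: gegenbauer.simps)
    qed
    also have "\<dots> = (real m + 2 + 2 * \<alpha>) * ?g (Suc (Suc m)) 1"
      using IH13 by (simp add: algebra_simps del: gegenbauer.simps)
    finally have "(real n + 1) * ?g (Suc n) 1 = (real n + 2 * \<alpha>) * ?g n 1"
      unfolding 3 by (simp add: add_ac del: gegenbauer.simps)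
    then show ?thesis using pos eq unfolding 3 by blast
  qed (use assms in \<open>auto simp: algebra_simps\<close>)
qed

lemma gegenbauer_normalized_eq_poly:
  assumes "d \<ge> 2"
  shows "gegenbauer_normalized d l x = poly (gpoly ((real d - 2) / 2) l) x"
proof (cases "d = 2")
  case True
  then show ?thesis by (simp add: gegenbauer_normalized_def gpoly_chebyshev)
next
  case False
  then have "(real d - 2) / 2 > 0" using assms by simp
  then have "gegenbauer ((real d - 2) / 2) l 1 > 0"
    "gegenbauer ((real d - 2) / 2) l x = gegenbauer ((real d - 2) / 2) l 1 * poly (gpoly ((real d - 2) / 2) l) x"
    using gegenbauer_eq_gpoly[of "(real d - 2) / 2" l] by blast+
  then show ?thesis
    using False by (simp add: gegenbauer_normalized_def)
qed

text \<open>The two differentiation formulas are proved together: differentiating the recurrence, the first one is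
applied to \<open>P\<^bsub>n+1\<^esub>\<close> and the second one to \<open>P\<^sub>n\<close>, so that only \<open>P\<^sub>n\<close> and \<open>P\<^bsub>n+1\<^esub>\<close> remain.\<close>

lemma gpoly_pderiv_eqs:
  assumes "\<alpha> \<ge> 0"
  shows "(1 - x\<^sup>2) * poly (pderiv (gpoly \<alpha> (Suc n))) x =
      (real n + 1) * (poly (gpoly \<alpha> n) x - x * poly (gpoly \<alpha> (Suc n)) x) \<and>
    (1 - x\<^sup>2) * poly (pderiv (gpoly \<alpha> n)) x =
      (real n + 2 * \<alpha>) * (x * poly (gpoly \<alpha> n) x - poly (gpoly \<alpha> (Suc n)) x)"
proof (induction n)
  case 0
  then show ?case by (simp add: pderiv_pCons power2_eq_square algebra_simps)
next
  case (Suc n)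
  let ?c = "real n + 1 + 2 * \<alpha>"
  let ?P = "\<lambda>k. poly (gpoly \<alpha> k) x" and ?D = "\<lambda>k. poly (pderiv (gpoly \<alpha> k)) x"
  have c: "?c \<noteq> 0" using assms by simp
  have rec: "?c * ?P (Suc (Suc n)) = 2 * (real n + 1 + \<alpha>) * x * ?P (Suc n) - (real n + 1) * ?P n"
    by (rule gpoly_rec[OF assms])
  have drec: "?c * ?D (Suc (Suc n)) = 2 * (real n + 1 + \<alpha>) * (?P (Suc n) + x * ?D (Suc n)) - (real n + 1) * ?D n"
    using c by (simp add: pderiv_smult pderiv_diff pderiv_mult pderiv_pCons field_simps)
  have 2: "(1 - x\<^sup>2) * ?D (Suc n) = ?c * (x * ?P (Suc n) - ?P (Suc (Suc n)))"
  proof -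
    have "?c * (x * ?P (Suc n) - ?P (Suc (Suc n))) = ?c * x * ?P (Suc n) - ?c * ?P (Suc (Suc n))"
      by (simp add: algebra_simps del: gpoly.simps)
    also have "\<dots> = (real n + 1) * (?P n - x * ?P (Suc n))"
      unfolding rec by (simp add: algebra_simps del: gpoly.simps)
    finally show ?thesis using Suc.IH by (simp del: gpoly.simps)
  qed
  have "?c * ((1 - x\<^sup>2) * ?D (Suc (Suc n)))
      = 2 * (real n + 1 + \<alpha>) * ((1 - x\<^sup>2) * ?P (Suc n) + x * ((1 - x\<^sup>2) * ?D (Suc n))) - (real n + 1) * ((1 - x\<^sup>2) * ?D n)"
    using arg_cong[OF drec, of "\<lambda>t. (1 - x\<^sup>2) * t"] by (simp add: algebra_simps del: gpoly.simps)
  also have "\<dots> = 2 * (real n + 1 + \<alpha>) * ((1 - x\<^sup>2) * ?P (Suc n) + x * ((real n + 1) * (?P n - x * ?P (Suc n))))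
      - (real n + 1) * ((real n + 2 * \<alpha>) * (x * ?P n - ?P (Suc n)))"
    using Suc.IH by (simp only:)
  also have "\<dots> = (real n + 2) * (?c * ?P (Suc n) - x * (?c * ?P (Suc (Suc n))))"
    unfolding rec by (simp add: algebra_simps power2_eq_square del: gpoly.simps)
  also have "\<dots> = ?c * ((real n + 2) * (?P (Suc n) - x * ?P (Suc (Suc n))))"
    by (simp add: algebra_simps del: gpoly.simps)
  finally have 1: "(1 - x\<^sup>2) * ?D (Suc (Suc n)) = (real n + 2) * (?P (Suc n) - x * ?P (Suc (Suc n)))"
    using c by (metis mult_left_cancel)
  show ?case using 1 2 by (simp add: add_ac del: gpoly.simps)
qed

text \<open>Differentiating the first formula of \<open>gpoly_pderiv_eqs\<close> and eliminating \<open>P\<^bsub>n-1\<^esub>\<close> and its derivative by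
the two formulas gives the equation multiplied by \<open>1 - x\<^sup>2\<close>, a factor that may be cancelled in the ring of
polynomials.\<close>

lemma gpoly_ODE:
  assumes "\<alpha> \<ge> 0"
  shows "(1 - x\<^sup>2) * poly (pderiv (pderiv (gpoly \<alpha> n))) x - (2 * \<alpha> + 1) * x * poly (pderiv (gpoly \<alpha> n)) x
    + real n * (real n + 2 * \<alpha>) * poly (gpoly \<alpha> n) x = 0"
proof (cases n)
  case (Suc m)
  let ?p = "gpoly \<alpha> (Suc m)" and ?q = "gpoly \<alpha> m"
  define X :: "real poly" where "X = [:0, 1:]"
  define W :: "real poly" where "W = [:1, 0, -1:]"
  have W: "poly W y = 1 - y\<^sup>2" "poly X y = y" "poly (pderiv W) y = -2 * y" "pderiv X = 1" "W \<noteq> 0" for y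
    by (simp_all add: W_def X_def pderiv_pCons power2_eq_square)
  have e1: "W * pderiv ?p = smult (real m + 1) (?q - X * ?p)"
  proof (intro poly_eq_poly_eq_iff[THEN iffD1] ext)
    fix y
    show "poly (W * pderiv ?p) y = poly (smult (real m + 1) (?q - X * ?p)) y"
      using gpoly_pderiv_eqs[OF assms, of y m] by (simp add: W algebra_simps del: gpoly.simps)
  qed
  have e2: "W * pderiv ?q = smult (real m + 2 * \<alpha>) (X * ?q - ?p)"
  proof (intro poly_eq_poly_eq_iff[THEN iffD1] ext)
    fix y
    show "poly (W * pderiv ?q) y = poly (smult (real m + 2 * \<alpha>) (X * ?q - ?p)) y"
      using gpoly_pderiv_eqs[OF assms, of y m] by (simp add: W algebra_simps del: gpoly.simps)
  qed
  define L where "L = W * pderiv (pderiv ?p) - smult (2 * \<alpha> + 1) (X * pderiv ?p) + smult ((real m + 1) * (real m + 1 + 2 * \<alpha>)) ?p"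
  have "poly (W * L) y = 0" for y
  proof -
    let ?w = "1 - y\<^sup>2" and ?P = "poly ?p y" and ?Q = "poly ?q y" and ?P1 = "poly (pderiv ?p) y"
      and ?P2 = "poly (pderiv (pderiv ?p)) y" and ?Q1 = "poly (pderiv ?q) y"
    have "poly (pderiv (W * pderiv ?p)) y = poly (pderiv (smult (real m + 1) (?q - X * ?p))) y"
      by (simp only: e1)
    then have a: "?w * ?P2 = 2 * y * ?P1 + (real m + 1) * (?Q1 - ?P - y * ?P1)"
      by (simp add: pderiv_mult pderiv_diff pderiv_smult pderiv_pCons W power2_eq_square algebra_simps del: gpoly.simps)
    have b: "?w * ?Q1 = (real m + 2 * \<alpha>) * (y * ?Q - ?P)"
      using gpoly_pderiv_eqs[OF assms, of y m] by simp
    have c: "(real m + 1) * ?Q = ?w * ?P1 + (real m + 1) * y * ?P"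
      using gpoly_pderiv_eqs[OF assms, of y m] by (simp add: algebra_simps del: gpoly.simps)
    have "poly (W * L) y = ?w * (?w * ?P2 - (2 * \<alpha> + 1) * y * ?P1 + (real m + 1) * (real m + 1 + 2 * \<alpha>) * ?P)"
      unfolding L_def by (simp add: W power2_eq_square algebra_simps del: gpoly.simps)
    also have "\<dots> = ?w * (2 * y * ?P1 - (2 * \<alpha> + 1) * y * ?P1 - (real m + 1) * (?P + y * ?P1) + (real m + 1) * (real m + 1 + 2 * \<alpha>) * ?P)
       + (real m + 1) * (?w * ?Q1)"
      unfolding a by (simp only: algebra_simps)
    also have "\<dots> = ?w * (2 * y * ?P1 - (2 * \<alpha> + 1) * y * ?P1 - (real m + 1) * (?P + y * ?P1) + (real m + 1) * (real m + 1 + 2 * \<alpha>) * ?P)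
       + (real m + 2 * \<alpha>) * (y * ((real m + 1) * ?Q) - (real m + 1) * ?P)"
      unfolding b by (simp only: algebra_simps)
    also have "\<dots> = 0"
      unfolding c by (simp add: algebra_simps power2_eq_square del: gpoly.simps)
    finally show ?thesis .
  qed
  then have "W * L = 0" by (intro poly_eq_poly_eq_iff[THEN iffD1] ext) simp
  then have "L = 0" using W(5) by simp
  then have "poly L x = 0" by simp
  then show ?thesis unfolding L_def Suc by (simp add: W power2_eq_square algebra_simps del: gpoly.simps)
qed simp

text \<open>The eigenvalue belonging to the \<open>j\<close>-th derivative of \<open>P\<^sub>n\<close>. It vanishes for \<open>j = n\<close>, where that derivative
is constant.\<close>

definition eigval :: "real \<Rightarrow> nat \<Rightarrow> nat \<Rightarrow> real" where
  "eigval \<alpha> j n = (real n - real j) * (real n + real j + 2 * \<alpha>)"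

definition gderiv :: "real \<Rightarrow> nat \<Rightarrow> nat \<Rightarrow> real poly" where
  "gderiv \<alpha> j n = (pderiv ^^ j) (gpoly \<alpha> n)"

lemma pderiv_gderiv: "pderiv (gderiv \<alpha> j n) = gderiv \<alpha> (Suc j) n"
  by (simp add: gderiv_def)

lemma gderiv_ODE:
  assumes "\<alpha> \<ge> 0"
  shows "(1 - x\<^sup>2) * poly (gderiv \<alpha> (Suc (Suc j)) n) x - (2 * \<alpha> + 2 * real j + 1) * x * poly (gderiv \<alpha> (Suc j) n) x
    + eigval \<alpha> j n * poly (gderiv \<alpha> j n) x = 0"
proof (induction j arbitrary: x)
  case 0
  then show ?case using gpoly_ODE[OF assms, of x n] by (simp add: gderiv_def eigval_def)
next
  case (Suc j)
  define X :: "real poly" where "X = [:0, 1:]"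
  define W :: "real poly" where "W = [:1, 0, -1:]"
  have W: "poly W y = 1 - y\<^sup>2" "poly X y = y" "poly (pderiv W) y = -2 * y" "pderiv X = 1" for y
    by (simp_all add: W_def X_def pderiv_pCons power2_eq_square)
  have "W * gderiv \<alpha> (Suc (Suc j)) n - smult (2 * \<alpha> + 2 * real j + 1) (X * gderiv \<alpha> (Suc j) n)
      + smult (eigval \<alpha> j n) (gderiv \<alpha> j n) = 0"
    (is "?L = 0")
  proof (intro poly_eq_poly_eq_iff[THEN iffD1] ext)
    fix y
    show "poly ?L y = poly 0 y"
      using Suc[of y] by (simp add: W algebra_simps)
  qed
  from arg_cong[OF this, of "\<lambda>p. poly (pderiv p) x"] show ?case
    by (simp add: W pderiv_mult pderiv_diff pderiv_add pderiv_smult pderiv_gderiv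
      eigval_def power2_eq_square algebra_simps)
qed

lemma gpoly_at_minus_1:
  assumes "\<alpha> \<ge> 0"
  shows "\<bar>poly (gpoly \<alpha> n) (-1)\<bar> = 1"
proof -
  have "poly (gpoly \<alpha> n) (-x) = (-1) ^ n * poly (gpoly \<alpha> n) x" for x
    using assms
  proof (induction \<alpha> n rule: gpoly.induct)
    case (3 \<alpha> n)
    have "(real n + 1 + 2 * \<alpha>) * poly (gpoly \<alpha> (Suc (Suc n))) (-x)
        = (-1) ^ n * (2 * (real n + 1 + \<alpha>) * x * poly (gpoly \<alpha> (Suc n)) x - (real n + 1) * poly (gpoly \<alpha> n) x)"
      unfolding gpoly_rec[OF 3(3)] 3(1)[OF 3(3)] 3(2)[OF 3(3)]
      by (simp add: algebra_simps del: gpoly.simps)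
    also have "\<dots> = (real n + 1 + 2 * \<alpha>) * ((-1) ^ Suc (Suc n) * poly (gpoly \<alpha> (Suc (Suc n))) x)"
      unfolding gpoly_rec[OF 3(3), of n x, symmetric] by (simp add: algebra_simps del: gpoly.simps)
    finally have "(real n + 1 + 2 * \<alpha>) * poly (gpoly \<alpha> (Suc (Suc n))) (-x)
        = (real n + 1 + 2 * \<alpha>) * ((-1) ^ Suc (Suc n) * poly (gpoly \<alpha> (Suc (Suc n))) x)" .
    moreover have "real n + 1 + 2 * \<alpha> \<noteq> 0" using 3(3) by simp
    ultimately show ?case by (metis mult_left_cancel)
  qed auto
  from this[of 1] show ?thesis using gpoly_at_1[OF assms] by (simp add: power_abs)
qed

text \<open>The function \<open>p\<^sup>2 + (1 - x\<^sup>2) p'\<^sup>2 / \<lambda>\<close> of a solution of the equation has derivative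
  \<open>4 \<alpha> x p'\<^sup>2 / \<lambda>\<close>, so it is largest at the endpoints, where it equals \<open>1\<close>.\<close>

lemma gpoly_bounded:
  assumes "\<alpha> \<ge> 0" "\<bar>x\<bar> \<le> 1"
  shows "\<bar>poly (gpoly \<alpha> n) x\<bar> \<le> 1"
proof (cases "n = 0")
  case False
  let ?p = "poly (gpoly \<alpha> n)" and ?p1 = "poly (gderiv \<alpha> 1 n)" and ?p2 = "poly (gderiv \<alpha> 2 n)"
  define l where "l = real n * (real n + 2 * \<alpha>)"
  have l: "l > 0" using False assms by (simp add: l_def)
  define f where "f = (\<lambda>x. l * (?p x)\<^sup>2 + (1 - x\<^sup>2) * (?p1 x)\<^sup>2)"
  have ode: "(1 - y\<^sup>2) * ?p2 y - (2 * \<alpha> + 1) * y * ?p1 y + l * ?p y = 0" for y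
    using gderiv_ODE[OF assms(1), of y 0 n] by (simp add: eigval_def l_def gderiv_def numeral_2_eq_2)
  have D: "(f has_field_derivative 4 * \<alpha> * y * (?p1 y)\<^sup>2) (at y)" for y
  proof -
    have d1: "(?p has_field_derivative ?p1 y) (at y)" using poly_DERIV[of "gpoly \<alpha> n" y] by (simp add: gderiv_def)
    have d2: "(?p1 has_field_derivative ?p2 y) (at y)"
      using poly_DERIV[of "gderiv \<alpha> 1 n" y] by (simp add: gderiv_def numeral_2_eq_2)
    have "(f has_field_derivative l * (2 * ?p y * ?p1 y) + (-2 * y * (?p1 y)\<^sup>2 + (1 - y\<^sup>2) * (2 * ?p1 y * ?p2 y))) (at y)"
      unfolding f_def by (rule derivative_eq_intros d1 d2 refl | simp add: algebra_simps)+
    moreover have "l * (2 * ?p y * ?p1 y) + (-2 * y * (?p1 y)\<^sup>2 + (1 - y\<^sup>2) * (2 * ?p1 y * ?p2 y))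
      = 2 * ?p1 y * ((1 - y\<^sup>2) * ?p2 y - (2 * \<alpha> + 1) * y * ?p1 y + l * ?p y) + 4 * \<alpha> * y * (?p1 y)\<^sup>2"
      by (simp add: algebra_simps power2_eq_square)
    ultimately show ?thesis unfolding ode by simp
  qed
  have "f x \<le> l"
  proof (cases "x \<ge> 0")
    case True
    have "f x \<le> f 1"
    proof (rule DERIV_nonneg_imp_nondecreasing[where f=f and a=x and b=1])
      show "x \<le> 1" using assms by simp
      show "\<exists>y'. (f has_field_derivative y') (at y) \<and> 0 \<le> y'" if "x \<le> y" "y \<le> 1" for y
        using D[of y] that True assms by (intro exI[of _ "4 * \<alpha> * y * (?p1 y)\<^sup>2"] conjI) auto
    qed
    then show ?thesis using gpoly_at_1[OF assms(1), of n] by (simp add: f_def)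
  next
    case False
    have "f x \<le> f (-1)"
    proof (rule DERIV_nonpos_imp_nonincreasing[where f=f and a="-1" and b=x])
      show "-1 \<le> x" using assms by simp
      show "\<exists>y'. (f has_field_derivative y') (at y) \<and> y' \<le> 0" if "-1 \<le> y" "y \<le> x" for y
      proof (intro exI conjI)
        show "4 * \<alpha> * y * (?p1 y)\<^sup>2 \<le> 0"
          using that False assms by (intro mult_nonpos_nonneg mult_nonneg_nonpos) auto
      qed (rule D)
    qed
    moreover have "(?p (-1))\<^sup>2 = 1" using gpoly_at_minus_1[OF assms(1), of n] by (metis abs_1 power2_abs power_one)
    ultimately show ?thesis by (simp add: f_def)
  qed
  moreover have "0 \<le> (1 - x\<^sup>2) * (?p1 x)\<^sup>2"
    using assms(2) by (intro mult_nonneg_nonneg) (auto simp: abs_square_le_1)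
  ultimately have "l * (?p x)\<^sup>2 \<le> l * 1" unfolding f_def by simp
  then have "(?p x)\<^sup>2 \<le> 1" using l by simp
  then show ?thesis by (simp add: abs_square_le_1)
qed simp

lemma degree_gpoly:
  assumes "\<alpha> \<ge> 0"
  shows "degree (gpoly \<alpha> n) = n \<and> lead_coeff (gpoly \<alpha> n) > 0"
  using assms
proof (induction \<alpha> n rule: gpoly.induct)
  case (3 \<alpha> n)
  let ?A = "smult (2 * (real n + 1 + \<alpha>)) ([:0, 1:] * gpoly \<alpha> (Suc n))" and ?B = "smult (real n + 1) (gpoly \<alpha> n)"
  have IH: "degree (gpoly \<alpha> n) = n" "degree (gpoly \<alpha> (Suc n)) = Suc n" "lead_coeff (gpoly \<alpha> (Suc n)) > 0"
    using 3 by auto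
  have nz: "gpoly \<alpha> (Suc n) \<noteq> 0" using IH by auto
  have dA: "degree ?A = Suc (Suc n)" using IH nz 3(3) by (simp del: gpoly.simps)
  have dB: "degree ?B < Suc (Suc n)" using IH by simp
  have cA: "coeff ?A (Suc (Suc n)) = 2 * (real n + 1 + \<alpha>) * lead_coeff (gpoly \<alpha> (Suc n))"
    using IH by (simp del: gpoly.simps)
  have cB: "coeff ?B (Suc (Suc n)) = 0" by (rule coeff_eq_0[OF dB])
  have "coeff (gpoly \<alpha> (Suc (Suc n))) (Suc (Suc n)) = 1 / (real n + 1 + 2 * \<alpha>) * (coeff ?A (Suc (Suc n)) - coeff ?B (Suc (Suc n)))"
    by (simp only: gpoly.simps(3) coeff_smult[of "1 / (real n + 1 + 2 * \<alpha>)"] coeff_diff)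
  also have "\<dots> > 0"
    unfolding cA cB using IH(3) 3(3) by (simp del: gpoly.simps)
  finally have pos: "coeff (gpoly \<alpha> (Suc (Suc n))) (Suc (Suc n)) > 0" .
  have "degree (?A - ?B) \<le> Suc (Suc n)" using dA dB by (intro degree_diff_le) auto
  then have "degree (gpoly \<alpha> (Suc (Suc n))) \<le> Suc (Suc n)"
    unfolding gpoly.simps(3) using degree_smult_le le_trans by blast
  moreover have "degree (gpoly \<alpha> (Suc (Suc n))) \<ge> Suc (Suc n)" by (rule le_degree[OF less_imp_neq[OF pos, THEN not_sym]])
  ultimately have "degree (gpoly \<alpha> (Suc (Suc n))) = Suc (Suc n)" by (rule antisym)
  then show ?case using pos by (metis (no_types))
qed auto

lemma degree_gderiv:
  assumes "\<alpha> \<ge> 0"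
  shows "degree (gderiv \<alpha> j n) = n - j"
proof (induction j)
  case 0 then show ?case using degree_gpoly[OF assms] by (simp add: gderiv_def)
next
  case (Suc j)
  then show ?case by (simp add: pderiv_gderiv[symmetric] degree_pderiv)
qed

lemma gderiv_neq_0:
  assumes "\<alpha> \<ge> 0" "j \<le> n"
  shows "gderiv \<alpha> j n \<noteq> 0"
  using assms(2)
proof (induction j)
  case 0
  then show ?case using degree_gpoly[OF assms(1), of n] by (auto simp: gderiv_def)
next
  case (Suc j)
  then show ?case using degree_gderiv[OF assms(1), of j n]
    by (auto simp: pderiv_gderiv[symmetric] pderiv_eq_0_iff)
qed

text \<open>The derivatives of order \<open>j\<close> contain one polynomial of every degree.\<close>

lemma gderiv_span:
  fixes I :: "real poly \<Rightarrow> real"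
  assumes \<alpha>: "\<alpha> \<ge> 0"
    and lin: "\<And>p q c. I (p + smult c q) = I p + c * I q"
    and zero: "\<And>n. I (gderiv \<alpha> j n) = 0"
  shows "I p = 0"
proof -
  have I0: "I 0 = 0" using lin[of 0 "-1" 0] by simp
  have "p = 0 \<or> degree p < m \<Longrightarrow> I p = 0" for m p
  proof (induction m arbitrary: p)
    case (Suc m)
    show ?case
    proof (cases "p = 0 \<or> degree p < m")
      case False
      then have dp: "degree p = m" "p \<noteq> 0" using Suc.prems by auto
      let ?q = "gderiv \<alpha> j (m + j)"
      have dq: "degree ?q = m" and q0: "?q \<noteq> 0"
        using degree_gderiv[OF \<alpha>, of j "m + j"] gderiv_neq_0[OF \<alpha>, of j "m + j"] by auto
      define c where "c = lead_coeff p / lead_coeff ?q"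
      let ?r = "p + smult (- c) ?q"
      have "coeff ?q m \<noteq> 0" using dq q0 by (metis leading_coeff_0_iff)
      then have cr: "coeff ?r m = 0" using dp dq by (simp add: c_def)
      have "degree ?r \<le> m" by (intro degree_add_le) (use dp dq degree_smult_le[of "-c" ?q] in auto)
      then have "?r = 0 \<or> degree ?r < m"
        using cr by (metis leading_coeff_0_iff le_neq_implies_less)
      then have "I ?r = 0" by (rule Suc.IH)
      then show ?thesis using lin[of p "-c" ?q] zero by simp
    qed (rule Suc.IH)
  qed (use I0 in auto)
  from this[of p "Suc (degree p)"] show ?thesis by simp
qed

section \<open>The weighted measures\<close>

definition wmeas :: "real \<Rightarrow> real measure" where
  "wmeas b = density leb11 (\<lambda>x. ennreal ((1 - x\<^sup>2) powr b))"

lemma weight_measurable: "(\<lambda>x. (1 - x\<^sup>2) powr b) \<in> borel_measurable leb11"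
  by (rule borel_measurable_leb11I) measurable

lemma space_wmeas [simp]: "space (wmeas b) = {-1<..<1}"
  by (simp add: wmeas_def space_restrict_space)

lemma sets_wmeas [simp, measurable_cong]: "sets (wmeas b) = sets leb11"
  by (simp add: wmeas_def)

lemma measurable_wmeas [simp]: "borel_measurable (wmeas b) = borel_measurable leb11"
  by (rule measurable_cong_sets) simp_all

lemma AE_wmeas [simp]: "(AE x in wmeas b. P x) \<longleftrightarrow> (AE x in leb11. P x)"
proof -
  have "(AE x in wmeas b. P x) \<longleftrightarrow> (AE x in leb11. 0 < ennreal ((1 - x\<^sup>2) powr b) \<longrightarrow> P x)"
    unfolding wmeas_def by (rule AE_density) (use weight_measurable in measurable)
  also have "\<dots> \<longleftrightarrow> (AE x in leb11. P x)"
    by (rule AE_cong) (use one_minus_square_pos in fastforce)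
  finally show ?thesis .
qed

lemma integrable_wmeas_iff:
  "f \<in> borel_measurable leb11 \<Longrightarrow>
    integrable (wmeas b) f \<longleftrightarrow> integrable leb11 (\<lambda>x. (1 - x\<^sup>2) powr b * f x)" for f :: "real \<Rightarrow> real"
  unfolding wmeas_def by (subst integrable_density) (simp_all add: weight_measurable)

lemma integral_wmeas:
  "f \<in> borel_measurable leb11 \<Longrightarrow>
    (\<integral>x. f x \<partial>wmeas b) = (\<integral>x. (1 - x\<^sup>2) powr b * f x \<partial>leb11)" for f :: "real \<Rightarrow> real"
  unfolding wmeas_def by (subst integral_density) (simp_all add: weight_measurable)

lemma nn_integral_wmeas:
  "f \<in> borel_measurable leb11 \<Longrightarrow>
    (\<integral>\<^sup>+x. f x \<partial>wmeas b) = (\<integral>\<^sup>+x. ennreal ((1 - x\<^sup>2) powr b) * f x \<partial>leb11)"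
  unfolding wmeas_def by (rule nn_integral_density) (use weight_measurable in measurable)

lemma integrable_wmeas_measurable: "integrable (wmeas b) f \<Longrightarrow> f \<in> borel_measurable leb11"
  for f :: "real \<Rightarrow> real"
  using borel_measurable_integrable[of "wmeas b" f] by simp

text \<open>The weights decrease in the exponent because \<open>1 - x\<^sup>2 \<le> 1\<close>.\<close>

lemma integrable_wmeas_mono:
  fixes f :: "real \<Rightarrow> real"
  assumes "integrable (wmeas b) f" "b \<le> c"
  shows "integrable (wmeas c) f"
proof -
  have f: "f \<in> borel_measurable leb11" using assms(1) by (rule integrable_wmeas_measurable)
  have "integrable leb11 (\<lambda>x. (1 - x\<^sup>2) powr b * f x * (1 - x\<^sup>2) powr (c - b))"
  proof (rule integrable_times_bounded)
    show "integrable leb11 (\<lambda>x. (1 - x\<^sup>2) powr b * f x)" using assms(1) f by (simp add: integrable_wmeas_iff)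
    show "\<bar>(1 - x\<^sup>2) powr (c - b)\<bar> \<le> 1" if "x \<in> space leb11" for x
      using that one_minus_square_pos[of x] assms(2) by (simp add: powr_le1)
  qed (rule weight_measurable)
  also have "?this \<longleftrightarrow> integrable leb11 (\<lambda>x. (1 - x\<^sup>2) powr c * f x)"
  proof (rule Bochner_Integration.integrable_cong[OF refl])
    fix x assume "x \<in> space leb11"
    have "(1 - x\<^sup>2) powr c = (1 - x\<^sup>2) powr b * (1 - x\<^sup>2) powr (c - b)" by (simp flip: powr_add)
    then show "(1 - x\<^sup>2) powr b * f x * (1 - x\<^sup>2) powr (c - b) = (1 - x\<^sup>2) powr c * f x" by simp
  qed
  finally show ?thesis using f by (simp add: integrable_wmeas_iff)
qed

text \<open>Finiteness for the most singular weight comes from its primitive \<open>arcsin\<close>; it dominates the others.\<close>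

lemma finite_measure_wmeas:
  assumes "b \<ge> -1/2"
  shows "finite_measure (wmeas b)"
proof -
  have "((\<lambda>x. inverse (sqrt (1 - x\<^sup>2))) has_integral (arcsin 1 - arcsin (-1))) {-1..1}"
  proof (rule fundamental_theorem_of_calculus_interior)
    fix x :: real assume "x \<in> {-1<..<1}"
    then show "(arcsin has_vector_derivative inverse (sqrt (1 - x\<^sup>2))) (at x)"
      by (intro has_real_derivative_iff_has_vector_derivative[THEN iffD1] DERIV_arcsin) auto
  qed (auto intro!: continuous_on_arcsin' continuous_intros)
  then have "(\<lambda>x. inverse (sqrt (1 - x\<^sup>2))) integrable_on {-1<..<1::real}"
    unfolding has_integral_Icc_iff_Ioo by (rule has_integral_integrable)
  then have "(\<lambda>x. inverse (sqrt (1 - x\<^sup>2))) absolutely_integrable_on {-1<..<1::real}"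
    by (rule nonnegative_absolutely_integrable_1) (use one_minus_square_pos in \<open>auto intro: less_imp_le\<close>)
  then have "integrable leb11 (\<lambda>x. inverse (sqrt (1 - x\<^sup>2)))"
    by (simp add: integrable_leb11_iff set_integrable_def)
  also have "?this \<longleftrightarrow> integrable leb11 (\<lambda>x. (1 - x\<^sup>2) powr (-1/2) * 1)"
  proof (rule Bochner_Integration.integrable_cong[OF refl])
    fix x assume "x \<in> space leb11"
    then have "1 - x\<^sup>2 > 0" using one_minus_square_pos by simp
    then show "inverse (sqrt (1 - x\<^sup>2)) = (1 - x\<^sup>2) powr (-1/2) * 1"
      by (simp add: powr_minus powr_half_sqrt)
  qed
  finally have "integrable (wmeas (-1/2)) (\<lambda>x. 1 :: real)" by (simp add: integrable_wmeas_iff)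
  then have "integrable (wmeas b) (\<lambda>x. 1 :: real)" using assms by (rule integrable_wmeas_mono)
  then show ?thesis
    using integrable_iff_bounded[of "wmeas b" "\<lambda>x. 1 :: real"] by (intro finite_measureI) (simp add: less_top)
qed

lemma weight_bounded_inside:
  fixes r b :: real
  assumes "r < 1"
  shows "\<exists>B>0. \<forall>x\<in>{-r..r}. \<bar>(1 - x\<^sup>2) powr b\<bar> \<le> B"
proof -
  have "continuous_on {-r..r} (\<lambda>x. (1 - x\<^sup>2) powr b)"
    using assms by (intro continuous_intros) (auto simp: power2_eq_1_iff)
  then have "bounded ((\<lambda>x. (1 - x\<^sup>2) powr b) ` {-r..r})"
    by (intro compact_imp_bounded compact_continuous_image) auto
  then show ?thesis unfolding bounded_pos by auto
qed

lemma integrable_wmeas_imp_locally_integrable: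
  assumes "integrable (wmeas b) f"
  shows "locally_integrable_11 f"
  unfolding locally_integrable_11_iff
proof (intro conjI allI impI)
  show f: "f \<in> borel_measurable leb11" using assms by (rule integrable_wmeas_measurable)
  fix r :: real assume r: "r < 1"
  obtain B where B: "B > 0" "\<And>x. x \<in> {-r..r} \<Longrightarrow> \<bar>(1 - x\<^sup>2) powr (-b)\<bar> \<le> B"
    using weight_bounded_inside[OF r, of "-b"] by blast
  have "integrable leb11 (\<lambda>x. (1 - x\<^sup>2) powr b * f x * (indicator {-r..r} x * (1 - x\<^sup>2) powr (-b)))"
  proof (rule integrable_times_bounded)
    show "integrable leb11 (\<lambda>x. (1 - x\<^sup>2) powr b * f x)" using assms f by (simp add: integrable_wmeas_iff)
    show "(\<lambda>x. indicator {-r..r} x * (1 - x\<^sup>2) powr (-b)) \<in> borel_measurable leb11"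
      by (intro borel_measurable_times weight_measurable borel_measurable_leb11I) simp
    show "\<bar>indicator {-r..r} x * (1 - x\<^sup>2) powr (-b)\<bar> \<le> B" for x
      using B by (auto simp: indicator_def)
  qed
  also have "?this \<longleftrightarrow> integrable leb11 (\<lambda>x. indicator {-r..r} x * f x)"
  proof (rule Bochner_Integration.integrable_cong[OF refl])
    fix x assume "x \<in> space leb11"
    then have "(1 - x\<^sup>2) powr b * (1 - x\<^sup>2) powr (-b) = 1"
      using one_minus_square_pos[of x] by (simp flip: powr_add)
    then show "(1 - x\<^sup>2) powr b * f x * (indicator {-r..r} x * (1 - x\<^sup>2) powr (-b)) = indicator {-r..r} x * f x"
      by (simp add: algebra_simps)
  qed
  finally show "integrable leb11 (\<lambda>x. indicator {-r..r} x * f x)" .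
qed

lemma integrable_wmeas_times_poly:
  assumes "integrable (wmeas b) f"
  shows "integrable (wmeas b) (\<lambda>x. f x * poly p x)"
proof -
  obtain B where "B \<ge> 0" "\<And>x::real. \<bar>x\<bar> \<le> 1 \<Longrightarrow> \<bar>poly p x\<bar> \<le> B" using poly_bounded_11 by blast
  then show ?thesis
    by (intro integrable_times_bounded[OF assms, where B=B]) (auto simp: poly_measurable_leb11 abs_le_iff)
qed

lemma integrable_wmeas_poly:
  assumes "b \<ge> -1/2"
  shows "integrable (wmeas b) (poly p)"
proof -
  interpret finite_measure "wmeas b" by (rule finite_measure_wmeas[OF assms])
  show ?thesis using integrable_wmeas_times_poly[OF integrable_const[of 1], of p] by simp
qed

text \<open>The test functions \<open>\<chi> q (1 - x\<^sup>2)\<^bsup>b+1\<^esup>\<close> with cutoffs \<open>\<chi>(x) = smooth_step (k (1 - x\<^sup>2))\<close> produce the formula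
in the limit \<open>k \<rightarrow> \<infinity>\<close>. No boundary term survives because \<open>(1 - x\<^sup>2) \<chi>'\<close>, which is \<open>-2 x T\<close> in the proof, is
bounded uniformly in \<open>k\<close> and vanishes at every point for large \<open>k\<close>.\<close>

lemma weighted_integration_by_parts:
  assumes uv: "has_weak_deriv (Suc 0) u v"
    and u: "integrable (wmeas b) u" and v: "integrable (wmeas (b + 1)) v"
  shows "(\<integral>x. v x * poly q x \<partial>wmeas (b + 1)) =
    (\<integral>x. u x * (2 * (b + 1) * x * poly q x - (1 - x\<^sup>2) * poly (pderiv q) x) \<partial>wmeas b)"
proof -
  define r :: "real poly" where "r = smult (2 * (b + 1)) ([:0, 1:] * q) - [:1, 0, -1:] * pderiv q"
  have r: "2 * (b + 1) * x * poly q x - (1 - x\<^sup>2) * poly (pderiv q) x = poly r x" for x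
    by (simp add: r_def power2_eq_square algebra_simps)
  have um: "u \<in> borel_measurable leb11" and vm: "v \<in> borel_measurable leb11"
    using u v integrable_wmeas_measurable by auto
  define cut where "cut = (\<lambda>k x. smooth_step (real (Suc k) * (1 - x\<^sup>2)))"
  define T where "T = (\<lambda>k x. real (Suc k) * (1 - x\<^sup>2) * deriv smooth_step (real (Suc k) * (1 - x\<^sup>2)))"
  define \<phi> where "\<phi> = (\<lambda>k x. cut k x * (1 - x\<^sup>2) powr (b + 1) * poly q x)"
  define g where "g = (\<lambda>k x. - 2 * x * poly q x * T k x - cut k x * poly r x)"
  have test: "test_fun_11 (\<phi> k)" for k
    unfolding \<phi>_def cut_def by (rule test_fun_11_cutoff_powr) simp
  have D: "deriv (\<phi> k) x = (1 - x\<^sup>2) powr b * g k x" if "x \<in> {-1<..<1}" for k x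
  proof (rule DERIV_imp_deriv)
    have x: "1 - x\<^sup>2 > 0" using one_minus_square_pos[OF that] .
    let ?k = "real (Suc k)"
    have 1: "(cut k has_field_derivative deriv smooth_step (?k * (1 - x\<^sup>2)) * (?k * (- 2 * x))) (at x)"
      unfolding cut_def by (rule DERIV_chain2[OF smooth_DERIV[OF smooth_smooth_step]])
        (auto intro!: derivative_eq_intros)
    have 2: "((\<lambda>x. (1 - x\<^sup>2) powr (b + 1)) has_field_derivative (b + 1) * (1 - x\<^sup>2) powr b * (- 2 * x)) (at x)"
    proof -
      have "((\<lambda>x. (1 - x\<^sup>2) powr (b + 1)) has_field_derivative (b + 1) * (1 - x\<^sup>2) powr (b + 1 - 1) * (- 2 * x)) (at x)"
        by (rule DERIV_chain2[where f="\<lambda>z. z powr (b + 1)" and g="\<lambda>x. 1 - x\<^sup>2", OF has_real_derivative_powr[OF x]]) (auto intro!: derivative_eq_intros)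
      then show ?thesis by simp
    qed
    have pw: "(1 - x\<^sup>2) powr (b + 1) = (1 - x\<^sup>2) powr b * (1 - x\<^sup>2)" using x by (simp add: powr_add)
    have "(\<phi> k has_field_derivative
       (deriv smooth_step (?k * (1 - x\<^sup>2)) * (?k * (- 2 * x)) * (1 - x\<^sup>2) powr (b + 1)
        + (b + 1) * (1 - x\<^sup>2) powr b * (- 2 * x) * cut k x) * poly q x
        + poly (pderiv q) x * (cut k x * (1 - x\<^sup>2) powr (b + 1))) (at x)"
      unfolding \<phi>_def by (intro DERIV_mult 1 2 poly_DERIV)
    also have "(deriv smooth_step (?k * (1 - x\<^sup>2)) * (?k * (- 2 * x)) * (1 - x\<^sup>2) powr (b + 1)
        + (b + 1) * (1 - x\<^sup>2) powr b * (- 2 * x) * cut k x) * poly q x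
        + poly (pderiv q) x * (cut k x * (1 - x\<^sup>2) powr (b + 1)) = (1 - x\<^sup>2) powr b * g k x"
      unfolding pw g_def T_def r[symmetric] by (simp add: algebra_simps del: of_nat_Suc)
    finally show "(\<phi> k has_field_derivative (1 - x\<^sup>2) powr b * g k x) (at x)" .
  qed
  obtain C where C: "C \<ge> 0" "\<And>y. \<bar>y * deriv smooth_step y\<bar> \<le> C" using deriv_smooth_step_bound by blast
  obtain Bq where Bq: "Bq \<ge> 0" "\<And>x::real. \<bar>x\<bar> \<le> 1 \<Longrightarrow> \<bar>poly q x\<bar> \<le> Bq" using poly_bounded_11 by blast
  obtain Br where Br: "Br \<ge> 0" "\<And>x::real. \<bar>x\<bar> \<le> 1 \<Longrightarrow> \<bar>poly r x\<bar> \<le> Br" using poly_bounded_11 by blast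
  have cutb: "\<bar>cut k x\<bar> \<le> 1" for k x using smooth_step_bounds by (simp add: cut_def)
  have gb: "\<bar>g k x\<bar> \<le> 2 * Bq * C + Br" if "x \<in> {-1<..<1}" for k x
  proof -
    have x: "\<bar>x\<bar> \<le> 1" using that by (simp add: abs_le_iff)
    have "\<bar>g k x\<bar> \<le> \<bar>2 * x * poly q x * T k x\<bar> + \<bar>cut k x * poly r x\<bar>"
      unfolding g_def by (rule order_trans[OF abs_triangle_ineq4]) simp
    also have "\<dots> = 2 * (\<bar>x\<bar> * \<bar>poly q x\<bar>) * \<bar>T k x\<bar> + \<bar>cut k x\<bar> * \<bar>poly r x\<bar>" by (simp add: abs_mult)
    also have "\<dots> \<le> 2 * (1 * Bq) * C + 1 * Br"
      using x Bq Br C cutb unfolding T_def by (intro add_mono mult_mono) auto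
    finally show ?thesis by simp
  qed
  have smc: "smooth (cut k)" for k
    using smooth_compose[OF smooth_smooth_step smooth_poly[of "smult (real (Suc k)) [:1, 0, -1:]"]]
    unfolding cut_def by (simp add: power2_eq_square algebra_simps del: of_nat_Suc)
  have cutm: "cut k \<in> borel_measurable leb11" for k
    by (intro borel_measurable_leb11I borel_measurable_continuous_onI smooth_continuous smc)
  have gm: "g k \<in> borel_measurable leb11" for k
  proof -
    have "continuous_on UNIV (deriv smooth_step)"
      using smooth_continuous[OF smooth_deriv_iter[OF smooth_smooth_step, of 1]] by simp
    then have "continuous_on UNIV (\<lambda>x. deriv smooth_step (real (Suc k) * (1 - x\<^sup>2)))"
      by (rule continuous_on_compose2) (auto intro!: continuous_intros)
    then have "continuous_on UNIV (g k)"
      unfolding g_def T_def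
      by (intro continuous_on_diff continuous_on_mult continuous_on_poly smooth_continuous[OF smc]
        continuous_on_const continuous_on_id continuous_on_power)
    then show ?thesis by (intro borel_measurable_leb11I borel_measurable_continuous_onI)
  qed
  have lim1: "\<forall>\<^sub>F k in sequentially. cut k x = 1 \<and> T k x = 0" if "x \<in> {-1<..<1}" for x
    using eventually_ge_at_top[of "nat \<lceil>3 / (1 - x\<^sup>2)\<rceil>"]
  proof eventually_elim
    case (elim k)
    have x: "1 - x\<^sup>2 > 0" using one_minus_square_pos[OF that] .
    have "3 / (1 - x\<^sup>2) \<le> real (Suc k)" using elim by linarith
    then have "3 \<le> real (Suc k) * (1 - x\<^sup>2)" using x by (simp add: field_simps)
    then have "2 < real (Suc k) * (1 - x\<^sup>2)" by linarith
    then show ?case unfolding cut_def T_def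
      by (simp add: smooth_step_1 deriv_smooth_step_eq_0 del: of_nat_Suc)
  qed
  have L: "(\<lambda>k. \<integral>x. u x * g k x \<partial>wmeas b) \<longlonglongrightarrow> (\<integral>x. u x * (- poly r x) \<partial>wmeas b)"
  proof (rule integral_dominated_convergence[where w="\<lambda>x. (2 * Bq * C + Br) * \<bar>u x\<bar>"])
    show "AE x in wmeas b. (\<lambda>k. u x * g k x) \<longlonglongrightarrow> u x * (- poly r x)"
    proof (rule AE_I2)
      fix x assume "x \<in> space (wmeas b)"
      then have "x \<in> {-1<..<1}" by simp
      from lim1[OF this] have "\<forall>\<^sub>F k in sequentially. u x * g k x = u x * (- poly r x)"
        by (rule eventually_mono) (simp add: g_def)
      then show "(\<lambda>k. u x * g k x) \<longlonglongrightarrow> u x * (- poly r x)" by (rule tendsto_eventually)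
    qed
    show "AE x in wmeas b. norm (u x * g k x) \<le> (2 * Bq * C + Br) * \<bar>u x\<bar>" for k
      using gb by (intro AE_I2) (auto simp: abs_mult mult.commute intro!: mult_left_mono)
  qed (use u um gm poly_measurable_leb11[of r] in auto)
  have R: "(\<lambda>k. \<integral>x. v x * (cut k x * poly q x) \<partial>wmeas (b + 1)) \<longlonglongrightarrow> (\<integral>x. v x * poly q x \<partial>wmeas (b + 1))"
  proof (rule integral_dominated_convergence[where w="\<lambda>x. Bq * \<bar>v x\<bar>"])
    show "AE x in wmeas (b + 1). (\<lambda>k. v x * (cut k x * poly q x)) \<longlonglongrightarrow> v x * poly q x"
    proof (rule AE_I2)
      fix x assume "x \<in> space (wmeas (b + 1))"
      then have "x \<in> {-1<..<1}" by simp
      from lim1[OF this] have "\<forall>\<^sub>F k in sequentially. v x * (cut k x * poly q x) = v x * poly q x"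
        by (rule eventually_mono) simp
      then show "(\<lambda>k. v x * (cut k x * poly q x)) \<longlonglongrightarrow> v x * poly q x" by (rule tendsto_eventually)
    qed
    show "AE x in wmeas (b + 1). norm (v x * (cut k x * poly q x)) \<le> Bq * \<bar>v x\<bar>" for k
    proof (rule AE_I2)
      fix x assume "x \<in> space (wmeas (b + 1))"
      then have "\<bar>x\<bar> \<le> 1" by (simp add: abs_le_iff)
      then have "\<bar>cut k x\<bar> * \<bar>poly q x\<bar> \<le> 1 * Bq" using cutb Bq by (intro mult_mono) auto
      then have "\<bar>v x\<bar> * (\<bar>cut k x\<bar> * \<bar>poly q x\<bar>) \<le> \<bar>v x\<bar> * Bq" by (intro mult_left_mono) auto
      then show "norm (v x * (cut k x * poly q x)) \<le> Bq * \<bar>v x\<bar>" by (simp add: abs_mult mult_ac)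
    qed
  qed (use v vm cutm poly_measurable_leb11[of q] in auto)
  have eq: "(\<integral>x. u x * g k x \<partial>wmeas b) = - (\<integral>x. v x * (cut k x * poly q x) \<partial>wmeas (b + 1))" for k
  proof -
    have "(\<integral>x. u x * g k x \<partial>wmeas b) = (\<integral>x. (1 - x\<^sup>2) powr b * (u x * g k x) \<partial>leb11)"
      using um gm by (intro integral_wmeas) auto
    also have "\<dots> = (\<integral>x. u x * (deriv ^^ Suc 0) (\<phi> k) x \<partial>leb11)"
      using D by (intro Bochner_Integration.integral_cong) auto
    also have "\<dots> = (-1) ^ Suc 0 * (\<integral>x. v x * \<phi> k x \<partial>leb11)"
      using uv test unfolding has_weak_deriv_def by blast
    also have "(\<integral>x. v x * \<phi> k x \<partial>leb11) = (\<integral>x. (1 - x\<^sup>2) powr (b + 1) * (v x * (cut k x * poly q x)) \<partial>leb11)"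
      by (intro Bochner_Integration.integral_cong) (auto simp: \<phi>_def)
    also have "\<dots> = (\<integral>x. v x * (cut k x * poly q x) \<partial>wmeas (b + 1))"
      using vm cutm poly_measurable_leb11[of q] by (intro integral_wmeas[symmetric]) auto
    finally show ?thesis by simp
  qed
  have "(\<integral>x. u x * (- poly r x) \<partial>wmeas b) = - (\<integral>x. v x * poly q x \<partial>wmeas (b + 1))"
    using L tendsto_minus[OF R] unfolding eq by (rule LIMSEQ_unique)
  then show ?thesis unfolding r by simp
qed

section \<open>Complete orthogonal systems\<close>

definition sqint :: "'a measure \<Rightarrow> ('a \<Rightarrow> real) \<Rightarrow> bool" where
  "sqint M f \<longleftrightarrow> f \<in> borel_measurable M \<and> integrable M (\<lambda>x. (f x)\<^sup>2)"

lemma sqint_times_integrable: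
  assumes "sqint M f" "sqint M g"
  shows "integrable M (\<lambda>x. f x * g x)"
proof (rule Bochner_Integration.integrable_bound)
  show "integrable M (\<lambda>x. (f x)\<^sup>2 + (g x)\<^sup>2)" using assms by (simp add: sqint_def)
  show "(\<lambda>x. f x * g x) \<in> borel_measurable M" using assms by (auto simp: sqint_def)
  have "\<bar>a * b\<bar> \<le> a\<^sup>2 + b\<^sup>2" for a b :: real
  proof -
    have "2 * (\<bar>a\<bar> * \<bar>b\<bar>) \<le> a\<^sup>2 + b\<^sup>2" using sum_squares_bound[of "\<bar>a\<bar>" "\<bar>b\<bar>"] by (simp add: mult.assoc)
    moreover have "0 \<le> \<bar>a\<bar> * \<bar>b\<bar>" by simp
    ultimately show ?thesis unfolding abs_mult by linarith
  qed
  then show "AE x in M. norm (f x * g x) \<le> norm ((f x)\<^sup>2 + (g x)\<^sup>2)"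
    by (intro AE_I2) (simp add: order_trans[OF _ abs_ge_self])
qed

lemma sqint_lincomb:
  assumes "sqint M f" "sqint M g"
  shows "sqint M (\<lambda>x. a * f x + b * g x)"
proof -
  have "integrable M (\<lambda>x. a\<^sup>2 * (f x)\<^sup>2 + (2 * a * b) * (f x * g x) + b\<^sup>2 * (g x)\<^sup>2)"
    using assms sqint_times_integrable[OF assms]
    by (intro Bochner_Integration.integrable_add Bochner_Integration.integrable_mult_right) (auto simp: sqint_def)
  also have "(\<lambda>x. a\<^sup>2 * (f x)\<^sup>2 + (2 * a * b) * (f x * g x) + b\<^sup>2 * (g x)\<^sup>2) = (\<lambda>x. (a * f x + b * g x)\<^sup>2)"
    by (simp add: power2_eq_square algebra_simps)
  finally show ?thesis using assms by (auto simp: sqint_def)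
qed

lemma sqint_diff: "sqint M f \<Longrightarrow> sqint M g \<Longrightarrow> sqint M (\<lambda>x. f x - g x)"
  using sqint_lincomb[of M f g 1 "-1"] by simp

lemma sqint_sum:
  assumes "\<And>i. i \<in> A \<Longrightarrow> sqint M (f i)"
  shows "sqint M (\<lambda>x. \<Sum>i\<in>A. c i * f i x)"
  using assms
proof (induction A rule: infinite_finite_induct)
  case (insert i A)
  then show ?case using sqint_lincomb[of M "f i" "\<lambda>x. \<Sum>i\<in>A. c i * f i x" "c i" 1] by simp
qed (auto simp: sqint_def)

lemma sqint_AE_cong:
  assumes "sqint M f" "g \<in> borel_measurable M" "AE x in M. f x = g x"
  shows "sqint M g" "(\<integral>x. (f x)\<^sup>2 \<partial>M) = (\<integral>x. (g x)\<^sup>2 \<partial>M)"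
proof -
  have "AE x in M. (f x)\<^sup>2 = (g x)\<^sup>2" using assms(3) by eventually_elim simp
  moreover have "(\<lambda>x. (f x)\<^sup>2) \<in> borel_measurable M" "(\<lambda>x. (g x)\<^sup>2) \<in> borel_measurable M"
    using assms by (auto simp: sqint_def)
  ultimately show "sqint M g" "(\<integral>x. (f x)\<^sup>2 \<partial>M) = (\<integral>x. (g x)\<^sup>2 \<partial>M)"
    using assms integrable_cong_AE[of "\<lambda>x. (f x)\<^sup>2" M "\<lambda>x. (g x)\<^sup>2"]
    by (auto simp: sqint_def intro: integral_cong_AE)
qed

lemma integral_Cauchy_Schwarz:
  assumes "sqint M f" "sqint M g"
  shows "(\<integral>x. f x * g x \<partial>M)\<^sup>2 \<le> (\<integral>x. (f x)\<^sup>2 \<partial>M) * (\<integral>x. (g x)\<^sup>2 \<partial>M)"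
proof -
  define a where "a = (\<integral>x. f x * g x \<partial>M)"
  define b where "b = (\<integral>x. (g x)\<^sup>2 \<partial>M)"
  define c where "c = (\<integral>x. (f x)\<^sup>2 \<partial>M)"
  have int: "integrable M (\<lambda>x. f x * g x)" "integrable M (\<lambda>x. (f x)\<^sup>2)" "integrable M (\<lambda>x. (g x)\<^sup>2)"
    using assms sqint_times_integrable by (auto simp: sqint_def)
  have b0: "b \<ge> 0" by (simp add: b_def)
  have q: "0 \<le> s\<^sup>2 * c - 2 * s * t * a + t\<^sup>2 * b" for s t
  proof -
    have "0 \<le> (\<integral>x. (s * f x - t * g x)\<^sup>2 \<partial>M)" by simp
    also have "\<dots> = (\<integral>x. s\<^sup>2 * (f x)\<^sup>2 - 2 * s * t * (f x * g x) + t\<^sup>2 * (g x)\<^sup>2 \<partial>M)"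
      by (simp add: power2_eq_square algebra_simps)
    also have "\<dots> = s\<^sup>2 * c - 2 * s * t * a + t\<^sup>2 * b"
      using int by (simp add: a_def b_def c_def)
    finally show ?thesis .
  qed
  show ?thesis
  proof (cases "b = 0")
    case True
    have "AE x in M. (g x)\<^sup>2 = 0"
      using True int(3) integral_nonneg_eq_0_iff_AE[of M "\<lambda>x. (g x)\<^sup>2"] by (simp add: b_def)
    then have "AE x in M. f x * g x = 0" by eventually_elim simp
    then have "a = 0" unfolding a_def by (rule integral_eq_zero_AE)
    then show ?thesis unfolding a_def[symmetric] b_def[symmetric] using True by simp
  next
    case False
    then have "b > 0" using b0 by simp
    \<comment> \<open>For \<open>s = b\<close> the quadratic form is minimal at \<open>t = a\<close>.\<close>
    have "0 \<le> b * (b * c - a\<^sup>2)" using q[of b a] by (simp add: power2_eq_square algebra_simps)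
    then have "0 \<le> b * c - a\<^sup>2" using \<open>b > 0\<close> by (simp add: zero_le_mult_iff)
    then show ?thesis unfolding a_def[symmetric] b_def[symmetric] c_def[symmetric] by (simp add: mult.commute)
  qed
qed

lemma (in finite_measure) sqint_imp_integrable: "sqint M f \<Longrightarrow> integrable M f"
  using sqint_times_integrable[of M f "\<lambda>x. 1"] by (simp add: sqint_def)

lemma (in finite_measure) sqint_bounded:
  assumes "f \<in> borel_measurable M" "\<And>x. x \<in> space M \<Longrightarrow> \<bar>f x\<bar> \<le> B"
  shows "sqint M f"
  unfolding sqint_def
proof
  show "integrable M (\<lambda>x. (f x)\<^sup>2)"
  proof (rule integrable_const_bound[where B="B\<^sup>2"])
    show "AE x in M. norm ((f x)\<^sup>2) \<le> B\<^sup>2"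
    proof (rule AE_I2)
      fix x assume "x \<in> space M"
      then have "\<bar>f x\<bar>\<^sup>2 \<le> B\<^sup>2" using assms(2) by (intro power_mono) auto
      then show "norm ((f x)\<^sup>2) \<le> B\<^sup>2" by simp
    qed
  qed (use assms in simp)
qed (rule assms)

lemma nn_integral_le_of_AE_limit:
  fixes u :: "nat \<Rightarrow> 'a \<Rightarrow> real"
  assumes "\<And>i. u i \<in> borel_measurable M" "AE x in M. (\<lambda>i. u i x) \<longlonglongrightarrow> g x"
    and "\<And>i. i \<ge> n \<Longrightarrow> (\<integral>\<^sup>+x. ennreal (u i x) \<partial>M) \<le> C"
  shows "(\<integral>\<^sup>+x. ennreal (g x) \<partial>M) \<le> C"
proof -
  have "(\<integral>\<^sup>+x. ennreal (g x) \<partial>M) = (\<integral>\<^sup>+x. liminf (\<lambda>i. ennreal (u i x)) \<partial>M)"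
  proof (rule nn_integral_cong_AE)
    show "AE x in M. ennreal (g x) = liminf (\<lambda>i. ennreal (u i x))"
      using assms(2)
    proof eventually_elim
      case (elim x)
      then have "(\<lambda>i. ennreal (u i x)) \<longlonglongrightarrow> ennreal (g x)" by (rule tendsto_ennrealI)
      then show ?case by (intro lim_imp_Liminf[symmetric]) auto
    qed
  qed
  also have "\<dots> \<le> liminf (\<lambda>i. \<integral>\<^sup>+x. ennreal (u i x) \<partial>M)"
    using assms(1) by (intro nn_integral_liminf) auto
  also have "\<dots> \<le> liminf (\<lambda>i. C)"
    using assms(3) by (intro Liminf_mono) (auto simp: eventually_sequentially)
  also have "\<dots> = C" by (simp add: Liminf_const)
  finally show ?thesis .
qed

text \<open>Members of the system may vanish, in which case \<open>N l = 0\<close>: this happens to derivatives of polynomials of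
too small a degree. Quotients by \<open>N l\<close> are then \<open>0\<close> and contribute nothing to the sums below.\<close>

locale orthogonal_system = finite_measure M for M :: "'a measure" +
  fixes e :: "nat \<Rightarrow> 'a \<Rightarrow> real" and N :: "nat \<Rightarrow> real"
  assumes e_measurable: "\<And>l. e l \<in> borel_measurable M"
    and e_bounded: "\<And>l. \<exists>B. \<forall>x\<in>space M. \<bar>e l x\<bar> \<le> B"
    and orthogonal: "\<And>k l. k \<noteq> l \<Longrightarrow> (\<integral>x. e k x * e l x \<partial>M) = 0"
    and square_norm: "\<And>l. (\<integral>x. (e l x)\<^sup>2 \<partial>M) = N l"
    and complete: "\<And>f. integrable M f \<Longrightarrow> (\<And>l. (\<integral>x. f x * e l x \<partial>M) = 0) \<Longrightarrow> AE x in M. f x = 0"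
begin

lemma sqint_e: "sqint M (e l)"
  using e_bounded[of l] e_measurable by (auto intro: sqint_bounded)

lemma N_nonneg: "N l \<ge> 0"
  unfolding square_norm[symmetric] by simp

lemma coeff_zero:
  assumes "N l = 0"
  shows "(\<integral>x. f x * e l x \<partial>M) = 0"
proof -
  have "AE x in M. (e l x)\<^sup>2 = 0"
    using assms integral_nonneg_eq_0_iff_AE[of M "\<lambda>x. (e l x)\<^sup>2"] sqint_e[of l] square_norm[of l]
    by (simp add: sqint_def)
  then have "AE x in M. f x * e l x = 0" by eventually_elim simp
  then show ?thesis by (rule integral_eq_zero_AE)
qed

definition psum :: "(nat \<Rightarrow> real) \<Rightarrow> nat set \<Rightarrow> 'a \<Rightarrow> real" where
  "psum c A x = (\<Sum>l\<in>A. c l * e l x)"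

lemma sqint_psum: "sqint M (psum c A)"
  unfolding psum_def by (rule sqint_sum[OF sqint_e])

lemma psum_coeff:
  assumes "finite A"
  shows "(\<integral>x. psum c A x * e m x \<partial>M) = (if m \<in> A then c m * N m else 0)"
proof -
  have "(\<integral>x. psum c A x * e m x \<partial>M) = (\<integral>x. (\<Sum>l\<in>A. c l * (e l x * e m x)) \<partial>M)"
    by (simp add: psum_def sum_distrib_right mult.assoc)
  also have "\<dots> = (\<Sum>l\<in>A. c l * (\<integral>x. e l x * e m x \<partial>M))"
    using sqint_times_integrable[OF sqint_e sqint_e] by (subst Bochner_Integration.integral_sum) auto
  also have "\<dots> = (\<Sum>l\<in>A. if l = m then c m * N m else 0)"
    using orthogonal square_norm by (intro sum.cong) (auto simp: power2_eq_square)
  finally show ?thesis using assms by (simp add: sum.delta)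
qed

lemma inner_psum:
  assumes "finite A" "sqint M f"
  shows "(\<integral>x. f x * psum c A x \<partial>M) = (\<Sum>l\<in>A. c l * (\<integral>x. f x * e l x \<partial>M))"
proof -
  have "(\<integral>x. f x * psum c A x \<partial>M) = (\<integral>x. (\<Sum>l\<in>A. c l * (f x * e l x)) \<partial>M)"
    by (simp add: psum_def sum_distrib_left mult_ac)
  also have "\<dots> = (\<Sum>l\<in>A. c l * (\<integral>x. f x * e l x \<partial>M))"
    using sqint_times_integrable[OF assms(2) sqint_e] by (subst Bochner_Integration.integral_sum) auto
  finally show ?thesis .
qed

lemma psum_square:
  assumes "finite A"
  shows "(\<integral>x. (psum c A x)\<^sup>2 \<partial>M) = (\<Sum>l\<in>A. (c l)\<^sup>2 * N l)"
  using inner_psum[OF assms sqint_psum, where c=c] psum_coeff[OF assms]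
  by (simp add: power2_eq_square mult.assoc)

lemma psum_diff: "finite A \<Longrightarrow> B \<subseteq> A \<Longrightarrow> psum c A x - psum c B x = psum c (A - B) x"
  by (simp add: psum_def sum_diff)

text \<open>A subsequence of partial sums with increments \<open>D\<^sub>i\<close> of norm at most \<open>2\<^sup>-\<^sup>i\<close> converges almost
  everywhere, since \<open>\<bar>D\<^sub>i\<bar> \<le> 2\<^sup>i D\<^sub>i\<^sup>2 + 2\<^sup>-\<^sup>i\<close> makes the increments absolutely summable almost
  everywhere on a finite measure space. Fatou's lemma carries the norm estimates to the limit.\<close>

lemma Riesz_Fischer:
  assumes sm: "summable (\<lambda>l. (c l)\<^sup>2 * N l)"
  shows "\<exists>f. sqint M f \<and> (\<forall>l. (\<integral>x. f x * e l x \<partial>M) = c l * N l) \<and>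
    (\<lambda>K. \<integral>x. (f x - psum c {..<K} x)\<^sup>2 \<partial>M) \<longlonglongrightarrow> 0"
proof -
  define t where "t = (\<lambda>K. \<Sum>l. (c (l + K))\<^sup>2 * N (l + K))"
  have nn: "0 \<le> (c l)\<^sup>2 * N l" for l by (simp add: N_nonneg)
  have t0: "t \<longlonglongrightarrow> 0"
    unfolding t_def using suminf_exist_split2[OF sm] by simp
  have tge: "(\<Sum>l\<in>{K..<K'}. (c l)\<^sup>2 * N l) \<le> t K" for K K'
  proof (cases "K \<le> K'")
    case True
    have "(\<Sum>l\<in>{K..<K'}. (c l)\<^sup>2 * N l) = (\<Sum>l<K' - K. (c (l + K))\<^sup>2 * N (l + K))"
      using sum.shift_bounds_nat_ivl[of "\<lambda>l. (c l)\<^sup>2 * N l" 0 K "K' - K"] True by (simp add: atLeast0LessThan)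
    also have "\<dots> \<le> t K" unfolding t_def
      using summable_ignore_initial_segment[OF sm, of K] nn by (intro sum_le_suminf) auto
    finally show ?thesis .
  next
    case False
    have "0 \<le> t K" unfolding t_def
      using summable_ignore_initial_segment[OF sm, of K] nn by (intro suminf_nonneg) auto
    then show ?thesis using False by simp
  qed
  have "\<exists>K0. \<forall>K\<ge>K0. t K \<le> (1/4) ^ i" for i
  proof -
    have "\<forall>\<^sub>F K in sequentially. t K < (1/4) ^ i" using t0 by (intro order_tendstoD) auto
    then show ?thesis unfolding eventually_sequentially by (metis less_imp_le)
  qed
  then obtain K0 where K0: "\<And>i K. K \<ge> K0 i \<Longrightarrow> t K \<le> (1/4) ^ i" by metis
  \<comment> \<open>The sum makes \<open>k\<close> monotone and at least \<open>K0 i\<close>; the summand \<open>i\<close> makes it unbounded.\<close>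
  define k where "k = (\<lambda>i. i + (\<Sum>j\<le>i. K0 j))"
  have kK0: "k i \<ge> K0 i" for i
    unfolding k_def by (rule trans_le_add2, rule member_le_sum) auto
  have ki: "k i \<ge> i" for i by (simp add: k_def)
  have kmono: "k i \<le> k (Suc i)" for i by (simp add: k_def)
  define D where "D = (\<lambda>i. psum c {k i..<k (Suc i)})"
  have Dd: "psum c {..<k (Suc i)} x = psum c {..<k i} x + D i x" for i x
  proof -
    have "{..<k (Suc i)} - {..<k i} = {k i..<k (Suc i)}" using kmono[of i] by auto
    then show ?thesis
      using psum_diff[where A="{..<k (Suc i)}" and B="{..<k i}" and c=c and x=x] kmono[of i] unfolding D_def by (simp add: algebra_simps)
  qed
  have Ds: "sqint M (D i)" for i unfolding D_def by (rule sqint_psum)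
  have Dn: "(\<integral>x. (D i x)\<^sup>2 \<partial>M) \<le> (1/4) ^ i" for i
    unfolding D_def using psum_square[where A="{k i..<k (Suc i)}" and c=c] tge[of "k i" "k (Suc i)"] K0[OF kK0[of i]] by simp
  have Dint: "(\<integral>x. \<bar>D i x\<bar> \<partial>M) \<le> (1 + measure M (space M)) * (1/2) ^ i" for i
  proof -
    have int: "integrable M (\<lambda>x. \<bar>D i x\<bar>)" "integrable M (\<lambda>x. (D i x)\<^sup>2)"
      using integrable_abs[OF sqint_imp_integrable[OF Ds]] Ds[unfolded sqint_def] by blast+
    have "(\<integral>x. \<bar>D i x\<bar> \<partial>M) \<le> (\<integral>x. 2 ^ i * (D i x)\<^sup>2 + (1/2) ^ i \<partial>M)"
    proof (rule integral_mono)
      fix x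
      define s :: real where "s = 2 ^ i"
      have s: "s > 0" "(1/2) ^ i = 1 / s" by (simp_all add: s_def power_divide)
      have "2 * (s * \<bar>D i x\<bar>) \<le> (s * \<bar>D i x\<bar>)\<^sup>2 + 1"
        using sum_squares_bound[of "s * \<bar>D i x\<bar>" 1] by simp
      moreover have "0 \<le> s * \<bar>D i x\<bar>" using s by simp
      ultimately have "s * \<bar>D i x\<bar> \<le> (s * \<bar>D i x\<bar>)\<^sup>2 + 1" by linarith
      also have "\<dots> = s * (s * (D i x)\<^sup>2 + 1 / s)" using s by (simp add: power2_eq_square algebra_simps)
      finally have "\<bar>D i x\<bar> \<le> s * (D i x)\<^sup>2 + 1 / s" using s(1) by (simp only: mult_le_cancel_left_pos)
      then show "\<bar>D i x\<bar> \<le> 2 ^ i * (D i x)\<^sup>2 + (1/2) ^ i" using s by (simp add: s_def)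
    qed (use int in auto)
    also have "\<dots> = 2 ^ i * (\<integral>x. (D i x)\<^sup>2 \<partial>M) + (1/2) ^ i * measure M (space M)"
      using int by simp
    also have "\<dots> \<le> 2 ^ i * (1/4) ^ i + (1/2) ^ i * measure M (space M)"
      using Dn by (intro add_mono mult_left_mono) auto
    also have "\<dots> = (1 + measure M (space M)) * (1/2) ^ i"
      by (simp add: algebra_simps flip: power_mult_distrib)
    finally show ?thesis .
  qed
  have Dm: "D i \<in> borel_measurable M" for i using Ds by (simp add: sqint_def)
  have "(\<integral>\<^sup>+x. (\<Sum>i. ennreal \<bar>D i x\<bar>) \<partial>M) = (\<Sum>i. \<integral>\<^sup>+x. ennreal \<bar>D i x\<bar> \<partial>M)"
    using Dm by (intro nn_integral_suminf) auto
  also have "\<dots> \<le> (\<Sum>i. ennreal ((1 + measure M (space M)) * (1/2) ^ i))"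
  proof (rule suminf_le)
    fix i
    have "(\<integral>\<^sup>+x. ennreal \<bar>D i x\<bar> \<partial>M) = ennreal (\<integral>x. \<bar>D i x\<bar> \<partial>M)"
      using integrable_abs[OF sqint_imp_integrable[OF Ds]] by (intro nn_integral_eq_integral) auto
    then show "(\<integral>\<^sup>+x. ennreal \<bar>D i x\<bar> \<partial>M) \<le> ennreal ((1 + measure M (space M)) * (1/2) ^ i)"
      using Dint by (auto intro: ennreal_leI)
  qed auto
  also have "\<dots> < \<infinity>"
  proof -
    have "summable (\<lambda>i. (1 + measure M (space M)) * (1/2) ^ i :: real)"
      by (intro summable_mult summable_geometric) simp
    then have "(\<Sum>i. ennreal ((1 + measure M (space M)) * (1/2) ^ i)) = ennreal (\<Sum>i. (1 + measure M (space M)) * (1/2) ^ i)"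
      by (intro suminf_ennreal2) auto
    then show ?thesis by simp
  qed
  finally have "(\<integral>\<^sup>+x. (\<Sum>i. ennreal \<bar>D i x\<bar>) \<partial>M) \<noteq> \<infinity>" by simp
  then have "AE x in M. (\<Sum>i. ennreal \<bar>D i x\<bar>) \<noteq> \<infinity>"
    using Dm by (intro nn_integral_noteq_infinite) auto
  then have conv: "AE x in M. convergent (\<lambda>i. psum c {..<k i} x)"
  proof eventually_elim
    case (elim x)
    then have "summable (\<lambda>i. \<bar>D i x\<bar>)" by (intro summable_suminf_not_top) simp_all
    then have "summable (\<lambda>i. D i x)" by (rule summable_rabs_cancel)
    then have cv: "convergent (\<lambda>n. psum c {..<k 0} x + (\<Sum>i<n. D i x))"
      by (rule convergent_add[OF convergent_const summable_iff_convergent[THEN iffD1]])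
    have "psum c {..<k n} x = psum c {..<k 0} x + (\<Sum>i<n. D i x)" for n
      by (induction n) (simp_all add: Dd)
    then have "(\<lambda>n. psum c {..<k n} x) = (\<lambda>n. psum c {..<k 0} x + (\<Sum>i<n. D i x))" by blast
    then show ?case by (rule ssubst) (rule cv)
  qed
  define f where "f = (\<lambda>x. lim (\<lambda>i. psum c {..<k i} x))"
  have pm: "psum c A \<in> borel_measurable M" for A using sqint_psum by (simp add: sqint_def)
  have fm: "f \<in> borel_measurable M" unfolding f_def using pm by (intro borel_measurable_lim_metric)
  have flim: "AE x in M. (\<lambda>i. psum c {..<k i} x) \<longlonglongrightarrow> f x"
    using conv by eventually_elim (simp add: f_def convergent_LIMSEQ_iff)
  have fK: "(\<integral>\<^sup>+x. ennreal ((f x - psum c {..<K} x)\<^sup>2) \<partial>M) \<le> ennreal (t K)" for K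
  proof (rule nn_integral_le_of_AE_limit)
    show "AE x in M. (\<lambda>i. (psum c {..<k i} x - psum c {..<K} x)\<^sup>2) \<longlonglongrightarrow> (f x - psum c {..<K} x)\<^sup>2"
      using flim by eventually_elim (intro tendsto_intros)
    fix i assume "i \<ge> K"
    then have "K \<le> k i" using ki[of i] by simp
    then have "{..<K} \<subseteq> {..<k i}" "{..<k i} - {..<K} = {K..<k i}" by auto
    then have "psum c {..<k i} x - psum c {..<K} x = psum c {K..<k i} x" for x
      using psum_diff[where A="{..<k i}" and B="{..<K}"] by simp
    then have "(\<integral>\<^sup>+x. ennreal ((psum c {..<k i} x - psum c {..<K} x)\<^sup>2) \<partial>M) = ennreal (\<integral>x. (psum c {K..<k i} x)\<^sup>2 \<partial>M)"
      using sqint_psum by (simp add: nn_integral_eq_integral sqint_def)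
    also have "\<dots> \<le> ennreal (t K)" using tge by (simp add: psum_square ennreal_leI)
    finally show "(\<integral>\<^sup>+x. ennreal ((psum c {..<k i} x - psum c {..<K} x)\<^sup>2) \<partial>M) \<le> ennreal (t K)" .
  qed (use pm in auto)
  have fdiff: "sqint M (\<lambda>x. f x - psum c {..<K} x)" for K
    unfolding sqint_def
  proof
    show "integrable M (\<lambda>x. (f x - psum c {..<K} x)\<^sup>2)"
      using fK[of K] fm pm by (intro integrableI_bounded) (auto simp: less_top[symmetric] top_unique)
  qed (use fm pm in auto)
  have fs: "sqint M f" using fdiff[of 0] by (simp add: psum_def)
  have fKi: "(\<integral>x. (f x - psum c {..<K} x)\<^sup>2 \<partial>M) \<le> t K" for K
  proof -
    have "t K \<ge> 0" using tge[of K K] by simp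
    moreover have "ennreal (\<integral>x. (f x - psum c {..<K} x)\<^sup>2 \<partial>M) = (\<integral>\<^sup>+x. ennreal ((f x - psum c {..<K} x)\<^sup>2) \<partial>M)"
      using fdiff[of K] by (intro nn_integral_eq_integral[symmetric]) (auto simp: sqint_def)
    ultimately show ?thesis using fK[of K] by (metis ennreal_le_iff)
  qed
  have L: "(\<lambda>K. \<integral>x. (f x - psum c {..<K} x)\<^sup>2 \<partial>M) \<longlonglongrightarrow> 0"
    by (rule tendsto_sandwich[OF _ _ tendsto_const t0]) (use fKi in auto)
  have "(\<integral>x. f x * e l x \<partial>M) = c l * N l" for l
  proof -
    have "(\<lambda>K. (\<integral>x. (f x - psum c {..<K} x) * e l x \<partial>M)\<^sup>2) \<longlonglongrightarrow> 0"
    proof (rule tendsto_sandwich[OF _ _ tendsto_const])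
      show "(\<lambda>K. (\<integral>x. (f x - psum c {..<K} x)\<^sup>2 \<partial>M) * (\<integral>x. (e l x)\<^sup>2 \<partial>M)) \<longlonglongrightarrow> 0"
        using tendsto_mult_left_zero[OF L] .
    qed (use integral_Cauchy_Schwarz[OF fdiff sqint_e] in auto)
    moreover have "\<forall>\<^sub>F K in sequentially. (\<integral>x. (f x - psum c {..<K} x) * e l x \<partial>M)\<^sup>2 = ((\<integral>x. f x * e l x \<partial>M) - c l * N l)\<^sup>2"
      using eventually_gt_at_top[of l]
    proof eventually_elim
      case (elim K)
      have "(\<integral>x. (f x - psum c {..<K} x) * e l x \<partial>M) = (\<integral>x. f x * e l x \<partial>M) - (\<integral>x. psum c {..<K} x * e l x \<partial>M)"
        using sqint_times_integrable[OF fs sqint_e] sqint_times_integrable[OF sqint_psum sqint_e]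
        by (simp add: left_diff_distrib)
      then show ?case using elim by (simp add: psum_coeff)
    qed
    ultimately have "(\<lambda>K::nat. ((\<integral>x. f x * e l x \<partial>M) - c l * N l)\<^sup>2) \<longlonglongrightarrow> 0"
      by (rule Lim_transform_eventually)
    then show ?thesis by (simp add: LIMSEQ_const_iff)
  qed
  then show ?thesis using fs L by blast
qed

lemma square_diff_psum:
  assumes f: "sqint M f" and c: "\<And>l. (\<integral>x. f x * e l x \<partial>M) = c l * N l"
  shows "(\<integral>x. (f x - psum c {..<K} x)\<^sup>2 \<partial>M) = (\<integral>x. (f x)\<^sup>2 \<partial>M) - (\<Sum>l<K. (c l)\<^sup>2 * N l)"
proof -
  have "(\<integral>x. (f x - psum c {..<K} x)\<^sup>2 \<partial>M) = (\<integral>x. (f x)\<^sup>2 - 2 * (f x * psum c {..<K} x) + (psum c {..<K} x)\<^sup>2 \<partial>M)"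
    by (simp add: power2_eq_square algebra_simps)
  also have "\<dots> = (\<integral>x. (f x)\<^sup>2 \<partial>M) - 2 * (\<integral>x. f x * psum c {..<K} x \<partial>M) + (\<integral>x. (psum c {..<K} x)\<^sup>2 \<partial>M)"
    using f sqint_psum[of c "{..<K}"] sqint_times_integrable[OF f sqint_psum] by (simp add: sqint_def)
  also have "(\<integral>x. f x * psum c {..<K} x \<partial>M) = (\<Sum>l<K. (c l)\<^sup>2 * N l)"
    using inner_psum[OF _ f, of "{..<K}" c] c by (simp add: power2_eq_square mult.assoc)
  finally show ?thesis by (simp add: psum_square)
qed

text \<open>Bessel's inequality makes the Riesz-Fischer theorem applicable to the coefficients of \<open>f\<close>. The function
obtained has the coefficients of \<open>f\<close> and coincides with \<open>f\<close> by completeness, so the partial sums converge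
to \<open>f\<close>.\<close>

lemma Parseval:
  assumes f: "sqint M f"
  shows "(\<lambda>l. (\<integral>x. f x * e l x \<partial>M)\<^sup>2 / N l) sums (\<integral>x. (f x)\<^sup>2 \<partial>M)"
proof -
  define c where "c = (\<lambda>l. (\<integral>x. f x * e l x \<partial>M) / N l)"
  have c: "(\<integral>x. f x * e l x \<partial>M) = c l * N l" for l
    using coeff_zero[of l f] by (simp add: c_def)
  have cN: "(c l)\<^sup>2 * N l = (\<integral>x. f x * e l x \<partial>M)\<^sup>2 / N l" for l
    by (simp add: c_def power2_eq_square)
  have "(\<Sum>l<K. (c l)\<^sup>2 * N l) \<le> (\<integral>x. (f x)\<^sup>2 \<partial>M)" for K
  proof -
    have "0 \<le> (\<integral>x. (f x - psum c {..<K} x)\<^sup>2 \<partial>M)" by simp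
    then show ?thesis unfolding square_diff_psum[OF f c] by simp
  qed
  then have sm: "summable (\<lambda>l. (c l)\<^sup>2 * N l)"
    by (intro summableI_nonneg_bounded) (auto simp: N_nonneg)
  then obtain g where g: "sqint M g" "\<And>l. (\<integral>x. g x * e l x \<partial>M) = c l * N l"
      "(\<lambda>K. \<integral>x. (g x - psum c {..<K} x)\<^sup>2 \<partial>M) \<longlonglongrightarrow> 0"
    using Riesz_Fischer by blast
  have "AE x in M. g x - f x = 0"
  proof (rule complete)
    show "integrable M (\<lambda>x. g x - f x)" using f g(1) sqint_imp_integrable by auto
    show "(\<integral>x. (g x - f x) * e l x \<partial>M) = 0" for l
      using g(2) c sqint_times_integrable[OF g(1) sqint_e, of l] sqint_times_integrable[OF f sqint_e, of l]
      by (simp add: left_diff_distrib)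
  qed
  then have "AE x in M. g x = f x" by simp
  then have "(\<integral>x. (g x)\<^sup>2 \<partial>M) = (\<integral>x. (f x)\<^sup>2 \<partial>M)"
    using sqint_AE_cong(2)[OF g(1)] f by (simp add: sqint_def)
  then have "(\<lambda>K. (\<integral>x. (f x)\<^sup>2 \<partial>M) - (\<Sum>l<K. (c l)\<^sup>2 * N l)) \<longlonglongrightarrow> 0"
    using g(3) unfolding square_diff_psum[OF g(1,2)] by simp
  then have "(\<lambda>K. (\<integral>x. (f x)\<^sup>2 \<partial>M) - ((\<integral>x. (f x)\<^sup>2 \<partial>M) - (\<Sum>l<K. (c l)\<^sup>2 * N l))) \<longlonglongrightarrow> (\<integral>x. (f x)\<^sup>2 \<partial>M) - 0"
    by (intro tendsto_diff tendsto_const)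
  then show ?thesis unfolding sums_def cN by simp
qed

end

section \<open>Gegenbauer polynomials and their derivatives as orthogonal systems\<close>

text \<open>The weight \<open>(1 - x\<^sup>2)\<^bsup>\<alpha> - 1/2 + j\<^esup>\<close> makes the \<open>j\<close>-th derivatives of the polynomials orthogonal.\<close>

definition gmeas :: "real \<Rightarrow> nat \<Rightarrow> real measure" where
  "gmeas \<alpha> j = wmeas (\<alpha> - 1/2 + real j)"

definition eigprod :: "real \<Rightarrow> nat \<Rightarrow> nat \<Rightarrow> real" where
  "eigprod \<alpha> j l = (\<Prod>i<j. eigval \<alpha> i l)"

definition gnorm :: "real \<Rightarrow> nat \<Rightarrow> real" where
  "gnorm \<alpha> l = (\<integral>x. (poly (gpoly \<alpha> l) x)\<^sup>2 \<partial>gmeas \<alpha> 0)"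

definition gcoef :: "real \<Rightarrow> nat \<Rightarrow> (real \<Rightarrow> real) \<Rightarrow> nat \<Rightarrow> real" where
  "gcoef \<alpha> j u l = (\<integral>x. u x * poly (gderiv \<alpha> j l) x \<partial>gmeas \<alpha> j)"

lemma space_gmeas [simp]: "space (gmeas \<alpha> j) = {-1<..<1}"
  by (simp add: gmeas_def)

lemma measurable_gmeas [simp]: "borel_measurable (gmeas \<alpha> j) = borel_measurable leb11"
  by (simp add: gmeas_def)

lemma AE_gmeas [simp]: "(AE x in gmeas \<alpha> j. P x) \<longleftrightarrow> (AE x in leb11. P x)"
  unfolding gmeas_def by (rule AE_wmeas)

lemma finite_measure_gmeas: "\<alpha> \<ge> 0 \<Longrightarrow> finite_measure (gmeas \<alpha> j)"
  unfolding gmeas_def by (rule finite_measure_wmeas) simp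

lemma integrable_gmeas_poly: "\<alpha> \<ge> 0 \<Longrightarrow> integrable (gmeas \<alpha> j) (poly p)"
  unfolding gmeas_def by (rule integrable_wmeas_poly) simp

lemma integrable_gmeas_times_poly:
  "integrable (gmeas \<alpha> j) f \<Longrightarrow> integrable (gmeas \<alpha> j) (\<lambda>x. f x * poly p x)"
  unfolding gmeas_def by (rule integrable_wmeas_times_poly)

text \<open>Integration by parts against \<open>w\<^bsub>j+1\<^esub> P\<^sub>l\<^bsup>(j+1)\<^esup>\<close>, whose derivative is \<open>- \<lambda> w\<^sub>j P\<^sub>l\<^bsup>(j)\<^esup>\<close> by the differential equation.\<close>

lemma gcoef_weak_deriv_Suc:
  assumes \<alpha>: "\<alpha> \<ge> 0" and uv: "has_weak_deriv (Suc 0) u v"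
    and "integrable (gmeas \<alpha> j) u" "integrable (gmeas \<alpha> (Suc j)) v"
  shows "gcoef \<alpha> (Suc j) v l = eigval \<alpha> j l * gcoef \<alpha> j u l"
proof -
  have b: "\<alpha> - 1/2 + real (Suc j) = (\<alpha> - 1/2 + real j) + 1" by simp
  have ode: "2 * (\<alpha> - 1/2 + real j + 1) * x * poly (gderiv \<alpha> (Suc j) l) x - (1 - x\<^sup>2) * poly (pderiv (gderiv \<alpha> (Suc j) l)) x
      = eigval \<alpha> j l * poly (gderiv \<alpha> j l) x" for x
    using gderiv_ODE[OF \<alpha>, of x j l] by (simp add: pderiv_gderiv algebra_simps)
  have "gcoef \<alpha> (Suc j) v l = (\<integral>x. u x * (eigval \<alpha> j l * poly (gderiv \<alpha> j l) x) \<partial>gmeas \<alpha> j)"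
    using weighted_integration_by_parts[OF uv, of "\<alpha> - 1/2 + real j" "gderiv \<alpha> (Suc j) l"] assms(3,4)
    unfolding gcoef_def gmeas_def b ode by blast
  also have "\<dots> = eigval \<alpha> j l * gcoef \<alpha> j u l"
    unfolding gcoef_def
    by (simp only: mult.left_commute[of _ "eigval \<alpha> j l"] integral_mult_right_zero)
  finally show ?thesis .
qed

lemma gcoef_weak_deriv:
  assumes \<alpha>: "\<alpha> \<ge> 0"
    and v: "\<And>j. j \<le> n \<Longrightarrow> has_weak_deriv j u (v j)" "\<And>j. j \<le> n \<Longrightarrow> integrable (gmeas \<alpha> j) (v j)"
    and u: "integrable (gmeas \<alpha> 0) u"
    and "j \<le> n"
  shows "gcoef \<alpha> j (v j) l = eigprod \<alpha> j l * gcoef \<alpha> 0 u l"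
  using assms(5)
proof (induction j)
  case 0
  have loc: "locally_integrable_11 u" using v(1)[OF 0] by (simp add: has_weak_deriv_def)
  have "AE x in leb11. v 0 x = u x"
    by (rule has_weak_deriv_unique[OF v(1)[OF 0] has_weak_deriv_0[OF loc]])
  then have "AE x in gmeas \<alpha> 0. v 0 x * poly (gderiv \<alpha> 0 l) x = u x * poly (gderiv \<alpha> 0 l) x"
    unfolding AE_gmeas by eventually_elim simp
  then have "gcoef \<alpha> 0 (v 0) l = gcoef \<alpha> 0 u l"
    unfolding gcoef_def
    using borel_measurable_integrable[OF integrable_gmeas_times_poly[OF v(2)[OF 0]]]
      borel_measurable_integrable[OF integrable_gmeas_times_poly[OF u]]
    by (intro integral_cong_AE)
  then show ?case by (simp add: eigprod_def)
next
  case (Suc j)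
  have "has_weak_deriv (Suc 0) (v j) (v (Suc j))"
    using v(1)[of j] v(1)[of "Suc j"] Suc.prems by (intro has_weak_deriv_Suc_0) auto
  then have "gcoef \<alpha> (Suc j) (v (Suc j)) l = eigval \<alpha> j l * gcoef \<alpha> j (v j) l"
    using v(2)[of j] v(2)[of "Suc j"] Suc.prems by (intro gcoef_weak_deriv_Suc \<alpha>) auto
  then show ?case using Suc by (simp add: eigprod_def)
qed

lemma inner_gderiv:
  assumes "\<alpha> \<ge> 0"
  shows "(\<integral>x. poly (gderiv \<alpha> j m) x * poly (gderiv \<alpha> j l) x \<partial>gmeas \<alpha> j) =
    eigprod \<alpha> j l * (\<integral>x. poly (gpoly \<alpha> m) x * poly (gpoly \<alpha> l) x \<partial>gmeas \<alpha> 0)"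
proof -
  have "gcoef \<alpha> j (poly ((pderiv ^^ j) (gpoly \<alpha> m))) l = eigprod \<alpha> j l * gcoef \<alpha> 0 (poly (gpoly \<alpha> m)) l"
    by (rule gcoef_weak_deriv[OF assms, where n=j])
       (auto intro: has_weak_deriv_poly integrable_gmeas_poly[OF assms])
  then show ?thesis by (simp add: gcoef_def gderiv_def)
qed

text \<open>The inner product of the first derivatives is \<open>\<lambda>\<^bsub>l,0\<^esub>\<close> as well as \<open>\<lambda>\<^bsub>m,0\<^esub>\<close> times that of the polynomials, and
\<open>\<lambda>\<^bsub>l,0\<^esub> \<noteq> \<lambda>\<^bsub>m,0\<^esub>\<close>.\<close>

lemma gpoly_orthogonal:
  assumes \<alpha>: "\<alpha> \<ge> 0" and "m \<noteq> l"
  shows "(\<integral>x. poly (gpoly \<alpha> m) x * poly (gpoly \<alpha> l) x \<partial>gmeas \<alpha> 0) = 0"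
proof -
  let ?I = "\<integral>x. poly (gpoly \<alpha> m) x * poly (gpoly \<alpha> l) x \<partial>gmeas \<alpha> 0"
  have "eigval \<alpha> 0 l * ?I = eigval \<alpha> 0 m * ?I"
    using inner_gderiv[OF \<alpha>, of 1 m l] inner_gderiv[OF \<alpha>, of 1 l m]
    by (simp add: eigprod_def mult.commute)
  moreover have "eigval \<alpha> 0 l - eigval \<alpha> 0 m = (real l - real m) * (real l + real m + 2 * \<alpha>)"
    by (simp add: eigval_def algebra_simps)
  then have "eigval \<alpha> 0 l \<noteq> eigval \<alpha> 0 m" using assms by auto
  ultimately show ?thesis by simp
qed

lemma integrable_gmeas_eq_0:
  fixes f :: "real \<Rightarrow> real"
  assumes \<alpha>: "\<alpha> \<ge> 0" and f: "integrable (gmeas \<alpha> j) f" and zero: "\<And>l. gcoef \<alpha> j f l = 0"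
  shows "AE x in leb11. f x = 0"
proof -
  let ?b = "\<alpha> - 1/2 + real j"
  have fm: "f \<in> borel_measurable leb11" using f borel_measurable_integrable[OF f] by simp
  have p0: "(\<integral>x. f x * poly p x \<partial>gmeas \<alpha> j) = 0" for p
  proof (rule gderiv_span[OF \<alpha>])
    show "(\<integral>x. f x * poly (p + smult c q) x \<partial>gmeas \<alpha> j) = (\<integral>x. f x * poly p x \<partial>gmeas \<alpha> j) + c * (\<integral>x. f x * poly q x \<partial>gmeas \<alpha> j)" for p q c
      using integrable_gmeas_times_poly[OF f, of p] integrable_gmeas_times_poly[OF f, of q]
      by (simp add: algebra_simps)
    show "(\<integral>x. f x * poly (gderiv \<alpha> j n) x \<partial>gmeas \<alpha> j) = 0" for n
      using zero by (simp add: gcoef_def)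
  qed
  have "AE x in leb11. (1 - x\<^sup>2) powr ?b * f x = 0"
  proof (rule AE_zero_if_orthogonal_to_polys)
    show "integrable leb11 (\<lambda>x. (1 - x\<^sup>2) powr ?b * f x)"
      using f fm by (simp add: gmeas_def integrable_wmeas_iff)
    show "(\<integral>x. (1 - x\<^sup>2) powr ?b * f x * poly p x \<partial>leb11) = 0" for p
      using p0[of p] fm poly_measurable_leb11[of p] by (simp add: gmeas_def integral_wmeas mult.assoc)
  qed
  then have "AE x in leb11. x \<in> space leb11 \<longrightarrow> f x = 0"
  proof eventually_elim
    case (elim x)
    then show ?case using one_minus_square_pos[of x] by auto
  qed
  then show ?thesis using AE_space by eventually_elim simp
qed

lemma gnorm_pos:
  assumes "\<alpha> \<ge> 0"
  shows "gnorm \<alpha> l > 0"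
proof -
  have sq: "integrable (gmeas \<alpha> 0) (\<lambda>x. (poly (gpoly \<alpha> l) x)\<^sup>2)"
    using integrable_gmeas_times_poly[OF integrable_gmeas_poly[OF assms, of 0 "gpoly \<alpha> l"], of "gpoly \<alpha> l"]
    by (simp add: power2_eq_square)
  have "gnorm \<alpha> l \<noteq> 0"
  proof
    assume "gnorm \<alpha> l = 0"
    then have "AE x in gmeas \<alpha> 0. (poly (gpoly \<alpha> l) x)\<^sup>2 = 0"
      using integral_nonneg_eq_0_iff_AE[OF sq] by (simp add: gnorm_def)
    then have z: "AE x in leb11. poly (gpoly \<alpha> l) x = 0" by simp
    have "gpoly \<alpha> l \<noteq> 0" using degree_gpoly[OF assms, of l] by auto
    then have fin: "finite {x. poly (gpoly \<alpha> l) x = 0}" by (rule poly_roots_finite)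
    have "AE x in lebesgue. x \<notin> {x. poly (gpoly \<alpha> l) x = 0}"
      using fin by (intro AE_not_in) (simp add: negligible_iff_null_sets[symmetric] negligible_finite)
    moreover have "AE x in lebesgue. x \<in> {-1<..<1} \<longrightarrow> poly (gpoly \<alpha> l) x = 0"
      using z by (simp add: AE_restrict_space_iff)
    ultimately have "AE x in lebesgue. x \<notin> {-1<..<1::real}" by eventually_elim simp
    then have "{-1<..<1::real} \<in> null_sets lebesgue" by (subst AE_iff_null_sets) auto
    then show False by (simp add: null_sets_def)
  qed
  moreover have "gnorm \<alpha> l \<ge> 0" by (simp add: gnorm_def)
  ultimately show ?thesis by simp
qed

lemma orthogonal_system_gderiv:
  assumes \<alpha>: "\<alpha> \<ge> 0"
  shows "orthogonal_system (gmeas \<alpha> j) (\<lambda>l. poly (gderiv \<alpha> j l)) (\<lambda>l. eigprod \<alpha> j l * gnorm \<alpha> l)"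
proof -
  interpret finite_measure "gmeas \<alpha> j" by (rule finite_measure_gmeas[OF \<alpha>])
  show ?thesis
  proof
    show "poly (gderiv \<alpha> j l) \<in> borel_measurable (gmeas \<alpha> j)" for l by (simp add: poly_measurable_leb11)
    show "\<exists>B. \<forall>x\<in>space (gmeas \<alpha> j). \<bar>poly (gderiv \<alpha> j l) x\<bar> \<le> B" for l
    proof -
      obtain B where B: "\<And>x::real. \<bar>x\<bar> \<le> 1 \<Longrightarrow> \<bar>poly (gderiv \<alpha> j l) x\<bar> \<le> B" using poly_bounded_11 by blast
      show ?thesis
      proof (intro exI ballI)
        fix x assume "x \<in> space (gmeas \<alpha> j)"
        then have "\<bar>x\<bar> \<le> 1" by (simp add: abs_le_iff)
        then show "\<bar>poly (gderiv \<alpha> j l) x\<bar> \<le> B" by (rule B)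
      qed
    qed
    show "(\<integral>x. poly (gderiv \<alpha> j k) x * poly (gderiv \<alpha> j l) x \<partial>gmeas \<alpha> j) = 0" if "k \<noteq> l" for k l
      using inner_gderiv[OF \<alpha>] gpoly_orthogonal[OF \<alpha> that] by simp
    show "(\<integral>x. (poly (gderiv \<alpha> j l) x)\<^sup>2 \<partial>gmeas \<alpha> j) = eigprod \<alpha> j l * gnorm \<alpha> l" for l
      using inner_gderiv[OF \<alpha>, of j l l] by (simp add: gnorm_def power2_eq_square)
    show "AE x in gmeas \<alpha> j. f x = 0"
      if "integrable (gmeas \<alpha> j) f" "\<And>l. (\<integral>x. f x * poly (gderiv \<alpha> j l) x \<partial>gmeas \<alpha> j) = 0" for f
      using integrable_gmeas_eq_0[OF \<alpha> that(1)] that(2) by (simp add: gcoef_def)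
  qed
qed

subsection \<open>Asymptotics of the norms\<close>

text \<open>Pairing the recurrence for \<open>P\<^bsub>n+2\<^esub>\<close> with \<open>P\<^bsub>n+2\<^esub>\<close> and the one for \<open>P\<^bsub>n+3\<^esub>\<close> with \<open>P\<^bsub>n+1\<^esub>\<close> expresses both norms
by the same integral \<open>X\<close> of \<open>x P\<^bsub>n+1\<^esub> P\<^bsub>n+2\<^esub>\<close>.\<close>

lemma gnorm_rec:
  assumes \<alpha>: "\<alpha> \<ge> 0"
  shows "(real n + 1 + 2 * \<alpha>) * (real n + 2 + \<alpha>) * gnorm \<alpha> (Suc (Suc n)) = (real n + 1 + \<alpha>) * (real n + 2) * gnorm \<alpha> (Suc n)"
proof -
  let ?P = "\<lambda>k. poly (gpoly \<alpha> k)" and ?M = "gmeas \<alpha> 0"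
  have ii: "integrable ?M (\<lambda>x. ?P k x * ?P l x)" for k l
    by (intro integrable_gmeas_times_poly integrable_gmeas_poly \<alpha>)
  have ix: "integrable ?M (\<lambda>x. x * ?P k x * ?P l x)" for k l
    using integrable_gmeas_times_poly[OF integrable_gmeas_poly[OF \<alpha>], of 0 "[:0,1:] * gpoly \<alpha> k" "gpoly \<alpha> l"] by simp
  have key: "(real n + 1 + 2 * \<alpha>) * (\<integral>x. ?P (Suc (Suc n)) x * ?P l x \<partial>?M) =
     2 * (real n + 1 + \<alpha>) * (\<integral>x. x * ?P (Suc n) x * ?P l x \<partial>?M) - (real n + 1) * (\<integral>x. ?P n x * ?P l x \<partial>?M)" for n l
  proof -
    have "(real n + 1 + 2 * \<alpha>) * (\<integral>x. ?P (Suc (Suc n)) x * ?P l x \<partial>?M) = (\<integral>x. ((real n + 1 + 2 * \<alpha>) * ?P (Suc (Suc n)) x) * ?P l x \<partial>?M)"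
      by (simp add: mult.assoc del: gpoly.simps)
    also have "\<dots> = (\<integral>x. 2 * (real n + 1 + \<alpha>) * (x * ?P (Suc n) x * ?P l x) - (real n + 1) * (?P n x * ?P l x) \<partial>?M)"
      unfolding gpoly_rec[OF \<alpha>] by (simp add: algebra_simps del: gpoly.simps)
    also have "\<dots> = 2 * (real n + 1 + \<alpha>) * (\<integral>x. x * ?P (Suc n) x * ?P l x \<partial>?M) - (real n + 1) * (\<integral>x. ?P n x * ?P l x \<partial>?M)"
      using ii ix by (simp del: gpoly.simps)
    finally show ?thesis .
  qed
  define X where "X = (\<integral>x. x * ?P (Suc n) x * ?P (Suc (Suc n)) x \<partial>?M)"
  have N: "(\<integral>x. ?P k x * ?P k x \<partial>?M) = gnorm \<alpha> k" for k by (simp add: gnorm_def power2_eq_square)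
  have 1: "(real n + 1 + 2 * \<alpha>) * gnorm \<alpha> (Suc (Suc n)) = 2 * (real n + 1 + \<alpha>) * X"
    using key[of n "Suc (Suc n)"] gpoly_orthogonal[OF \<alpha>, of n "Suc (Suc n)"] unfolding N X_def by (simp del: gpoly.simps)
  have "(\<integral>x. x * ?P (Suc (Suc n)) x * ?P (Suc n) x \<partial>?M) = X" by (simp add: X_def mult_ac del: gpoly.simps)
  then have 2: "2 * (real n + 2 + \<alpha>) * X = (real n + 2) * gnorm \<alpha> (Suc n)"
    using key[of "Suc n" "Suc n"] gpoly_orthogonal[OF \<alpha>, of "Suc (Suc (Suc n))" "Suc n"]
    unfolding N by (simp add: add_ac del: gpoly.simps)
  have "(real n + 1 + 2 * \<alpha>) * (real n + 2 + \<alpha>) * gnorm \<alpha> (Suc (Suc n)) = (real n + 2 + \<alpha>) * ((real n + 1 + 2 * \<alpha>) * gnorm \<alpha> (Suc (Suc n)))"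
    by (simp add: mult_ac del: gpoly.simps)
  also have "\<dots> = (real n + 1 + \<alpha>) * (2 * (real n + 2 + \<alpha>) * X)" unfolding 1 by (simp add: algebra_simps)
  also have "\<dots> = (real n + 1 + \<alpha>) * (real n + 2) * gnorm \<alpha> (Suc n)" unfolding 2 by (simp add: mult_ac)
  finally show ?thesis .
qed

lemma harmonic_dim_rec:
  assumes "d \<ge> 2"
  shows "(2 * real n + real d) * (real n + 2) * harmonic_dim (Suc (Suc n)) d = (2 * real n + 2 + real d) * (real n + real d - 1) * harmonic_dim (Suc n) d"
proof -
  define e where "e = d - 2"
  have e: "d = e + 2" using assms by (simp add: e_def)
  have f: "fact (Suc (Suc n) + d - 3) = (real n + real d - 1) * fact (Suc n + d - 3)"
    by (simp add: e algebra_simps)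
  define q :: real where "q = fact (Suc n + d - 3) / (fact (d - 2) * fact (Suc n))"
  have h1: "harmonic_dim (Suc n) d = (2 * real n + real d) * q"
    unfolding harmonic_dim_def q_def by (simp add: algebra_simps)
  have h2: "harmonic_dim (Suc (Suc n)) d = (2 * real n + 2 + real d) * ((real n + real d - 1) * q / (real n + 2))"
  proof -
    have "fact (Suc (Suc n) + d - 3) / (fact (d - 2) * fact (Suc (Suc n))) = (real n + real d - 1) * q / (real n + 2)"
      unfolding f q_def fact_Suc[of "Suc n"] by (simp add: field_simps del: fact_Suc)
    then show ?thesis unfolding harmonic_dim_def by (simp add: algebra_simps del: fact_Suc)
  qed
  have "(2 * real n + real d) * (real n + 2) * harmonic_dim (Suc (Suc n)) d
      = (2 * real n + real d) * ((2 * real n + 2 + real d) * ((real n + real d - 1) * q))"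
    unfolding h2 by simp
  then show ?thesis unfolding h1 by (simp only: mult_ac)
qed

text \<open>The two factors satisfy reciprocal recurrences. This determines the norms up to a constant factor from
the dimensions \<open>h(l,d)\<close>.\<close>

lemma harmonic_dim_times_gnorm:
  assumes "d \<ge> 2"
  shows "harmonic_dim (Suc n) d * gnorm ((real d - 2) / 2) (Suc n) = harmonic_dim 1 d * gnorm ((real d - 2) / 2) 1"
proof (induction n)
  case (Suc n)
  let ?\<alpha> = "(real d - 2) / 2"
  let ?A = "(2 * real n + real d) * (real n + 2)" and ?B = "(2 * real n + 2 + real d) * (real n + real d - 1)"
  have \<alpha>: "?\<alpha> \<ge> 0" using assms by simp
  have pos: "?A > 0" "?B > 0" using assms by (auto intro!: mult_pos_pos)
  have h: "?A * harmonic_dim (Suc (Suc n)) d = ?B * harmonic_dim (Suc n) d"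
    using harmonic_dim_rec[OF assms, of n] by (simp add: mult.assoc)
  have g: "?B * gnorm ?\<alpha> (Suc (Suc n)) = ?A * gnorm ?\<alpha> (Suc n)"
    using gnorm_rec[OF \<alpha>, of n] by (simp add: field_simps)
  have "?A * ?B * (harmonic_dim (Suc (Suc n)) d * gnorm ?\<alpha> (Suc (Suc n))) = (?A * harmonic_dim (Suc (Suc n)) d) * (?B * gnorm ?\<alpha> (Suc (Suc n)))"
    by (simp only: mult_ac)
  also have "\<dots> = ?A * ?B * (harmonic_dim (Suc n) d * gnorm ?\<alpha> (Suc n))"
    unfolding h g by (simp only: mult_ac)
  finally have "?A * ?B * (harmonic_dim (Suc (Suc n)) d * gnorm ?\<alpha> (Suc (Suc n))) = ?A * ?B * (harmonic_dim (Suc n) d * gnorm ?\<alpha> (Suc n))" .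
  moreover have "?A * ?B \<noteq> 0" using mult_pos_pos[OF pos] by (rule less_imp_neq[THEN not_sym])
  ultimately have "harmonic_dim (Suc (Suc n)) d * gnorm ?\<alpha> (Suc (Suc n)) = harmonic_dim (Suc n) d * gnorm ?\<alpha> (Suc n)"
    using mult_left_cancel by blast
  then show ?case using Suc by simp
qed simp

lemma fact_quotient_bounds:
  fixes l m :: nat
  shows "real l ^ m \<le> fact (l + m) / fact l" "fact (l + m) / fact l \<le> real (l + m) ^ m"
proof -
  show "real l ^ m \<le> fact (l + m) / fact l"
  proof (induction m)
    case (Suc m)
    have "real l ^ Suc m \<le> real (l + Suc m) * (fact (l + m) / fact l)"
      using Suc by (simp only: power_Suc) (intro mult_mono; simp)
    then show ?case by (simp add: algebra_simps)
  qed simp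
  show "fact (l + m) / fact l \<le> real (l + m) ^ m"
  proof (induction m)
    case (Suc m)
    have "fact (l + Suc m) / fact l = real (l + Suc m) * (fact (l + m) / fact l)" by (simp add: algebra_simps)
    also have "\<dots> \<le> real (l + Suc m) * real (l + m) ^ m" using Suc by (intro mult_left_mono) auto
    also have "\<dots> \<le> real (l + Suc m) * real (l + Suc m) ^ m" by (intro mult_left_mono power_mono) auto
    finally show ?case by simp
  qed simp
qed

lemma harmonic_dim_bounds:
  assumes "d \<ge> 2"
  shows "\<exists>c>0. \<exists>C>0. \<forall>l\<ge>1. c * real l ^ (d - 2) \<le> harmonic_dim l d \<and> harmonic_dim l d \<le> C * real l ^ (d - 2)"
proof (cases "d = 2")
  case True
  have "harmonic_dim l d = 2" if "l \<ge> 1" for l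
  proof -
    obtain k where "l = Suc k" using \<open>l \<ge> 1\<close> by (cases l) auto
    then show ?thesis using True by (simp add: harmonic_dim_def field_simps del: of_nat_Suc)
  qed
  then show ?thesis using True by (intro exI[of _ 2] conjI) auto
next
  case False
  define m where "m = d - 3"
  have m: "d = m + 3" using assms False by (simp add: m_def)
  let ?F = "\<lambda>l. fact (l + m) / fact l :: real"
  have h: "harmonic_dim l d = (2 * real l + real m + 1) * ?F l / fact (m + 1)" for l
  proof -
    have "harmonic_dim l d = (2 * real l + (real m + 1)) * (fact (l + m) / (fact (m + 1) * fact l))"
      unfolding harmonic_dim_def m by (simp add: algebra_simps del: fact_Suc)
    then show ?thesis by (simp add: divide_simps mult.commute add.assoc del: fact_Suc)
  qed
  have "2 / fact (m + 1) * real l ^ (m + 1) \<le> harmonic_dim l d \<and>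
      harmonic_dim l d \<le> (real m + 3) * (real m + 1) ^ m / fact (m + 1) * real l ^ (m + 1)" if l: "l \<ge> 1" for l
  proof
    have l1: "real l \<ge> 1" using l by simp
    have "2 * real l * real l ^ m \<le> (2 * real l + real m + 1) * ?F l"
      using fact_quotient_bounds(1)[of l m] by (intro mult_mono) auto
    then show "2 / fact (m + 1) * real l ^ (m + 1) \<le> harmonic_dim l d"
      unfolding h by (simp add: field_simps del: fact_Suc)
    have a: "2 * real l + real m + 1 \<le> (real m + 3) * real l"
      using mult_left_mono[OF l1, of "real m + 1"] by (simp add: algebra_simps)
    have "real (l + m) \<le> (real m + 1) * real l"
      using mult_left_mono[OF l1, of "real m"] by (simp add: algebra_simps)
    then have "real (l + m) ^ m \<le> ((real m + 1) * real l) ^ m" by (intro power_mono) auto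
    then have b: "?F l \<le> (real m + 1) ^ m * real l ^ m"
      using fact_quotient_bounds(2)[of l m] by (simp add: power_mult_distrib)
    have "(2 * real l + real m + 1) * ?F l \<le> ((real m + 3) * real l) * ((real m + 1) ^ m * real l ^ m)"
      by (intro mult_mono a b) auto
    then have "harmonic_dim l d \<le> ((real m + 3) * real l) * ((real m + 1) ^ m * real l ^ m) / fact (m + 1)"
      unfolding h by (rule divide_right_mono) simp
    then show "harmonic_dim l d \<le> (real m + 3) * (real m + 1) ^ m / fact (m + 1) * real l ^ (m + 1)"
      by (simp add: mult_ac del: fact_Suc)
  qed
  moreover have "d - 2 = m + 1" using m by simp
  ultimately show ?thesis
    by (intro exI[of _ "2 / fact (m + 1)"] conjI exI[of _ "(real m + 3) * (real m + 1) ^ m / fact (m + 1)"]) auto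
qed

lemma inverse_gnorm_bounds:
  assumes "d \<ge> 2"
  shows "\<exists>c>0. \<exists>C>0. \<forall>l\<ge>1. c * real l ^ (d - 2) \<le> 1 / gnorm ((real d - 2) / 2) l \<and>
    1 / gnorm ((real d - 2) / 2) l \<le> C * real l ^ (d - 2)"
proof -
  let ?\<alpha> = "(real d - 2) / 2"
  obtain c C where cC: "c > 0" "C > 0"
    "\<And>l. l \<ge> 1 \<Longrightarrow> c * real l ^ (d - 2) \<le> harmonic_dim l d \<and> harmonic_dim l d \<le> C * real l ^ (d - 2)"
    using harmonic_dim_bounds[OF assms] by blast
  define K where "K = harmonic_dim 1 d * gnorm ?\<alpha> 1"
  have g: "gnorm ?\<alpha> l > 0" for l using assms by (intro gnorm_pos) simp
  have "harmonic_dim 1 d > 0" using cC(3)[of 1] cC(1) by simp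
  then have K: "K > 0" using g[of 1] by (simp add: K_def)
  have e: "1 / gnorm ?\<alpha> l = harmonic_dim l d / K" if "l \<ge> 1" for l
  proof -
    obtain k where k: "l = Suc k" using \<open>l \<ge> 1\<close> by (cases l) auto
    have "harmonic_dim l d * gnorm ?\<alpha> l = K"
      unfolding k K_def by (rule harmonic_dim_times_gnorm[OF assms])
    then show ?thesis using K g[of l] by (simp add: field_simps)
  qed
  have "c / K * real l ^ (d - 2) \<le> 1 / gnorm ?\<alpha> l \<and> 1 / gnorm ?\<alpha> l \<le> C / K * real l ^ (d - 2)" if "l \<ge> 1" for l
    unfolding e[OF that] using cC(3)[OF that] K by (simp add: divide_right_mono)
  then show ?thesis using cC K by (intro exI[of _ "c / K"] conjI exI[of _ "C / K"]) auto
qed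

section \<open>The spaces of integer order\<close>

abbreviation dalpha :: "nat \<Rightarrow> real" where
  "dalpha d \<equiv> (real d - 2) / 2"

abbreviation dcoef :: "nat \<Rightarrow> (real \<Rightarrow> real) \<Rightarrow> nat \<Rightarrow> real" where
  "dcoef d u l \<equiv> gcoef (dalpha d) 0 u l"

text \<open>The weights for which the squared norm of order \<open>n\<close> is exactly \<open>\<Sum>\<^sub>l u\<^sub>l\<^sup>2 vweight d n l\<close>.\<close>

definition vweight :: "nat \<Rightarrow> nat \<Rightarrow> nat \<Rightarrow> real" where
  "vweight d n l = (\<Sum>j\<le>n. eigprod (dalpha d) j l) / gnorm (dalpha d) l"

lemma gmeas_dalpha: "gmeas (dalpha d) j = wmeas ((real d - 3) / 2 + real j)"
  by (simp add: gmeas_def diff_divide_distrib)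

lemma dalpha_nonneg: "d \<ge> 2 \<Longrightarrow> dalpha d \<ge> 0"
  by simp

lemma eigprod_0 [simp]: "eigprod \<alpha> 0 l = 1"
  by (simp add: eigprod_def)

lemma eigprod_nonneg:
  assumes "\<alpha> \<ge> 0"
  shows "eigprod \<alpha> j l \<ge> 0"
  using orthogonal_system.N_nonneg[OF orthogonal_system_gderiv[OF assms], of j l] gnorm_pos[OF assms, of l]
  by (simp add: zero_le_mult_iff)

lemma inverse_gnorm_le_vweight:
  assumes "d \<ge> 2"
  shows "1 / gnorm (dalpha d) l \<le> vweight d n l"
proof -
  have "eigprod (dalpha d) 0 l \<le> (\<Sum>j\<le>n. eigprod (dalpha d) j l)"
    using eigprod_nonneg[OF dalpha_nonneg[OF assms]] by (intro member_le_sum) auto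
  then show ?thesis
    unfolding vweight_def using gnorm_pos[OF dalpha_nonneg[OF assms], of l] by (simp add: divide_right_mono)
qed

lemma vweight_pos: "d \<ge> 2 \<Longrightarrow> vweight d n l > 0"
  using inverse_gnorm_le_vweight[of d l n] gnorm_pos[OF dalpha_nonneg, of d l]
  by (meson divide_pos_pos less_le_trans zero_less_one)

lemma vweight_Suc_mono: "d \<ge> 2 \<Longrightarrow> vweight d n l \<le> vweight d (Suc n) l"
  unfolding vweight_def
  using gnorm_pos[OF dalpha_nonneg, of d l] eigprod_nonneg[OF dalpha_nonneg, of d "Suc n" l]
  by (intro divide_right_mono) auto

lemma gegenbauer_coeff_eq_gcoef:
  assumes d: "d \<ge> 2" and u: "u \<in> borel_measurable leb11"
  shows "gegenbauer_coeff d u l = dcoef d u l"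
  unfolding gegenbauer_coeff_def gcoef_def gmeas_dalpha gegenbauer_integrand_def
    gegenbauer_normalized_eq_poly[OF d]
  by (subst integral_wmeas)
     (auto simp: gderiv_def mult_ac intro!: borel_measurable_times u poly_measurable_leb11)

lemma gegenbauer_coeffs_exist_iff:
  assumes d: "d \<ge> 2" and u: "u \<in> borel_measurable leb11"
  shows "gegenbauer_coeffs_exist d u \<longleftrightarrow> integrable (gmeas (dalpha d) 0) u"
proof -
  have *: "integrable leb11 (gegenbauer_integrand d u l) \<longleftrightarrow> integrable (gmeas (dalpha d) 0) (\<lambda>x. u x * poly (gpoly (dalpha d) l) x)" for l
    unfolding gmeas_dalpha gegenbauer_integrand_def[abs_def] gegenbauer_normalized_eq_poly[OF d]
    by (subst integrable_wmeas_iff)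
       (auto simp: mult_ac intro!: borel_measurable_times u poly_measurable_leb11)
  show ?thesis
    unfolding gegenbauer_coeffs_exist_def *
  proof
    assume "\<forall>l. integrable (gmeas (dalpha d) 0) (\<lambda>x. u x * poly (gpoly (dalpha d) l) x)"
    from this[rule_format, of 0] show "integrable (gmeas (dalpha d) 0) u" by simp
  qed (rule allI, rule integrable_gmeas_times_poly)
qed

lemma nn_integral_weight_square:
  assumes "v \<in> borel_measurable leb11"
  shows "(\<integral>\<^sup>+ \<mu>. ennreal ((v \<mu>)\<^sup>2 * (1 - \<mu>\<^sup>2) powr ((real d - 3) / 2 + real j)) \<partial>leb11) =
    (\<integral>\<^sup>+ \<mu>. ennreal ((v \<mu>)\<^sup>2) \<partial>gmeas (dalpha d) j)"
proof -
  have "(\<integral>\<^sup>+ \<mu>. ennreal ((v \<mu>)\<^sup>2) \<partial>gmeas (dalpha d) j)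
      = (\<integral>\<^sup>+ \<mu>. ennreal ((1 - \<mu>\<^sup>2) powr ((real d - 3) / 2 + real j)) * ennreal ((v \<mu>)\<^sup>2) \<partial>leb11)"
    unfolding gmeas_dalpha using assms by (intro nn_integral_wmeas) auto
  also have "\<dots> = (\<integral>\<^sup>+ \<mu>. ennreal ((v \<mu>)\<^sup>2 * (1 - \<mu>\<^sup>2) powr ((real d - 3) / 2 + real j)) \<partial>leb11)"
    by (intro nn_integral_cong) (simp add: ennreal_mult'[symmetric] mult.commute)
  finally show ?thesis by simp
qed

lemma has_weak_deriv_measurable:
  "has_weak_deriv j u v \<Longrightarrow> u \<in> borel_measurable leb11" "has_weak_deriv j u v \<Longrightarrow> v \<in> borel_measurable leb11"
  by (auto simp: has_weak_deriv_def intro: locally_integrable_11_measurable)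

lemma V_nat_norm2_eq_sum:
  assumes "\<And>j. j \<le> n \<Longrightarrow> has_weak_deriv j u (v j)"
  shows "V_nat_norm2 d n u = (\<Sum>j\<le>n. \<integral>\<^sup>+ \<mu>. ennreal ((v j \<mu>)\<^sup>2) \<partial>gmeas (dalpha d) j)"
proof -
  have "V_nat_norm2 d n u = (\<Sum>j\<le>n. \<integral>\<^sup>+ \<mu>. ennreal ((weak_deriv j u \<mu>)\<^sup>2 * (1 - \<mu>\<^sup>2) powr ((real d - 3) / 2 + real j)) \<partial>leb11)"
    unfolding V_nat_norm2_def using assms by (auto intro!: if_P)
  also have "\<dots> = (\<Sum>j\<le>n. \<integral>\<^sup>+ \<mu>. ennreal ((v j \<mu>)\<^sup>2) \<partial>gmeas (dalpha d) j)"
  proof (rule sum.cong[OF refl])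
    fix j assume "j \<in> {..n}"
    then have w: "has_weak_deriv j u (v j)" using assms by simp
    have "AE \<mu> in leb11. weak_deriv j u \<mu> = v j \<mu>" by (rule weak_deriv_AE_eq[OF w])
    then have "(\<integral>\<^sup>+ \<mu>. ennreal ((weak_deriv j u \<mu>)\<^sup>2 * (1 - \<mu>\<^sup>2) powr ((real d - 3) / 2 + real j)) \<partial>leb11)
      = (\<integral>\<^sup>+ \<mu>. ennreal ((v j \<mu>)\<^sup>2 * (1 - \<mu>\<^sup>2) powr ((real d - 3) / 2 + real j)) \<partial>leb11)"
      by (intro nn_integral_cong_AE) (elim eventually_mono, simp)
    also have "\<dots> = (\<integral>\<^sup>+ \<mu>. ennreal ((v j \<mu>)\<^sup>2) \<partial>gmeas (dalpha d) j)"
      by (rule nn_integral_weight_square[OF has_weak_deriv_measurable(2)[OF w]])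
    finally show "(\<integral>\<^sup>+ \<mu>. ennreal ((weak_deriv j u \<mu>)\<^sup>2 * (1 - \<mu>\<^sup>2) powr ((real d - 3) / 2 + real j)) \<partial>leb11)
      = (\<integral>\<^sup>+ \<mu>. ennreal ((v j \<mu>)\<^sup>2) \<partial>gmeas (dalpha d) j)" .
  qed
  finally show ?thesis .
qed

lemma sqint_iff_nn_integral:
  assumes "f \<in> borel_measurable M"
  shows "sqint M f \<longleftrightarrow> (\<integral>\<^sup>+x. ennreal ((f x)\<^sup>2) \<partial>M) < \<infinity>"
  using assms by (auto simp: sqint_def integrable_iff_bounded)

text \<open>Parseval's identity for the \<open>j\<close>-th weak derivative contributes the term of \<open>vweight\<close> with index \<open>j\<close>.\<close>

lemma V_nat_norm2_finite:
  assumes d: "d \<ge> 2" and fin: "V_nat_norm2 d n u < \<infinity>"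
  shows "integrable (gmeas (dalpha d) 0) u"
    and "\<exists>R. (\<lambda>l. (dcoef d u l)\<^sup>2 * vweight d n l) sums R \<and> V_nat_norm2 d n u = ennreal R"
proof -
  let ?\<alpha> = "dalpha d" let ?c = "gcoef ?\<alpha> 0 u"
  note \<alpha> = dalpha_nonneg[OF d]
  have ex: "\<forall>j\<le>n. \<exists>v. has_weak_deriv j u v"
    using fin unfolding V_nat_norm2_def by (rule contrapos_pp) auto
  define v where "v = (\<lambda>j. weak_deriv j u)"
  have w: "has_weak_deriv j u (v j)" if "j \<le> n" for j
    using ex that has_weak_deriv_weak_deriv unfolding v_def by blast
  have norm: "V_nat_norm2 d n u = (\<Sum>j\<le>n. \<integral>\<^sup>+ \<mu>. ennreal ((v j \<mu>)\<^sup>2) \<partial>gmeas ?\<alpha> j)"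
    by (rule V_nat_norm2_eq_sum[OF w])
  have vm: "v j \<in> borel_measurable leb11" if "j \<le> n" for j by (rule has_weak_deriv_measurable(2)[OF w[OF that]])
  have sq: "sqint (gmeas ?\<alpha> j) (v j)" if "j \<le> n" for j
  proof -
    have "(\<integral>\<^sup>+ \<mu>. ennreal ((v j \<mu>)\<^sup>2) \<partial>gmeas ?\<alpha> j) \<le> V_nat_norm2 d n u"
      unfolding norm using that by (intro member_le_sum) auto
    then show ?thesis using fin vm[OF that] by (subst sqint_iff_nn_integral) auto
  qed
  have vi: "integrable (gmeas ?\<alpha> j) (v j)" if "j \<le> n" for j
    by (rule finite_measure.sqint_imp_integrable[OF finite_measure_gmeas[OF \<alpha>] sq[OF that]])
  have um: "u \<in> borel_measurable leb11" by (rule has_weak_deriv_measurable(1)[OF w[of 0]]) simp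
  have "locally_integrable_11 u" using w[of 0] by (simp add: has_weak_deriv_def)
  then have AEu: "AE x in gmeas ?\<alpha> 0. v 0 x = u x"
    unfolding AE_gmeas using has_weak_deriv_unique[OF w[of 0] has_weak_deriv_0] by simp
  show ui: "integrable (gmeas ?\<alpha> 0) u"
    using integrable_cong_AE[OF _ _ AEu] vi[of 0] vm[of 0] um by simp
  have c: "gcoef ?\<alpha> j (v j) l = eigprod ?\<alpha> j l * ?c l" if "j \<le> n" for j l
    by (rule gcoef_weak_deriv[OF \<alpha> w vi ui that])
  have P: "(\<lambda>l. eigprod ?\<alpha> j l * (?c l)\<^sup>2 / gnorm ?\<alpha> l) sums (\<integral>x. (v j x)\<^sup>2 \<partial>gmeas ?\<alpha> j)" if "j \<le> n" for j
  proof -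
    have "(\<lambda>l. (gcoef ?\<alpha> j (v j) l)\<^sup>2 / (eigprod ?\<alpha> j l * gnorm ?\<alpha> l)) sums (\<integral>x. (v j x)\<^sup>2 \<partial>gmeas ?\<alpha> j)"
      using orthogonal_system.Parseval[OF orthogonal_system_gderiv[OF \<alpha>] sq[OF that]]
      unfolding gcoef_def .
    moreover have "(gcoef ?\<alpha> j (v j) l)\<^sup>2 / (eigprod ?\<alpha> j l * gnorm ?\<alpha> l) = eigprod ?\<alpha> j l * (?c l)\<^sup>2 / gnorm ?\<alpha> l" for l
      unfolding c[OF that] by (cases "eigprod ?\<alpha> j l = 0") (simp_all add: power2_eq_square)
    ultimately show ?thesis by simp
  qed
  define R where "R = (\<Sum>j\<le>n. \<integral>x. (v j x)\<^sup>2 \<partial>gmeas ?\<alpha> j)"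
  have "(\<lambda>l. \<Sum>j\<le>n. eigprod ?\<alpha> j l * (?c l)\<^sup>2 / gnorm ?\<alpha> l) sums R"
    unfolding R_def by (rule sums_sum) (use P in auto)
  moreover have "(\<Sum>j\<le>n. eigprod ?\<alpha> j l * (?c l)\<^sup>2 / gnorm ?\<alpha> l) = (?c l)\<^sup>2 * vweight d n l" for l
    by (simp add: vweight_def sum_divide_distrib sum_distrib_left mult.commute)
  moreover have "V_nat_norm2 d n u = (\<Sum>j\<le>n. ennreal (\<integral>x. (v j x)\<^sup>2 \<partial>gmeas ?\<alpha> j))"
    unfolding norm using sq by (intro sum.cong refl nn_integral_eq_integral) (auto simp: sqint_def)
  then have "V_nat_norm2 d n u = ennreal R" unfolding R_def by (simp add: sum_ennreal)
  ultimately show "\<exists>R. (\<lambda>l. (?c l)\<^sup>2 * vweight d n l) sums R \<and> V_nat_norm2 d n u = ennreal R" by auto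
qed

text \<open>Weighted convergence implies convergence against test functions: \<open>\<psi>\<close> divided by the weight is bounded,
because \<open>\<psi>\<close> vanishes near \<open>\<plusminus>1\<close>.\<close>

lemma tendsto_integral_test_fun:
  assumes \<alpha>: "\<alpha> \<ge> 0" and \<psi>: "test_fun_11 \<psi>"
    and f: "sqint (gmeas \<alpha> j) f" and F: "\<And>K. sqint (gmeas \<alpha> j) (F K)"
    and lim: "(\<lambda>K. \<integral>x. (f x - F K x)\<^sup>2 \<partial>gmeas \<alpha> j) \<longlonglongrightarrow> 0"
  shows "(\<lambda>K. \<integral>x. F K x * \<psi> x \<partial>leb11) \<longlonglongrightarrow> (\<integral>x. f x * \<psi> x \<partial>leb11)"
proof -
  let ?b = "\<alpha> - 1/2 + real j" and ?M = "gmeas \<alpha> j"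
  interpret finite_measure ?M by (rule finite_measure_gmeas[OF \<alpha>])
  define g where "g = (\<lambda>x. \<psi> x * (1 - x\<^sup>2) powr (- ?b))"
  have \<psi>m: "\<psi> \<in> borel_measurable leb11" by (rule test_fun_11_measurable[OF \<psi>])
  have gm: "g \<in> borel_measurable leb11" unfolding g_def by (intro borel_measurable_times \<psi>m weight_measurable)
  obtain B r where B: "0 \<le> r" "r < 1" "0 \<le> B" "\<And>x. \<bar>\<psi> x\<bar> \<le> B * indicator {-r..r} x"
    using test_fun_11_bounded[OF \<psi>] by blast
  obtain C where C: "C > 0" "\<And>x. x \<in> {-r..r} \<Longrightarrow> \<bar>(1 - x\<^sup>2) powr (- ?b)\<bar> \<le> C"
    using weight_bounded_inside[OF B(2), of "- ?b"] by blast
  have gB: "\<bar>g x\<bar> \<le> B * C" for x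
  proof (cases "x \<in> {-r..r}")
    case True
    have "\<bar>\<psi> x\<bar> \<le> B" using B(4)[of x] True by simp
    then show ?thesis unfolding g_def abs_mult using C(2)[OF True] B(3) by (intro mult_mono) auto
  next
    case False
    then have "\<psi> x = 0" using B(4)[of x] by simp
    then show ?thesis unfolding g_def using B(3) C(1) by simp
  qed
  have gs: "sqint ?M g" by (rule sqint_bounded) (use gm gB in auto)
  have conv: "(\<integral>x. h x * \<psi> x \<partial>leb11) = (\<integral>x. h x * g x \<partial>?M)" if "sqint ?M h" for h
  proof -
    have hm: "h \<in> borel_measurable leb11" using that by (simp add: sqint_def)
    have "(\<integral>x. h x * g x \<partial>?M) = (\<integral>x. (1 - x\<^sup>2) powr ?b * (h x * g x) \<partial>leb11)"
      unfolding gmeas_def using hm gm by (intro integral_wmeas) auto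
    also have "\<dots> = (\<integral>x. h x * \<psi> x \<partial>leb11)"
    proof (rule Bochner_Integration.integral_cong[OF refl])
      fix x assume "x \<in> space leb11"
      then have "1 - x\<^sup>2 > 0" using one_minus_square_pos[of x] by simp
      then have "(1 - x\<^sup>2) powr ?b * (1 - x\<^sup>2) powr (- ?b) = 1" unfolding powr_add[symmetric] by simp
      then show "(1 - x\<^sup>2) powr ?b * (h x * g x) = h x * \<psi> x"
        unfolding g_def by (metis mult.assoc mult.commute mult_1)
    qed
    finally show ?thesis by simp
  qed
  have "(\<lambda>K. (\<integral>x. (f x - F K x) * g x \<partial>?M)\<^sup>2) \<longlonglongrightarrow> 0"
  proof (rule tendsto_sandwich[OF _ _ tendsto_const])
    show "(\<lambda>K. (\<integral>x. (f x - F K x)\<^sup>2 \<partial>?M) * (\<integral>x. (g x)\<^sup>2 \<partial>?M)) \<longlonglongrightarrow> 0"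
      by (rule tendsto_mult_left_zero[OF lim])
  qed (use integral_Cauchy_Schwarz[OF sqint_diff[OF f F] gs] in auto)
  from tendsto_real_sqrt[OF this] have "(\<lambda>K. (\<integral>x. (f x - F K x) * g x \<partial>?M)) \<longlonglongrightarrow> 0"
    by - (rule tendsto_rabs_zero_cancel, simp)
  moreover have "(\<integral>x. (f x - F K x) * g x \<partial>?M) = (\<integral>x. f x * g x \<partial>?M) - (\<integral>x. F K x * g x \<partial>?M)" for K
    using sqint_times_integrable[OF f gs] sqint_times_integrable[OF F gs] by (simp add: left_diff_distrib)
  ultimately have "(\<lambda>K. (\<integral>x. f x * g x \<partial>?M) - (\<integral>x. F K x * g x \<partial>?M)) \<longlonglongrightarrow> 0" by simp
  from tendsto_diff[OF tendsto_const this, of "\<integral>x. f x * g x \<partial>?M"]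
  have "(\<lambda>K. (\<integral>x. F K x * g x \<partial>?M)) \<longlonglongrightarrow> (\<integral>x. f x * g x \<partial>?M)" by simp
  then show ?thesis unfolding conv[OF f] conv[OF F] .
qed

lemma pderiv_iter_sum: "(pderiv ^^ j) (\<Sum>l\<in>A. smult (c l) (p l)) = (\<Sum>l\<in>A. smult (c l) ((pderiv ^^ j) (p l)))"
  by (simp add: higher_pderiv_sum higher_pderiv_smult)

definition gsum :: "real \<Rightarrow> (nat \<Rightarrow> real) \<Rightarrow> nat \<Rightarrow> real poly" where
  "gsum \<alpha> b K = (\<Sum>l<K. smult (b l / gnorm \<alpha> l) (gpoly \<alpha> l))"

text \<open>The \<open>j\<close>-th derivatives of the partial sums converge in the weighted space of order \<open>j\<close> to some \<open>v\<close>, and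
the partial sums themselves converge to \<open>u\<close>; the identity that defines weak derivatives passes to the
limit.\<close>

lemma ex_weak_derivs_of_coeffs:
  assumes \<alpha>: "\<alpha> \<ge> 0" and u: "integrable (gmeas \<alpha> 0) u"
    and sm: "\<And>i. i \<in> {0, j} \<Longrightarrow> summable (\<lambda>l. (gcoef \<alpha> 0 u l)\<^sup>2 * eigprod \<alpha> i l / gnorm \<alpha> l)"
  shows "\<exists>v. has_weak_deriv j u v \<and> sqint (gmeas \<alpha> j) v"
proof -
  define c where "c = (\<lambda>l. gcoef \<alpha> 0 u l / gnorm \<alpha> l)"
  define S where "S = gsum \<alpha> (gcoef \<alpha> 0 u)"
  have gp: "gnorm \<alpha> l > 0" for l by (rule gnorm_pos[OF \<alpha>])
  have RF: "\<exists>f. sqint (gmeas \<alpha> i) f \<and> (\<forall>l. (\<integral>x. f x * poly (gderiv \<alpha> i l) x \<partial>gmeas \<alpha> i) = c l * (eigprod \<alpha> i l * gnorm \<alpha> l)) \<and>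
     (\<lambda>K. \<integral>x. (f x - poly ((pderiv ^^ i) (S K)) x)\<^sup>2 \<partial>gmeas \<alpha> i) \<longlonglongrightarrow> 0" if i: "i \<in> {0, j}" for i
  proof -
    interpret S: orthogonal_system "gmeas \<alpha> i" "\<lambda>l. poly (gderiv \<alpha> i l)" "\<lambda>l. eigprod \<alpha> i l * gnorm \<alpha> l"
      by (rule orthogonal_system_gderiv[OF \<alpha>])
    have "(c l)\<^sup>2 * (eigprod \<alpha> i l * gnorm \<alpha> l) = (gcoef \<alpha> 0 u l)\<^sup>2 * eigprod \<alpha> i l / gnorm \<alpha> l" for l
      using gp[of l] by (simp add: c_def power2_eq_square)
    then have "summable (\<lambda>l. (c l)\<^sup>2 * (eigprod \<alpha> i l * gnorm \<alpha> l))" using sm[OF i] by simp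
    moreover have "S.psum c {..<K} x = poly ((pderiv ^^ i) (S K)) x" for K x
      unfolding S.psum_def S_def gsum_def pderiv_iter_sum by (simp add: poly_sum c_def gderiv_def)
    ultimately show ?thesis using S.Riesz_Fischer[of c] by simp
  qed
  obtain v where v: "sqint (gmeas \<alpha> j) v"
      "(\<lambda>K. \<integral>x. (v x - poly ((pderiv ^^ j) (S K)) x)\<^sup>2 \<partial>gmeas \<alpha> j) \<longlonglongrightarrow> 0"
    using RF[of j] by blast
  obtain g where g: "sqint (gmeas \<alpha> 0) g" "\<And>l. (\<integral>x. g x * poly (gderiv \<alpha> 0 l) x \<partial>gmeas \<alpha> 0) = c l * (eigprod \<alpha> 0 l * gnorm \<alpha> l)"
      "(\<lambda>K. \<integral>x. (g x - poly ((pderiv ^^ 0) (S K)) x)\<^sup>2 \<partial>gmeas \<alpha> 0) \<longlonglongrightarrow> 0"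
    using RF[of 0] by blast
  have int: "integrable (gmeas \<alpha> i) f" if "sqint (gmeas \<alpha> i) f" for f i
    by (rule finite_measure.sqint_imp_integrable[OF finite_measure_gmeas[OF \<alpha>] that])
  have psq: "sqint (gmeas \<alpha> i) (poly p)" for i p
    unfolding sqint_def using integrable_gmeas_times_poly[OF integrable_gmeas_poly[OF \<alpha>], of i p p]
    by (simp add: power2_eq_square poly_measurable_leb11)
  have "AE x in leb11. g x - u x = 0"
  proof (rule integrable_gmeas_eq_0[OF \<alpha>])
    show gu: "integrable (gmeas \<alpha> 0) (\<lambda>x. g x - u x)" using int[OF g(1)] u by simp
    show "gcoef \<alpha> 0 (\<lambda>x. g x - u x) l = 0" for l
    proof -
      have "gcoef \<alpha> 0 (\<lambda>x. g x - u x) l = (\<integral>x. g x * poly (gderiv \<alpha> 0 l) x \<partial>gmeas \<alpha> 0) - gcoef \<alpha> 0 u l"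
        unfolding gcoef_def using integrable_gmeas_times_poly[OF int[OF g(1)]] integrable_gmeas_times_poly[OF u]
        by (simp add: left_diff_distrib)
      then show ?thesis unfolding g(2) using gp[of l] by (simp add: c_def)
    qed
  qed
  then have gu: "AE x in leb11. g x = u x" by simp
  have loc: "locally_integrable_11 f" if "integrable (gmeas \<alpha> i) f" for f i
    using that unfolding gmeas_def by (rule integrable_wmeas_imp_locally_integrable)
  have "has_weak_deriv j g v"
    unfolding has_weak_deriv_def
  proof (intro conjI allI impI)
    show "locally_integrable_11 g" "locally_integrable_11 v" by (rule loc[OF int], rule g v)+
    fix \<phi> assume \<phi>: "test_fun_11 \<phi>"
    have "(\<lambda>K. \<integral>x. poly ((pderiv ^^ 0) (S K)) x * (deriv ^^ j) \<phi> x \<partial>leb11) \<longlonglongrightarrow> (\<integral>x. g x * (deriv ^^ j) \<phi> x \<partial>leb11)"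
      by (rule tendsto_integral_test_fun[OF \<alpha> test_fun_11_deriv_iter[OF \<phi>] g(1) psq g(3)])
    moreover have "(\<lambda>K. (-1) ^ j * (\<integral>x. poly ((pderiv ^^ j) (S K)) x * \<phi> x \<partial>leb11)) \<longlonglongrightarrow> (-1) ^ j * (\<integral>x. v x * \<phi> x \<partial>leb11)"
      by (intro tendsto_mult_left tendsto_integral_test_fun[OF \<alpha> \<phi> v(1) psq v(2)])
    moreover have "(\<integral>x. poly ((pderiv ^^ 0) (S K)) x * (deriv ^^ j) \<phi> x \<partial>leb11) = (-1) ^ j * (\<integral>x. poly ((pderiv ^^ j) (S K)) x * \<phi> x \<partial>leb11)" for K
      using has_weak_deriv_poly[of j "S K"] \<phi> unfolding has_weak_deriv_def by simp
    ultimately show "(\<integral>x. g x * (deriv ^^ j) \<phi> x \<partial>leb11) = (-1) ^ j * (\<integral>x. v x * \<phi> x \<partial>leb11)"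
      by (simp add: LIMSEQ_unique)
  qed
  then have "has_weak_deriv j u v"
    by (rule has_weak_deriv_AE_cong[OF _ _ gu]) (use borel_measurable_integrable[OF u] in simp)
  then show ?thesis using v(1) by blast
qed

lemma V_nat_norm2_finite_if_summable:
  assumes d: "d \<ge> 2" and u: "integrable (gmeas (dalpha d) 0) u"
    and sm: "summable (\<lambda>l. (dcoef d u l)\<^sup>2 * vweight d n l)"
  shows "V_nat_norm2 d n u < \<infinity>"
proof -
  let ?\<alpha> = "dalpha d"
  note \<alpha> = dalpha_nonneg[OF d]
  have smj: "summable (\<lambda>l. (gcoef ?\<alpha> 0 u l)\<^sup>2 * eigprod ?\<alpha> j l / gnorm ?\<alpha> l)" if "j \<le> n" for j
  proof (rule summable_comparison_test'[OF sm])
    fix l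
    have "eigprod ?\<alpha> j l \<le> (\<Sum>j\<le>n. eigprod ?\<alpha> j l)"
      using eigprod_nonneg[OF \<alpha>] that by (intro member_le_sum) auto
    then have "eigprod ?\<alpha> j l / gnorm ?\<alpha> l \<le> vweight d n l"
      unfolding vweight_def using gnorm_pos[OF \<alpha>, of l] by (intro divide_right_mono) auto
    then have "(gcoef ?\<alpha> 0 u l)\<^sup>2 * (eigprod ?\<alpha> j l / gnorm ?\<alpha> l) \<le> (gcoef ?\<alpha> 0 u l)\<^sup>2 * vweight d n l"
      by (intro mult_left_mono) auto
    then show "norm ((gcoef ?\<alpha> 0 u l)\<^sup>2 * eigprod ?\<alpha> j l / gnorm ?\<alpha> l) \<le> (gcoef ?\<alpha> 0 u l)\<^sup>2 * vweight d n l"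
      using eigprod_nonneg[OF \<alpha>, of j l] gnorm_pos[OF \<alpha>, of l] by simp
  qed
  have "\<exists>v. has_weak_deriv j u v \<and> sqint (gmeas ?\<alpha> j) v" if "j \<le> n" for j
    by (rule ex_weak_derivs_of_coeffs[OF \<alpha> u]) (use smj[of 0] smj[OF that] in auto)
  then obtain v where v: "\<And>j. j \<le> n \<Longrightarrow> has_weak_deriv j u (v j)" "\<And>j. j \<le> n \<Longrightarrow> sqint (gmeas ?\<alpha> j) (v j)"
    by metis
  have "(\<integral>\<^sup>+ \<mu>. ennreal ((v j \<mu>)\<^sup>2) \<partial>gmeas ?\<alpha> j) < \<infinity>" if "j \<le> n" for j
    using v(2)[OF that] sqint_iff_nn_integral[of "v j" "gmeas ?\<alpha> j"] by (simp add: sqint_def)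
  moreover have "V_nat_norm2 d n u = (\<Sum>j\<le>n. \<integral>\<^sup>+ \<mu>. ennreal ((v j \<mu>)\<^sup>2) \<partial>gmeas ?\<alpha> j)"
    by (rule V_nat_norm2_eq_sum[OF v(1)])
  ultimately show ?thesis by (simp add: less_top[symmetric])
qed

lemma gcoef_lincomb:
  assumes "integrable (gmeas \<alpha> j) u" "integrable (gmeas \<alpha> j) v"
  shows "gcoef \<alpha> j (\<lambda>x. a * u x + b * v x) l = a * gcoef \<alpha> j u l + b * gcoef \<alpha> j v l"
  unfolding gcoef_def
  using integrable_gmeas_times_poly[OF assms(1)] integrable_gmeas_times_poly[OF assms(2)]
  by (simp add: distrib_right mult.assoc)

lemma gcoef_gsum:
  assumes "\<alpha> \<ge> 0"
  shows "gcoef \<alpha> 0 (poly (gsum \<alpha> b K)) l = (if l < K then b l else 0)"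
proof -
  interpret S: orthogonal_system "gmeas \<alpha> 0" "\<lambda>l. poly (gderiv \<alpha> 0 l)" "\<lambda>l. eigprod \<alpha> 0 l * gnorm \<alpha> l"
    by (rule orthogonal_system_gderiv[OF assms])
  have "poly (gsum \<alpha> b K) = S.psum (\<lambda>l. b l / gnorm \<alpha> l) {..<K}"
    unfolding S.psum_def[abs_def] gsum_def by (simp add: poly_sum gderiv_def fun_eq_iff)
  then show ?thesis
    using S.psum_coeff[of "{..<K}" "\<lambda>l. b l / gnorm \<alpha> l" l] gnorm_pos[OF assms, of l]
    by (simp add: gcoef_def)
qed

lemma poly_in_sobolev_H: "poly p \<in> sobolev_H n"
proof -
  have "poly q \<in> L2_11" for q
  proof -
    have "integrable (wmeas 0) (poly (q * q))" by (rule integrable_wmeas_poly) simp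
    then have "integrable leb11 (\<lambda>x. (1 - x\<^sup>2) powr 0 * poly (q * q) x)"
      using poly_measurable_leb11 integrable_wmeas_iff by blast
    also have "?this \<longleftrightarrow> integrable leb11 (\<lambda>x. (poly q x)\<^sup>2)"
      by (rule Bochner_Integration.integrable_cong[OF refl])
         (use one_minus_square_pos in \<open>fastforce simp: power2_eq_square\<close>)
    finally show ?thesis by (simp add: L2_11_def poly_measurable_leb11)
  qed
  then show ?thesis unfolding sobolev_H_def using has_weak_deriv_poly by blast
qed

text \<open>The difference between \<open>u\<close> and a partial sum of its expansion has the coefficients of \<open>u\<close> beyond some
index and none before, so its norm is the tail of a convergent series. This puts \<open>u\<close> into the closure of
the Sobolev space.\<close>

lemma V_nat_iff:
  assumes d: "d \<ge> 2"
  shows "u \<in> V_nat d n \<longleftrightarrow> integrable (gmeas (dalpha d) 0) u \<and>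
    summable (\<lambda>l. (dcoef d u l)\<^sup>2 * vweight d n l)"
proof
  assume "u \<in> V_nat d n"
  then have "V_nat_norm2 d n u < \<infinity>" by (simp add: V_nat_def)
  from V_nat_norm2_finite[OF d this] show "integrable (gmeas (dalpha d) 0) u \<and>
    summable (\<lambda>l. (dcoef d u l)\<^sup>2 * vweight d n l)"
    by (auto simp: sums_iff)
next
  let ?\<alpha> = "dalpha d"
  note \<alpha> = dalpha_nonneg[OF d]
  define a where "a = (\<lambda>l. (gcoef ?\<alpha> 0 u l)\<^sup>2 * vweight d n l)"
  assume "integrable (gmeas ?\<alpha> 0) u \<and> summable (\<lambda>l. (gcoef ?\<alpha> 0 u l)\<^sup>2 * vweight d n l)"
  then have u: "integrable (gmeas ?\<alpha> 0) u" and sm: "summable a" by (auto simp: a_def)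
  define f where "f = (\<lambda>k. poly (gsum ?\<alpha> (gcoef ?\<alpha> 0 u) k))"
  have nrm: "V_nat_norm2 d n (\<lambda>\<mu>. f k \<mu> - u \<mu>) = ennreal (suminf a - sum a {..<k})" for k
  proof -
    have fi: "integrable (gmeas ?\<alpha> 0) (f k)" unfolding f_def by (rule integrable_gmeas_poly[OF \<alpha>])
    have i: "integrable (gmeas ?\<alpha> 0) (\<lambda>\<mu>. f k \<mu> - u \<mu>)" using fi u by simp
    have "gcoef ?\<alpha> 0 (\<lambda>\<mu>. 1 * f k \<mu> + (-1) * u \<mu>) l = (if l < k then 0 else - gcoef ?\<alpha> 0 u l)" for l
      unfolding gcoef_lincomb[OF fi u] unfolding f_def gcoef_gsum[OF \<alpha>] by simp
    then have co: "(gcoef ?\<alpha> 0 (\<lambda>\<mu>. f k \<mu> - u \<mu>) l)\<^sup>2 * vweight d n l = a l - (if l \<in> {..<k} then a l else 0)" for l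
      by (simp add: a_def)
    have "(\<lambda>l. a l - (if l \<in> {..<k} then a l else 0)) sums (suminf a - sum a {..<k})"
      using sm by (intro sums_diff summable_sums sums_If_finite_set) auto
    then have s: "(\<lambda>l. (gcoef ?\<alpha> 0 (\<lambda>\<mu>. f k \<mu> - u \<mu>) l)\<^sup>2 * vweight d n l) sums (suminf a - sum a {..<k})"
      unfolding co .
    then have "V_nat_norm2 d n (\<lambda>\<mu>. f k \<mu> - u \<mu>) < \<infinity>"
      by (intro V_nat_norm2_finite_if_summable[OF d i]) (simp add: sums_iff)
    from V_nat_norm2_finite(2)[OF d this] show ?thesis using sums_unique2[OF s] by auto
  qed
  have "V_nat_norm2 d n u < \<infinity>"
    using V_nat_norm2_finite_if_summable[OF d u] sm by (simp add: a_def)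
  moreover have "\<forall>k. f k \<in> sobolev_H n" unfolding f_def using poly_in_sobolev_H by blast
  moreover have "(\<lambda>k. V_nat_norm2 d n (\<lambda>\<mu>. f k \<mu> - u \<mu>)) \<longlonglongrightarrow> 0"
  proof -
    have "(\<lambda>k. suminf a - sum a {..<k}) \<longlonglongrightarrow> suminf a - suminf a"
      by (intro tendsto_diff tendsto_const summable_LIMSEQ[OF sm])
    then have "(\<lambda>k. ennreal (suminf a - sum a {..<k})) \<longlonglongrightarrow> ennreal 0" by (intro tendsto_ennrealI) simp
    then show ?thesis unfolding nrm by simp
  qed
  ultimately show "u \<in> V_nat d n" unfolding V_nat_def by blast
qed

lemma V_nat_norm2_eq:
  assumes d: "d \<ge> 2" and u: "u \<in> V_nat d n"
  shows "V_nat_norm2 d n u = ennreal (\<Sum>l. (dcoef d u l)\<^sup>2 * vweight d n l)"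
  using V_nat_norm2_finite(2)[OF d, of n u] u by (auto simp: V_nat_def sums_iff)

lemma ex_V_nat_of_coeffs:
  assumes d: "d \<ge> 2" and sm: "summable (\<lambda>l. (b l)\<^sup>2 * vweight d n l)"
  shows "\<exists>w\<in>V_nat d n. \<forall>l. dcoef d w l = b l"
proof -
  let ?\<alpha> = "dalpha d"
  note \<alpha> = dalpha_nonneg[OF d]
  interpret S: orthogonal_system "gmeas ?\<alpha> 0" "\<lambda>l. poly (gderiv ?\<alpha> 0 l)" "\<lambda>l. eigprod ?\<alpha> 0 l * gnorm ?\<alpha> l"
    by (rule orthogonal_system_gderiv[OF \<alpha>])
  have gp: "gnorm ?\<alpha> l > 0" for l by (rule gnorm_pos[OF \<alpha>])
  have "summable (\<lambda>l. (b l / gnorm ?\<alpha> l)\<^sup>2 * (eigprod ?\<alpha> 0 l * gnorm ?\<alpha> l))"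
  proof (rule summable_comparison_test'[OF sm])
    fix l
    have "(b l / gnorm ?\<alpha> l)\<^sup>2 * (eigprod ?\<alpha> 0 l * gnorm ?\<alpha> l) = (b l)\<^sup>2 * (1 / gnorm ?\<alpha> l)"
      using gp[of l] by (simp add: power2_eq_square)
    moreover have "\<dots> \<le> (b l)\<^sup>2 * vweight d n l"
      by (intro mult_left_mono inverse_gnorm_le_vweight[OF d]) auto
    moreover have "0 \<le> (b l)\<^sup>2 * (1 / gnorm ?\<alpha> l)" using gp[of l] by simp
    ultimately show "norm ((b l / gnorm ?\<alpha> l)\<^sup>2 * (eigprod ?\<alpha> 0 l * gnorm ?\<alpha> l)) \<le> (b l)\<^sup>2 * vweight d n l"
      by simp
  qed
  from S.Riesz_Fischer[OF this] obtain w where w: "sqint (gmeas ?\<alpha> 0) w"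
      "\<And>l. (\<integral>x. w x * poly (gderiv ?\<alpha> 0 l) x \<partial>gmeas ?\<alpha> 0) = b l / gnorm ?\<alpha> l * (eigprod ?\<alpha> 0 l * gnorm ?\<alpha> l)"
    by blast
  have c: "gcoef ?\<alpha> 0 w l = b l" for l using w(2)[of l] gp[of l] by (simp add: gcoef_def)
  have "w \<in> V_nat d n" using S.sqint_imp_integrable[OF w(1)] sm by (simp add: V_nat_iff[OF d] c)
  then show ?thesis using c by blast
qed

subsection \<open>Growth of the weights\<close>

lemma eigval_le:
  assumes "\<alpha> \<ge> 0" "l \<ge> 1"
  shows "eigval \<alpha> i l \<le> (1 + 2 * \<alpha>) * (real l)\<^sup>2"
proof -
  have "eigval \<alpha> i l = (real l)\<^sup>2 + 2 * \<alpha> * real l - (real i)\<^sup>2 - 2 * \<alpha> * real i"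
    by (simp add: eigval_def power2_eq_square algebra_simps)
  also have "\<dots> \<le> (real l)\<^sup>2 + 2 * \<alpha> * real l"
  proof -
    have "0 \<le> (real i)\<^sup>2" "0 \<le> 2 * \<alpha> * real i" using assms by simp_all
    then show ?thesis by linarith
  qed
  also have "\<dots> \<le> (real l)\<^sup>2 + 2 * \<alpha> * (real l)\<^sup>2"
    using assms by (intro add_left_mono mult_left_mono) (auto simp: power2_eq_square)
  finally show ?thesis by (simp add: algebra_simps)
qed

lemma eigprod_upper:
  assumes "\<alpha> \<ge> 0" "l \<ge> 1" "j \<le> n"
  shows "eigprod \<alpha> j l \<le> (1 + 2 * \<alpha>) ^ n * real l ^ (2 * n)"
proof (cases "j \<le> l")
  case True
  have "eigprod \<alpha> j l \<le> (\<Prod>i<j. (1 + 2 * \<alpha>) * (real l)\<^sup>2)"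
    unfolding eigprod_def
  proof (rule prod_mono)
    fix i assume "i \<in> {..<j}"
    then have "i \<le> l" using True by simp
    then show "0 \<le> eigval \<alpha> i l \<and> eigval \<alpha> i l \<le> (1 + 2 * \<alpha>) * (real l)\<^sup>2"
      using eigval_le[OF assms(1,2)] assms(1) by (simp add: eigval_def)
  qed
  also have "\<dots> = ((1 + 2 * \<alpha>) * (real l)\<^sup>2) ^ j" by simp
  also have "\<dots> \<le> ((1 + 2 * \<alpha>) * (real l)\<^sup>2) ^ n"
  proof (rule power_increasing[OF assms(3)])
    have "1 * 1 \<le> (1 + 2 * \<alpha>) * (real l)\<^sup>2"
      using assms by (intro mult_mono) auto
    then show "1 \<le> (1 + 2 * \<alpha>) * (real l)\<^sup>2" by simp
  qed
  finally show ?thesis by (simp add: power_mult_distrib power_mult)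
next
  case False
  then have "eigval \<alpha> l l = 0" "l \<in> {..<j}" by (auto simp: eigval_def)
  then have "eigprod \<alpha> j l = 0" unfolding eigprod_def by (intro prod_zero) auto
  then show ?thesis using assms by simp
qed

text \<open>For \<open>i < n \<le> l\<close> the factor \<open>l - i\<close> is at least \<open>l / n\<close> and the other factor of the eigenvalue is at least
\<open>l\<close>.\<close>

lemma power_le_eigprod:
  assumes "\<alpha> \<ge> 0" "n \<ge> 1" "l \<ge> n"
  shows "real l ^ (2 * n) \<le> real n ^ n * eigprod \<alpha> n l"
proof -
  have "(\<Prod>i<n. (real l)\<^sup>2) \<le> (\<Prod>i<n. real n * eigval \<alpha> i l)"
  proof (rule prod_mono)
    fix i assume "i \<in> {..<n}"
    then have i: "real i \<le> real n - 1" by simp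
    have "0 \<le> (real n - 1) * (real l - real n)" using assms by (intro mult_nonneg_nonneg) auto
    then have "real l \<le> real n * (real l - (real n - 1))" by (simp add: algebra_simps)
    also have "\<dots> \<le> real n * (real l - real i)" using i by (intro mult_left_mono) auto
    finally have "real l * real l \<le> (real n * (real l - real i)) * (real l + real i + 2 * \<alpha>)"
      using assms by (intro mult_mono) auto
    then show "0 \<le> (real l)\<^sup>2 \<and> (real l)\<^sup>2 \<le> real n * eigval \<alpha> i l"
      by (simp add: eigval_def power2_eq_square mult.assoc)
  qed
  then show ?thesis by (simp add: eigprod_def prod.distrib power_mult)
qed

lemma sum_eigprod_bounds:
  assumes "\<alpha> \<ge> 0"
  shows "\<exists>c>0. \<exists>C>0. \<forall>l\<ge>1. c * real l ^ (2 * n) \<le> (\<Sum>j\<le>n. eigprod \<alpha> j l) \<and>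
    (\<Sum>j\<le>n. eigprod \<alpha> j l) \<le> C * real l ^ (2 * n)"
proof (intro exI conjI allI impI)
  \<comment> \<open>Large enough for the finitely many \<open>l < n\<close>, at which the product of order \<open>n\<close> vanishes.\<close>
  define q where "q = max 1 (real n) ^ (2 * n)"
  have q: "q \<ge> 1" by (simp add: q_def one_le_power)
  show "0 < 1 / (2 * q)" using q by simp
  show "0 < (real n + 1) * (1 + 2 * \<alpha>) ^ n" using assms by (intro mult_pos_pos zero_less_power) auto
  fix l :: nat assume l: "l \<ge> 1"
  have "(\<Sum>j\<le>n. eigprod \<alpha> j l) \<le> (\<Sum>j\<le>n. (1 + 2 * \<alpha>) ^ n * real l ^ (2 * n))"
    using eigprod_upper[OF assms l] by (intro sum_mono) auto
  then show "(\<Sum>j\<le>n. eigprod \<alpha> j l) \<le> (real n + 1) * (1 + 2 * \<alpha>) ^ n * real l ^ (2 * n)"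
    by (simp add: algebra_simps)
  have le0: "eigprod \<alpha> j l \<le> (\<Sum>j\<le>n. eigprod \<alpha> j l)" if "j \<le> n" for j
    using eigprod_nonneg[OF assms] that by (intro member_le_sum) auto
  have S1: "1 \<le> (\<Sum>j\<le>n. eigprod \<alpha> j l)" using le0[of 0] by simp
  have "real l ^ (2 * n) \<le> q * (\<Sum>j\<le>n. eigprod \<alpha> j l)"
  proof (cases "n \<ge> 1 \<and> l \<ge> n")
    case True
    then have "real l ^ (2 * n) \<le> real n ^ n * eigprod \<alpha> n l" using power_le_eigprod[OF assms] by simp
    also have "\<dots> \<le> q * (\<Sum>j\<le>n. eigprod \<alpha> j l)"
    proof (rule mult_mono)
      have "real n ^ n \<le> real n ^ (2 * n)" using True by (intro power_increasing) auto
      then show "real n ^ n \<le> q" using True by (simp add: q_def max_def)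
    qed (use le0[of n] eigprod_nonneg[OF assms] q in auto)
    finally show ?thesis .
  next
    case False
    have "real l ^ (2 * n) \<le> q"
    proof (cases "n = 0")
      case False
      then have "real l \<le> max 1 (real n)" using \<open>\<not> (n \<ge> 1 \<and> l \<ge> n)\<close> by auto
      then show ?thesis unfolding q_def by (intro power_mono) auto
    qed (use q in simp)
    also have "\<dots> \<le> q * (\<Sum>j\<le>n. eigprod \<alpha> j l)" using S1 q by simp
    finally show ?thesis .
  qed
  then have "1 / (2 * q) * real l ^ (2 * n) \<le> 1 / (2 * q) * (q * (\<Sum>j\<le>n. eigprod \<alpha> j l))"
    using q by (intro mult_left_mono) auto
  also have "\<dots> = (\<Sum>j\<le>n. eigprod \<alpha> j l) / 2" using q by simp
  also have "\<dots> \<le> (\<Sum>j\<le>n. eigprod \<alpha> j l)" using S1 by simp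
  finally show "1 / (2 * q) * real l ^ (2 * n) \<le> (\<Sum>j\<le>n. eigprod \<alpha> j l)" .
qed

lemma vweight_bounds:
  assumes d: "d \<ge> 2"
  shows "\<exists>c>0. \<exists>C>0. \<forall>l\<ge>1. c * real l powr (real d - 2 + 2 * real n) \<le> vweight d n l \<and>
    vweight d n l \<le> C * real l powr (real d - 2 + 2 * real n)"
proof -
  let ?\<alpha> = "dalpha d"
  obtain c1 C1 where 1: "c1 > 0" "C1 > 0" "\<And>l. l \<ge> 1 \<Longrightarrow> c1 * real l ^ (d - 2) \<le> 1 / gnorm ?\<alpha> l \<and> 1 / gnorm ?\<alpha> l \<le> C1 * real l ^ (d - 2)"
    using inverse_gnorm_bounds[OF d] by blast
  obtain c2 C2 where 2: "c2 > 0" "C2 > 0" "\<And>l. l \<ge> 1 \<Longrightarrow> c2 * real l ^ (2 * n) \<le> (\<Sum>j\<le>n. eigprod ?\<alpha> j l) \<and> (\<Sum>j\<le>n. eigprod ?\<alpha> j l) \<le> C2 * real l ^ (2 * n)"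
    using sum_eigprod_bounds[OF dalpha_nonneg[OF d], of n] by blast
  have "c2 * c1 * real l powr (real d - 2 + 2 * real n) \<le> vweight d n l \<and> vweight d n l \<le> C2 * C1 * real l powr (real d - 2 + 2 * real n)"
    if l: "l \<ge> 1" for l
  proof -
    have p: "real l powr (real d - 2 + 2 * real n) = real l ^ (2 * n) * real l ^ (d - 2)"
      using l d by (simp add: powr_realpow[symmetric] powr_add[symmetric] of_nat_diff add_ac)
    have w: "vweight d n l = (\<Sum>j\<le>n. eigprod ?\<alpha> j l) * (1 / gnorm ?\<alpha> l)" by (simp add: vweight_def)
    have gp: "0 \<le> 1 / gnorm ?\<alpha> l" using gnorm_pos[OF dalpha_nonneg[OF d], of l] by simp
    have S0: "0 \<le> (\<Sum>j\<le>n. eigprod ?\<alpha> j l)" by (intro sum_nonneg eigprod_nonneg[OF dalpha_nonneg[OF d]])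
    have "(c2 * real l ^ (2 * n)) * (c1 * real l ^ (d - 2)) \<le> vweight d n l"
      unfolding w using 1 2 l S0 by (intro mult_mono) auto
    moreover have "vweight d n l \<le> (C2 * real l ^ (2 * n)) * (C1 * real l ^ (d - 2))"
      unfolding w using 1 2 l gp by (intro mult_mono) auto
    ultimately show ?thesis unfolding p by (simp add: mult_ac)
  qed
  then show ?thesis using 1(1,2) 2(1,2) by (intro exI[of _ "c2 * c1"] conjI exI[of _ "C2 * C1"]) auto
qed

section \<open>Real interpolation between consecutive orders\<close>

abbreviation wsum :: "nat \<Rightarrow> (nat \<Rightarrow> real) \<Rightarrow> (real \<Rightarrow> real) \<Rightarrow> ennreal" where
  "wsum d w u \<equiv> \<Sum>l. ennreal ((dcoef d u l)\<^sup>2 * w l)"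

lemma V_nat_measurable: "d \<ge> 2 \<Longrightarrow> u \<in> V_nat d n \<Longrightarrow> u \<in> borel_measurable leb11"
  using V_nat_iff[of d u n] borel_measurable_integrable[of "gmeas (dalpha d) 0" u] by simp

lemma V_nat_norm_square:
  assumes d: "d \<ge> 2" and u: "u \<in> V_nat d n"
  shows "(V_nat_norm d n u)\<^sup>2 = (\<Sum>l. (dcoef d u l)\<^sup>2 * vweight d n l)" "0 \<le> V_nat_norm d n u"
proof -
  have "0 \<le> (\<Sum>l. (dcoef d u l)\<^sup>2 * vweight d n l)"
    using u by (intro suminf_nonneg mult_nonneg_nonneg less_imp_le[OF vweight_pos[OF d]])
      (simp_all add: V_nat_iff[OF d])
  then show "(V_nat_norm d n u)\<^sup>2 = (\<Sum>l. (dcoef d u l)\<^sup>2 * vweight d n l)" "0 \<le> V_nat_norm d n u"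
    unfolding V_nat_norm_def V_nat_norm2_eq[OF d u] by simp_all
qed

lemma V_nat_Suc_subset:
  assumes d: "d \<ge> 2" and u: "u \<in> V_nat d (Suc n)"
  shows "u \<in> V_nat d n"
proof -
  have "summable (\<lambda>l. (dcoef d u l)\<^sup>2 * vweight d n l)"
  proof (rule summable_comparison_test')
    show "summable (\<lambda>l. (dcoef d u l)\<^sup>2 * vweight d (Suc n) l)" using u V_nat_iff[OF d] by blast
    show "norm ((dcoef d u l)\<^sup>2 * vweight d n l) \<le> (dcoef d u l)\<^sup>2 * vweight d (Suc n) l" for l
      using vweight_Suc_mono[OF d, of n l] vweight_pos[OF d, of n l] by (simp add: mult_left_mono)
  qed
  then show ?thesis using u V_nat_iff[OF d] by blast
qed

text \<open>The decompositions in the K-functional are identities almost everywhere. That such a sum is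
measurable rests on the completeness of Lebesgue measure.\<close>

lemma measurable_leb11_AE_cong:
  fixes f g :: "real \<Rightarrow> real"
  assumes "f \<in> borel_measurable leb11" "AE x in leb11. f x = g x"
  shows "g \<in> borel_measurable leb11"
proof -
  have "(\<lambda>x. indicator {-1<..<1} x *\<^sub>R g x) \<in> borel_measurable lebesgue"
  proof (rule borel_measurable_AE)
    show "(\<lambda>x. indicator {-1<..<1} x *\<^sub>R f x) \<in> borel_measurable lebesgue"
      using assms(1) by (subst (asm) borel_measurable_restrict_space_iff) auto
    have "AE x in lebesgue. x \<in> {-1<..<1} \<longrightarrow> f x = g x"
      using assms(2) by (subst (asm) AE_restrict_space_iff) auto
    then show "AE x in lebesgue. indicator {-1<..<1} x *\<^sub>R f x = indicator {-1<..<1} x *\<^sub>R g x"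
      by eventually_elim (auto simp: indicator_def)
  qed
  then show ?thesis by (subst borel_measurable_restrict_space_iff) auto
qed

lemma decomposition_coeffs:
  assumes d: "d \<ge> 2" and v: "v \<in> V_nat d n" and w: "w \<in> V_nat d (Suc n)"
    and uvw: "AE x in leb11. u x = v x + w x"
  shows "u \<in> V_nat d n" "dcoef d u l = dcoef d v l + dcoef d w l"
proof -
  let ?M = "gmeas (dalpha d) 0" and ?c = "dcoef d"
  have w': "w \<in> V_nat d n" by (rule V_nat_Suc_subset[OF d w])
  have iv: "integrable ?M v" and iw: "integrable ?M w" using v w' V_nat_iff[OF d] by auto
  have "AE x in leb11. v x + w x = u x" using uvw by eventually_elim simp
  moreover have vwm: "(\<lambda>x. v x + w x) \<in> borel_measurable leb11"
    using V_nat_measurable[OF d] v w by auto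
  ultimately have um: "u \<in> borel_measurable leb11" by (rule measurable_leb11_AE_cong[rotated])
  have iu: "integrable ?M u"
    using integrable_cong_AE[of u ?M "\<lambda>x. v x + w x"] um vwm uvw iv iw by simp
  have c: "?c u l = ?c v l + ?c w l" for l
  proof -
    have "?c u l = ?c (\<lambda>x. 1 * v x + 1 * w x) l"
      unfolding gcoef_def
    proof (rule integral_cong_AE)
      show "(\<lambda>x. u x * poly (gderiv (dalpha d) 0 l) x) \<in> borel_measurable ?M"
        by (rule borel_measurable_integrable[OF integrable_gmeas_times_poly[OF iu]])
      show "(\<lambda>x. (1 * v x + 1 * w x) * poly (gderiv (dalpha d) 0 l) x) \<in> borel_measurable ?M"
        using vwm poly_measurable_leb11 by simp
      show "AE x in ?M. u x * poly (gderiv (dalpha d) 0 l) x = (1 * v x + 1 * w x) * poly (gderiv (dalpha d) 0 l) x"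
        unfolding AE_gmeas using uvw by eventually_elim simp
    qed
    then show ?thesis unfolding gcoef_lincomb[OF iv iw] by simp
  qed
  then show "?c u l = ?c v l + ?c w l" .
  have "summable (\<lambda>l. 2 * ((?c v l)\<^sup>2 * vweight d n l) + 2 * ((?c w l)\<^sup>2 * vweight d n l))"
    using v w' V_nat_iff[OF d] by (intro summable_add summable_mult) auto
  then have "summable (\<lambda>l. (?c u l)\<^sup>2 * vweight d n l)"
  proof (rule summable_comparison_test')
    fix l
    have "(?c u l)\<^sup>2 \<le> 2 * (?c v l)\<^sup>2 + 2 * (?c w l)\<^sup>2"
      unfolding c using sum_squares_bound[of "?c v l" "?c w l"] by (simp add: power2_sum)
    then have "(?c u l)\<^sup>2 * vweight d n l \<le> (2 * (?c v l)\<^sup>2 + 2 * (?c w l)\<^sup>2) * vweight d n l"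
      using vweight_pos[OF d, of n l] by (intro mult_right_mono) auto
    then show "norm ((?c u l)\<^sup>2 * vweight d n l) \<le> 2 * ((?c v l)\<^sup>2 * vweight d n l) + 2 * ((?c w l)\<^sup>2 * vweight d n l)"
      using vweight_pos[OF d, of n l] by (simp add: algebra_simps)
  qed
  then show "u \<in> V_nat d n" using iu V_nat_iff[OF d] by blast
qed

definition kweight :: "nat \<Rightarrow> nat \<Rightarrow> real \<Rightarrow> nat \<Rightarrow> real" where
  "kweight d n t l = min (vweight d n l) (t\<^sup>2 * vweight d (Suc n) l)"

lemma kweight_nonneg: "d \<ge> 2 \<Longrightarrow> 0 \<le> kweight d n t l"
  using vweight_pos[of d n l] vweight_pos[of d "Suc n" l] by (simp add: kweight_def)

lemma summable_kweight:
  assumes d: "d \<ge> 2" and u: "u \<in> V_nat d n"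
  shows "summable (\<lambda>l. (dcoef d u l)\<^sup>2 * kweight d n t l)"
proof (rule summable_comparison_test')
  show "summable (\<lambda>l. (dcoef d u l)\<^sup>2 * vweight d n l)" using u V_nat_iff[OF d] by blast
  show "norm ((dcoef d u l)\<^sup>2 * kweight d n t l) \<le> (dcoef d u l)\<^sup>2 * vweight d n l" for l
    using kweight_nonneg[OF d, of n t l] by (simp add: mult_left_mono kweight_def)
qed

text \<open>Write \<open>A\<close> and \<open>B\<close> for the weights of orders \<open>n\<close> and \<open>n + 1\<close>. A decomposition \<open>u = v + w\<close> can be compared coefficientwise: \<open>v\<^sup>2 A + t\<^sup>2 w\<^sup>2 B\<close> is at least
  \<open>(v + w)\<^sup>2 min (A, t\<^sup>2 B) / 2\<close>.\<close>

lemma K_functional_lower: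
  assumes d: "d \<ge> 2" and t: "t > 0" and u: "u \<in> V_nat d n"
  shows "ennreal ((\<Sum>l. (dcoef d u l)\<^sup>2 * kweight d n t l) / 2) \<le> (K_functional d n t u)\<^sup>2"
proof -
  let ?c = "dcoef d"
  define Q where "Q = (\<Sum>l. (?c u l)\<^sup>2 * kweight d n t l)"
  have Q0: "Q \<ge> 0" unfolding Q_def using kweight_nonneg[OF d] summable_kweight[OF d u]
    by (intro suminf_nonneg) auto
  have "ennreal (sqrt (Q / 2)) \<le> K_functional d n t u"
    unfolding K_functional_def
  proof (rule INF_greatest, clarify)
    fix v w assume v: "v \<in> V_nat d n" and w: "w \<in> V_nat d (Suc n)" and uvw: "AE x in leb11. u x = v x + w x"
    let ?a = "V_nat_norm d n v" and ?b = "V_nat_norm d (Suc n) w"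
    have sv: "summable (\<lambda>l. (?c v l)\<^sup>2 * vweight d n l)" and sw: "summable (\<lambda>l. (?c w l)\<^sup>2 * vweight d (Suc n) l)"
      using v w V_nat_iff[OF d] by auto
    have "Q / 2 = (\<Sum>l. (?c u l)\<^sup>2 * kweight d n t l / 2)"
      unfolding Q_def using summable_kweight[OF d u] by (rule suminf_divide[symmetric])
    also have "\<dots> \<le> (\<Sum>l. (?c v l)\<^sup>2 * vweight d n l + t\<^sup>2 * ((?c w l)\<^sup>2 * vweight d (Suc n) l))"
    proof (rule suminf_le)
      show "summable (\<lambda>l. (?c u l)\<^sup>2 * kweight d n t l / 2)" by (intro summable_divide summable_kweight d u)
      show "summable (\<lambda>l. (?c v l)\<^sup>2 * vweight d n l + t\<^sup>2 * ((?c w l)\<^sup>2 * vweight d (Suc n) l))"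
        by (intro summable_add summable_mult sv sw)
      fix l
      have "(?c u l)\<^sup>2 \<le> 2 * (?c v l)\<^sup>2 + 2 * (?c w l)\<^sup>2"
        unfolding decomposition_coeffs(2)[OF d v w uvw]
        using sum_squares_bound[of "?c v l" "?c w l"] by (simp add: power2_sum)
      then have "(?c u l)\<^sup>2 * kweight d n t l \<le> (2 * (?c v l)\<^sup>2 + 2 * (?c w l)\<^sup>2) * kweight d n t l"
        using kweight_nonneg[OF d] by (intro mult_right_mono) auto
      moreover have "(?c v l)\<^sup>2 * kweight d n t l \<le> (?c v l)\<^sup>2 * vweight d n l"
        "(?c w l)\<^sup>2 * kweight d n t l \<le> (?c w l)\<^sup>2 * (t\<^sup>2 * vweight d (Suc n) l)"
        by (intro mult_left_mono; simp add: kweight_def)+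
      ultimately show "(?c u l)\<^sup>2 * kweight d n t l / 2 \<le> (?c v l)\<^sup>2 * vweight d n l + t\<^sup>2 * ((?c w l)\<^sup>2 * vweight d (Suc n) l)"
        by (simp add: algebra_simps)
    qed
    also have "\<dots> = ?a\<^sup>2 + t\<^sup>2 * ?b\<^sup>2"
      unfolding V_nat_norm_square(1)[OF d v] V_nat_norm_square(1)[OF d w]
      using suminf_add[OF sv summable_mult[OF sw, of "t\<^sup>2"]] suminf_mult[OF sw, of "t\<^sup>2"] by simp
    also have "\<dots> \<le> (?a + t * ?b)\<^sup>2"
      using V_nat_norm_square(2)[OF d v] V_nat_norm_square(2)[OF d w] t
      by (simp add: power2_sum power_mult_distrib)
    finally have "sqrt (Q / 2) \<le> ?a + t * ?b"
      using V_nat_norm_square(2)[OF d v] V_nat_norm_square(2)[OF d w] t by (intro real_le_lsqrt) auto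
    then show "ennreal (sqrt (Q / 2)) \<le> ennreal (?a + t * ?b)" by (rule ennreal_leI)
  qed
  then have "(ennreal (sqrt (Q / 2)))\<^sup>2 \<le> (K_functional d n t u)\<^sup>2" by (rule power_mono) simp
  then show ?thesis using Q0 by (simp add: ennreal_power Q_def[symmetric])
qed

text \<open>The splitting that assigns a coefficient to \<open>w\<close> exactly when \<open>t\<^sup>2 B \<le> A\<close> realizes the
  K-functional up to a factor.\<close>

lemma K_functional_upper:
  assumes d: "d \<ge> 2" and t: "t > 0" and u: "u \<in> V_nat d n"
  shows "(K_functional d n t u)\<^sup>2 \<le> ennreal (2 * (\<Sum>l. (dcoef d u l)\<^sup>2 * kweight d n t l))"
proof -
  let ?c = "dcoef d"
  let ?A = "vweight d n" and ?B = "vweight d (Suc n)"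
  define b where "b = (\<lambda>l. if t\<^sup>2 * ?B l \<le> ?A l then ?c u l else 0)"
  have su: "summable (\<lambda>l. (?c u l)\<^sup>2 * ?A l)" and iu: "integrable (gmeas (dalpha d) 0) u" using u V_nat_iff[OF d] by auto
  have AB: "?A l > 0" "?B l > 0" for l using vweight_pos[OF d] by auto
  have "summable (\<lambda>l. (b l)\<^sup>2 * ?B l)"
  proof (rule summable_comparison_test'[OF summable_mult[OF su, of "1 / t\<^sup>2"]])
    fix l
    have "t\<^sup>2 * ((b l)\<^sup>2 * ?B l) \<le> (?c u l)\<^sup>2 * ?A l"
      unfolding b_def using AB[of l] mult_left_mono[of "t\<^sup>2 * ?B l" "?A l" "(?c u l)\<^sup>2"]
      by (auto simp: mult_ac intro: less_imp_le)
    then show "norm ((b l)\<^sup>2 * ?B l) \<le> 1 / t\<^sup>2 * ((?c u l)\<^sup>2 * ?A l)"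
      using t AB[of l] by (simp add: field_simps)
  qed
  from ex_V_nat_of_coeffs[OF d this] obtain w where w: "w \<in> V_nat d (Suc n)" and cw: "\<And>l. ?c w l = b l"
    by blast
  have iw: "integrable (gmeas (dalpha d) 0) w" using w V_nat_iff[OF d] by auto
  define v where "v = (\<lambda>x. 1 * u x + (-1) * w x)"
  have cv: "?c v l = ?c u l - b l" for l
    unfolding v_def gcoef_lincomb[OF iu iw] by (simp add: cw)
  have v: "v \<in> V_nat d n"
    unfolding V_nat_iff[OF d]
  proof
    show "integrable (gmeas (dalpha d) 0) v" unfolding v_def using iu iw by simp
    show "summable (\<lambda>l. (?c v l)\<^sup>2 * ?A l)"
      by (rule summable_comparison_test'[OF su]) (use AB in \<open>auto simp: cv b_def less_imp_le\<close>)
  qed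
  let ?a = "V_nat_norm d n v" and ?bb = "V_nat_norm d (Suc n) w"
  have sv: "summable (\<lambda>l. (?c v l)\<^sup>2 * ?A l)" and sw: "summable (\<lambda>l. (?c w l)\<^sup>2 * ?B l)"
    using v w V_nat_iff[OF d] by auto
  have "?a\<^sup>2 + t\<^sup>2 * ?bb\<^sup>2 = (\<Sum>l. (?c v l)\<^sup>2 * ?A l + t\<^sup>2 * ((?c w l)\<^sup>2 * ?B l))"
    unfolding V_nat_norm_square(1)[OF d v] V_nat_norm_square(1)[OF d w]
    using suminf_add[OF sv summable_mult[OF sw, of "t\<^sup>2"]] suminf_mult[OF sw, of "t\<^sup>2"] by simp
  also have "\<dots> = (\<Sum>l. (?c u l)\<^sup>2 * kweight d n t l)"
    by (intro suminf_cong) (simp add: cv cw b_def kweight_def min_def)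
  finally have e: "?a\<^sup>2 + t\<^sup>2 * ?bb\<^sup>2 = (\<Sum>l. (?c u l)\<^sup>2 * kweight d n t l)" .
  have "(?a + t * ?bb)\<^sup>2 \<le> 2 * (?a\<^sup>2 + t\<^sup>2 * ?bb\<^sup>2)"
    using sum_squares_bound[of ?a "t * ?bb"] by (simp add: power2_sum power_mult_distrib)
  then have le: "(?a + t * ?bb)\<^sup>2 \<le> 2 * (\<Sum>l. (?c u l)\<^sup>2 * kweight d n t l)" unfolding e .
  have "K_functional d n t u \<le> ennreal (?a + t * ?bb)"
    unfolding K_functional_def
    by (rule INF_lower2[of "(v, w)"]) (use v w in \<open>auto simp: v_def\<close>)
  then have "(K_functional d n t u)\<^sup>2 \<le> (ennreal (?a + t * ?bb))\<^sup>2" by (rule power_mono) simp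
  also have "\<dots> = ennreal ((?a + t * ?bb)\<^sup>2)"
    using V_nat_norm_square(2)[OF d v] V_nat_norm_square(2)[OF d w] t
    by (intro ennreal_power) simp
  also have "\<dots> \<le> ennreal (2 * (\<Sum>l. (?c u l)\<^sup>2 * kweight d n t l))" using le by (rule ennreal_leI)
  finally show ?thesis .
qed

abbreviation iconst :: "real \<Rightarrow> real" where
  "iconst \<theta> \<equiv> 1 / (2 - 2 * \<theta>) + 1 / (2 * \<theta>)"

text \<open>The minimum is \<open>t\<^sup>2 B\<close> up to \<open>T = \<surd>(A / B)\<close> and \<open>A\<close> beyond. The two pieces are integrals of powers, and each
is a multiple of \<open>A\<^bsup>1-\<theta>\<^esup> B\<^bsup>\<theta>\<^esup>\<close>.\<close>

lemma interpolation_integral: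
  fixes \<theta> A B :: real
  assumes \<theta>: "0 < \<theta>" "\<theta> < 1" and AB: "A > 0" "B > 0"
  shows "(\<integral>\<^sup>+ t\<in>{0<..}. ennreal (t powr (- 2 * \<theta>)) * ennreal (min A (t\<^sup>2 * B)) * ennreal (1 / t) \<partial>lborel) =
    ennreal (iconst \<theta> * (A powr (1 - \<theta>) * B powr \<theta>))"
proof -
  define T where "T = sqrt (A / B)"
  have T: "T > 0" "T\<^sup>2 = A / B" using AB by (simp_all add: T_def)
  have Tp: "T powr s = (A / B) powr (s / 2)" for s
    unfolding T_def using AB by (simp add: powr_half_sqrt[symmetric] powr_powr mult.commute)
  have le: "t\<^sup>2 * B \<le> A \<longleftrightarrow> t \<le> T" if "t > 0" for t
  proof -
    have "t\<^sup>2 * B \<le> A \<longleftrightarrow> t\<^sup>2 \<le> T\<^sup>2" unfolding T(2) using AB by (simp add: field_simps)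
    also have "\<dots> \<longleftrightarrow> t \<le> T" using that T(1) by (intro power_mono_iff) auto
    finally show ?thesis .
  qed
  have "(\<integral>\<^sup>+ t\<in>{0<..}. ennreal (t powr (- 2 * \<theta>)) * ennreal (min A (t\<^sup>2 * B)) * ennreal (1 / t) \<partial>lborel)
    = (\<integral>\<^sup>+ t. ennreal (B * t powr (1 - 2 * \<theta>)) * indicator {0..T} t + ennreal (A * t powr (- 2 * \<theta> - 1)) * indicator {T..} t \<partial>lborel)"
  proof (rule nn_integral_cong_AE)
    have "AE t in lborel. t \<noteq> T" "AE t in lborel. t \<noteq> (0::real)" by (rule AE_lborel_singleton)+
    then show "AE t in lborel. ennreal (t powr (- 2 * \<theta>)) * ennreal (min A (t\<^sup>2 * B)) * ennreal (1 / t) * indicator {0<..} t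
      = ennreal (B * t powr (1 - 2 * \<theta>)) * indicator {0..T} t + ennreal (A * t powr (- 2 * \<theta> - 1)) * indicator {T..} t"
    proof eventually_elim
      case (elim t)
      consider "t < 0" | "0 < t" "t < T" | "T < t" using elim by linarith
      then show ?case
      proof cases
        case 1
        then show ?thesis using T(1) by simp
      next
        case 2
        have "t powr (1 - 2 * \<theta>) = t powr (2 + - 2 * \<theta> + -1)" by (simp add: algebra_simps)
        also have "\<dots> = t\<^sup>2 * t powr (- 2 * \<theta>) * (1 / t)"
          using 2 unfolding powr_add by (simp add: powr_minus divide_inverse powr_numeral)
        finally show ?thesis using 2 le[of t] AB
          by (simp add: min_def ennreal_mult[symmetric] mult_ac)
      next
        case 3
        have t: "t > 0" using 3 T(1) by simp
        have "t powr (- 2 * \<theta> - 1) = t powr (- 2 * \<theta> + -1)" by simp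
        also have "\<dots> = t powr (- 2 * \<theta>) * (1 / t)"
          using t unfolding powr_add by (simp add: powr_minus divide_inverse)
        finally show ?thesis using 3 t le[OF t] AB
          by (simp add: min_def ennreal_mult[symmetric] mult_ac)
      qed
    qed
  qed
  also have "\<dots> = (\<integral>\<^sup>+ t. ennreal (B * t powr (1 - 2 * \<theta>)) * indicator {0..T} t \<partial>lborel)
      + (\<integral>\<^sup>+ t. ennreal (A * t powr (- 2 * \<theta> - 1)) * indicator {T..} t \<partial>lborel)"
    by (intro nn_integral_add) auto
  also have "(\<integral>\<^sup>+ t. ennreal (B * t powr (1 - 2 * \<theta>)) * indicator {0..T} t \<partial>lborel)
      = ennreal (B * (T powr (1 - 2 * \<theta> + 1) / (1 - 2 * \<theta> + 1)))"
    by (rule nn_integral_has_integral_lebesgue'[OF _ has_integral_mult_right[OF has_integral_powr_from_0]])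
       (use AB T \<theta> in auto)
  also have "(\<integral>\<^sup>+ t. ennreal (A * t powr (- 2 * \<theta> - 1)) * indicator {T..} t \<partial>lborel)
      = ennreal (A * (- (T powr (- 2 * \<theta> - 1 + 1)) / (- 2 * \<theta> - 1 + 1)))"
    by (rule nn_integral_has_integral_lebesgue'[OF _ has_integral_mult_right[OF has_integral_powr_to_inf]])
       (use AB T \<theta> in auto)
  also have "B * (T powr (1 - 2 * \<theta> + 1) / (1 - 2 * \<theta> + 1)) = 1 / (2 - 2 * \<theta>) * (A powr (1 - \<theta>) * B powr \<theta>)"
  proof -
    have "(1 - 2 * \<theta> + 1) / 2 = 1 - \<theta>" by simp
    then have "T powr (1 - 2 * \<theta> + 1) = (A / B) powr (1 - \<theta>)" unfolding Tp by (simp only:)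
    then have "B * T powr (1 - 2 * \<theta> + 1) = A powr (1 - \<theta>) * (B / B powr (1 - \<theta>))"
      using AB by (simp only:) (simp add: powr_divide)
    also have "B / B powr (1 - \<theta>) = B powr \<theta>"
      using AB powr_diff[of B 1 "1 - \<theta>"] by simp
    finally show ?thesis by simp
  qed
  also have "A * (- (T powr (- 2 * \<theta> - 1 + 1)) / (- 2 * \<theta> - 1 + 1)) = 1 / (2 * \<theta>) * (A powr (1 - \<theta>) * B powr \<theta>)"
  proof -
    have "(- 2 * \<theta> - 1 + 1) / 2 = - \<theta>" by simp
    then have "A * T powr (- 2 * \<theta> - 1 + 1) = (A * A powr (- \<theta>)) / B powr (- \<theta>)"
      unfolding Tp using AB by (simp add: powr_divide)
    also have "A * A powr (- \<theta>) = A powr (1 - \<theta>)"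
      using AB powr_add[of A 1 "- \<theta>"] by simp
    also have "A powr (1 - \<theta>) / B powr (- \<theta>) = A powr (1 - \<theta>) * B powr \<theta>"
      by (simp add: powr_minus divide_inverse)
    finally show ?thesis by (simp add: field_simps)
  qed
  finally show ?thesis
    using \<theta> AB by (subst (asm) ennreal_plus[symmetric]) (auto simp: distrib_right)
qed

definition iweight :: "nat \<Rightarrow> nat \<Rightarrow> real \<Rightarrow> nat \<Rightarrow> real" where
  "iweight d n \<theta> l = vweight d n l powr (1 - \<theta>) * vweight d (Suc n) l powr \<theta>"

lemma iweight_pos: "d \<ge> 2 \<Longrightarrow> 0 < iweight d n \<theta> l"
  using vweight_pos[of d n l] vweight_pos[of d "Suc n" l] by (simp add: iweight_def)

lemma integral_kweight_sum:
  assumes d: "d \<ge> 2" and \<theta>: "0 < \<theta>" "\<theta> < 1" and u: "u \<in> V_nat d n" and r: "r > 0"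
  shows "(\<integral>\<^sup>+ t\<in>{0<..}. ennreal (t powr (- 2 * \<theta>)) * ennreal (r * (\<Sum>l. (dcoef d u l)\<^sup>2 * kweight d n t l)) * ennreal (1 / t) \<partial>lborel) =
    ennreal (r * iconst \<theta>) * wsum d (iweight d n \<theta>) u"
proof -
  let ?c = "dcoef d u"
  let ?\<kappa> = "iconst \<theta>"
  have \<kappa>: "?\<kappa> > 0" using \<theta> by (intro add_pos_pos) auto
  have "(\<integral>\<^sup>+ t\<in>{0<..}. ennreal (t powr (- 2 * \<theta>)) * ennreal (r * (\<Sum>l. (?c l)\<^sup>2 * kweight d n t l)) * ennreal (1 / t) \<partial>lborel)
    = (\<integral>\<^sup>+ t. (\<Sum>l. ennreal (r * (?c l)\<^sup>2) * (ennreal (t powr (- 2 * \<theta>)) * ennreal (kweight d n t l) * ennreal (1 / t) * indicator {0<..} t)) \<partial>lborel)"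
  proof (rule nn_integral_cong)
    fix t
    have "ennreal (r * (\<Sum>l. (?c l)\<^sup>2 * kweight d n t l)) = (\<Sum>l. ennreal (r * ((?c l)\<^sup>2 * kweight d n t l)))"
      using r kweight_nonneg[OF d, of n t] summable_kweight[OF d u, of t]
      by (subst suminf_mult[symmetric]) (auto intro!: suminf_ennreal2[symmetric] summable_mult)
    also have "\<dots> = (\<Sum>l. ennreal (r * (?c l)\<^sup>2) * ennreal (kweight d n t l))"
      using r kweight_nonneg[OF d, of n t] by (simp add: ennreal_mult[symmetric] mult.assoc)
    finally have e: "ennreal (r * (\<Sum>l. (?c l)\<^sup>2 * kweight d n t l)) = (\<Sum>l. ennreal (r * (?c l)\<^sup>2) * ennreal (kweight d n t l))" .
    show "ennreal (t powr (- 2 * \<theta>)) * ennreal (r * (\<Sum>l. (?c l)\<^sup>2 * kweight d n t l)) * ennreal (1 / t) * indicator {0<..} t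
      = (\<Sum>l. ennreal (r * (?c l)\<^sup>2) * (ennreal (t powr (- 2 * \<theta>)) * ennreal (kweight d n t l) * ennreal (1 / t) * indicator {0<..} t))"
      unfolding e by (simp add: mult_ac flip: ennreal_suminf_cmult ennreal_suminf_multc)
  qed
  also have "\<dots> = (\<Sum>l. \<integral>\<^sup>+ t. ennreal (r * (?c l)\<^sup>2) * (ennreal (t powr (- 2 * \<theta>)) * ennreal (kweight d n t l) * ennreal (1 / t) * indicator {0<..} t) \<partial>lborel)"
    unfolding kweight_def by (intro nn_integral_suminf) measurable
  also have "\<dots> = (\<Sum>l. ennreal (r * (?c l)\<^sup>2) * ennreal (?\<kappa> * iweight d n \<theta> l))"
  proof (rule suminf_cong)
    fix l
    have "(\<integral>\<^sup>+ t. ennreal (r * (?c l)\<^sup>2) * (ennreal (t powr (- 2 * \<theta>)) * ennreal (kweight d n t l) * ennreal (1 / t) * indicator {0<..} t) \<partial>lborel)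
      = ennreal (r * (?c l)\<^sup>2) * (\<integral>\<^sup>+ t. ennreal (t powr (- 2 * \<theta>)) * ennreal (kweight d n t l) * ennreal (1 / t) * indicator {0<..} t \<partial>lborel)"
      unfolding kweight_def by (rule nn_integral_cmult) measurable
    also have "(\<integral>\<^sup>+ t. ennreal (t powr (- 2 * \<theta>)) * ennreal (kweight d n t l) * ennreal (1 / t) * indicator {0<..} t \<partial>lborel) = ennreal (?\<kappa> * iweight d n \<theta> l)"
      unfolding kweight_def iweight_def by (rule interpolation_integral[OF \<theta> vweight_pos[OF d] vweight_pos[OF d]])
    finally show "(\<integral>\<^sup>+ t. ennreal (r * (?c l)\<^sup>2) * (ennreal (t powr (- 2 * \<theta>)) * ennreal (kweight d n t l) * ennreal (1 / t) * indicator {0<..} t) \<partial>lborel)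
      = ennreal (r * (?c l)\<^sup>2) * ennreal (?\<kappa> * iweight d n \<theta> l)" .
  qed
  also have "\<dots> = (\<Sum>l. ennreal (r * ?\<kappa>) * ennreal ((?c l)\<^sup>2 * iweight d n \<theta> l))"
    using r \<kappa> iweight_pos[OF d, of n \<theta>]
    by (intro suminf_cong) (simp add: ennreal_mult[symmetric] less_imp_le mult_ac)
  also have "\<dots> = ennreal (r * ?\<kappa>) * (\<Sum>l. ennreal ((?c l)\<^sup>2 * iweight d n \<theta> l))"
    by (rule ennreal_suminf_cmult)
  finally show ?thesis .
qed

lemma V_interp_norm2_bounds:
  assumes d: "d \<ge> 2" and \<theta>: "0 < \<theta>" "\<theta> < 1" and u: "u \<in> V_nat d n"
  shows "ennreal (1 / 2 * iconst \<theta>) * wsum d (iweight d n \<theta>) u \<le> V_interp_norm2 d n \<theta> u"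
    and "V_interp_norm2 d n \<theta> u \<le> ennreal (2 * iconst \<theta>) * wsum d (iweight d n \<theta>) u"
proof -
  show "ennreal (1 / 2 * iconst \<theta>) * wsum d (iweight d n \<theta>) u \<le> V_interp_norm2 d n \<theta> u"
    unfolding integral_kweight_sum[OF d \<theta> u half_gt_zero[OF zero_less_one], symmetric] V_interp_norm2_def
  proof (rule nn_integral_mono)
    fix t
    show "ennreal (t powr (- 2 * \<theta>)) * ennreal (1 / 2 * (\<Sum>l. (dcoef d u l)\<^sup>2 * kweight d n t l)) * ennreal (1 / t) * indicator {0<..} t
      \<le> ennreal (t powr (- 2 * \<theta>)) * (K_functional d n t u)\<^sup>2 * ennreal (1 / t) * indicator {0<..} t"
      using K_functional_lower[OF d _ u, of t]
      by (cases "t > 0") (auto intro!: mult_right_mono mult_left_mono)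
  qed
  show "V_interp_norm2 d n \<theta> u \<le> ennreal (2 * iconst \<theta>) * wsum d (iweight d n \<theta>) u"
    unfolding integral_kweight_sum[OF d \<theta> u zero_less_numeral, symmetric] V_interp_norm2_def
  proof (rule nn_integral_mono)
    fix t
    show "ennreal (t powr (- 2 * \<theta>)) * (K_functional d n t u)\<^sup>2 * ennreal (1 / t) * indicator {0<..} t
      \<le> ennreal (t powr (- 2 * \<theta>)) * ennreal (2 * (\<Sum>l. (dcoef d u l)\<^sup>2 * kweight d n t l)) * ennreal (1 / t) * indicator {0<..} t"
      using K_functional_upper[OF d _ u, of t]
      by (cases "t > 0") (auto intro!: mult_right_mono mult_left_mono)
  qed
qed

text \<open>For any other function there is no decomposition, so the K-functional and its integral are infinite.\<close>

lemma V_nat_if_V_interp_norm2_finite: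
  assumes d: "d \<ge> 2" and fin: "V_interp_norm2 d n \<theta> u < \<infinity>"
  shows "u \<in> V_nat d n"
proof (rule ccontr)
  assume nu: "u \<notin> V_nat d n"
  have "K_functional d n t u = \<infinity>" for t
  proof -
    have "{(v, w). v \<in> V_nat d n \<and> w \<in> V_nat d (Suc n) \<and> (AE \<mu> in leb11. u \<mu> = v \<mu> + w \<mu>)} = {}"
      using decomposition_coeffs(1)[OF d] nu by blast
    then show ?thesis unfolding K_functional_def by (simp only: image_empty Inf_empty) (simp add: top_ennreal.abs_eq)
  qed
  then have "V_interp_norm2 d n \<theta> u = integral\<^sup>N lborel (\<lambda>t::real. \<infinity> * indicator {0<..} t)"
    unfolding V_interp_norm2_def
    by (intro nn_integral_cong) (auto simp: indicator_def ennreal_mult_top ennreal_top_mult)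
  also have "\<dots> = \<infinity> * emeasure lborel {0::real<..}" by (rule nn_integral_cmult_indicator) simp
  also have "\<dots> = \<infinity>"
  proof -
    have "emeasure lborel {0<..<1::real} \<le> emeasure lborel {0::real<..}" by (intro emeasure_mono) auto
    then have "emeasure lborel {0::real<..} \<noteq> 0" by auto
    then show ?thesis by (simp add: ennreal_top_mult)
  qed
  finally show False using fin by simp
qed

text \<open>Hence the space of order \<open>n + \<theta>\<close> is contained in that of order \<open>n\<close>, on which the K-functional has been
estimated.\<close>

lemma vweight_le_iweight:
  assumes d: "d \<ge> 2" and \<theta>: "0 < \<theta>" "\<theta> < 1"
  shows "vweight d n l \<le> iweight d n \<theta> l"
proof -
  have "vweight d n l = vweight d n l powr (1 - \<theta>) * vweight d n l powr \<theta>"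
    using vweight_pos[OF d, of n l] by (simp add: powr_add[symmetric])
  also have "\<dots> \<le> iweight d n \<theta> l"
    unfolding iweight_def using vweight_Suc_mono[OF d, of n l] vweight_pos[OF d, of n l] \<theta>
    by (intro mult_left_mono powr_mono2) auto
  finally show ?thesis .
qed

lemma iweight_bounds:
  assumes d: "d \<ge> 2" and \<theta>: "0 < \<theta>" "\<theta> < 1"
  shows "\<exists>c>0. \<exists>C>0. \<forall>l\<ge>1. c * real l powr (real d - 2 + 2 * (real n + \<theta>)) \<le> iweight d n \<theta> l \<and>
    iweight d n \<theta> l \<le> C * real l powr (real d - 2 + 2 * (real n + \<theta>))"
proof -
  obtain c1 C1 where 1: "c1 > 0" "C1 > 0" "\<And>l. l \<ge> 1 \<Longrightarrow> c1 * real l powr (real d - 2 + 2 * real n) \<le> vweight d n l \<and> vweight d n l \<le> C1 * real l powr (real d - 2 + 2 * real n)"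
    using vweight_bounds[OF d] by blast
  obtain c2 C2 where 2: "c2 > 0" "C2 > 0" "\<And>l. l \<ge> 1 \<Longrightarrow> c2 * real l powr (real d - 2 + 2 * real (Suc n)) \<le> vweight d (Suc n) l \<and> vweight d (Suc n) l \<le> C2 * real l powr (real d - 2 + 2 * real (Suc n))"
    using vweight_bounds[OF d] by blast
  have "c1 powr (1 - \<theta>) * c2 powr \<theta> * real l powr (real d - 2 + 2 * (real n + \<theta>)) \<le> iweight d n \<theta> l \<and>
      iweight d n \<theta> l \<le> C1 powr (1 - \<theta>) * C2 powr \<theta> * real l powr (real d - 2 + 2 * (real n + \<theta>))" if l: "l \<ge> 1" for l
  proof -
    let ?p = "real l powr (real d - 2 + 2 * real n)" and ?q = "real l powr (real d - 2 + 2 * real (Suc n))"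
    have comb: "(k1 * ?p) powr (1 - \<theta>) * (k2 * ?q) powr \<theta> = k1 powr (1 - \<theta>) * k2 powr \<theta> * real l powr (real d - 2 + 2 * (real n + \<theta>))"
      if "k1 > 0" "k2 > 0" for k1 k2
    proof -
      have "(real d - 2 + 2 * real n) * (1 - \<theta>) + (real d - 2 + 2 * real (Suc n)) * \<theta> = real d - 2 + 2 * (real n + \<theta>)"
        by (simp add: algebra_simps)
      then have "?p powr (1 - \<theta>) * ?q powr \<theta> = real l powr (real d - 2 + 2 * (real n + \<theta>))"
        unfolding powr_powr powr_add[symmetric] by simp
      then show ?thesis using that by (simp add: powr_mult mult_ac)
    qed
    have "(c1 * ?p) powr (1 - \<theta>) * (c2 * ?q) powr \<theta> \<le> iweight d n \<theta> l"
      unfolding iweight_def using 1 2 l \<theta> by (intro mult_mono powr_mono2) auto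
    moreover have "iweight d n \<theta> l \<le> (C1 * ?p) powr (1 - \<theta>) * (C2 * ?q) powr \<theta>"
      unfolding iweight_def using 1 2 l \<theta> vweight_pos[OF d]
      by (intro mult_mono powr_mono2) (auto intro: less_imp_le)
    ultimately show ?thesis unfolding comb[OF 1(1) 2(1)] comb[OF 1(2) 2(2)] by blast
  qed
  then show ?thesis using 1(1,2) 2(1,2)
    by (intro exI[of _ "c1 powr (1 - \<theta>) * c2 powr \<theta>"] conjI exI[of _ "C1 powr (1 - \<theta>) * C2 powr \<theta>"]) auto
qed

section \<open>Spaces of arbitrary order and covariance kernels\<close>

lemma V_space_of_nat [simp]: "V_space d (real n) = V_nat d n"
  by (simp add: V_space_def)

lemma summable_iff_suminf_ennreal_finite:
  assumes "\<And>l. 0 \<le> f l"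
  shows "summable f \<longleftrightarrow> (\<Sum>l. ennreal (f l)) < \<infinity>"
proof
  assume "summable f"
  then show "(\<Sum>l. ennreal (f l)) < \<infinity>" using assms by (simp add: suminf_ennreal2)
next
  assume "(\<Sum>l. ennreal (f l)) < \<infinity>"
  then show "summable f" using assms by (intro summable_suminf_not_top) auto
qed

text \<open>The weight \<open>w\<close> is \<open>vweight\<close> for an integer order, where the norms are even equal, and \<open>iweight\<close> otherwise.\<close>

lemma V_space_eq_weighted_l2:
  assumes d: "d \<ge> 2" and \<eta>: "\<eta> \<ge> 0"
  obtains w k K where "k > 0" "K > 0" and "\<forall>l. 0 < w l"
    and "\<exists>c>0. \<exists>C>0. \<forall>l\<ge>1. c * real l powr (real d - 2 + 2 * \<eta>) \<le> w l \<and>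
      w l \<le> C * real l powr (real d - 2 + 2 * \<eta>)"
    and "\<forall>u. u \<in> V_space d \<eta> \<longleftrightarrow> integrable (gmeas (dalpha d) 0) u \<and>
      summable (\<lambda>l. (dcoef d u l)\<^sup>2 * w l)"
    and "\<forall>u\<in>V_space d \<eta>. ennreal k * wsum d w u \<le> V_norm2 d \<eta> u \<and>
      V_norm2 d \<eta> u \<le> ennreal K * wsum d w u"
proof (cases "\<eta> \<in> \<nat>")
  case True
  then obtain n where n: "\<eta> = real n" by (auto elim: Nats_cases)
  have norm: "V_norm2 d \<eta> u = wsum d (vweight d n) u" if u: "u \<in> V_nat d n" for u
  proof -
    have "V_norm2 d \<eta> u = V_nat_norm2 d n u" by (simp add: V_norm2_def n)
    also have "\<dots> = ennreal (\<Sum>l. (dcoef d u l)\<^sup>2 * vweight d n l)" by (rule V_nat_norm2_eq[OF d u])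
    also have "\<dots> = wsum d (vweight d n) u"
      using u vweight_pos[OF d, of n] by (intro suminf_ennreal2[symmetric]) (simp_all add: V_nat_iff[OF d] less_imp_le)
    finally show ?thesis .
  qed
  show thesis
  proof (rule that[of 1 1 "vweight d n"])
    show "\<exists>c>0. \<exists>C>0. \<forall>l\<ge>1. c * real l powr (real d - 2 + 2 * \<eta>) \<le> vweight d n l \<and>
        vweight d n l \<le> C * real l powr (real d - 2 + 2 * \<eta>)"
      unfolding n by (rule vweight_bounds[OF d])
    show "\<forall>u\<in>V_space d \<eta>. ennreal 1 * wsum d (vweight d n) u \<le> V_norm2 d \<eta> u \<and>
       V_norm2 d \<eta> u \<le> ennreal 1 * wsum d (vweight d n) u"
      using norm by (simp add: n)
  qed (simp_all add: n V_nat_iff[OF d] vweight_pos[OF d])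
next
  case False
  define n where "n = nat \<lfloor>\<eta>\<rfloor>"
  define \<theta> where "\<theta> = \<eta> - real n"
  have n: "real n = of_int \<lfloor>\<eta>\<rfloor>" using \<eta> by (simp add: n_def)
  have "\<eta> \<noteq> real n" using False by auto
  then have \<theta>: "0 < \<theta>" "\<theta> < 1" unfolding \<theta>_def n by linarith+
  have \<eta>n: "\<eta> = real n + \<theta>" by (simp add: \<theta>_def)
  have norm: "V_norm2 d \<eta> u = V_interp_norm2 d n \<theta> u" for u
    using False by (simp add: V_norm2_def n_def \<theta>_def)
  let ?\<kappa> = "iconst \<theta>"
  have \<kappa>: "?\<kappa> > 0" using \<theta> by (intro add_pos_pos) auto
  have ip: "0 \<le> (dcoef d u l)\<^sup>2 * iweight d n \<theta> l" for u l
    using iweight_pos[OF d, of n \<theta> l] by simp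
  have sf: "summable (\<lambda>l. (dcoef d u l)\<^sup>2 * iweight d n \<theta> l) \<longleftrightarrow>
      wsum d (iweight d n \<theta>) u < \<infinity>" for u
    by (rule summable_iff_suminf_ennreal_finite[OF ip])
  have imp: "u \<in> V_nat d n" if "u \<in> V_space d \<eta>" for u
    using that False V_nat_if_V_interp_norm2_finite[OF d, of n \<theta> u] by (simp add: V_space_def norm)
  have iff: "u \<in> V_space d \<eta> \<longleftrightarrow> integrable (gmeas (dalpha d) 0) u \<and> summable (\<lambda>l. (dcoef d u l)\<^sup>2 * iweight d n \<theta> l)" for u
  proof
    assume u: "u \<in> V_space d \<eta>"
    have "ennreal (1 / 2 * ?\<kappa>) * wsum d (iweight d n \<theta>) u \<le> V_norm2 d \<eta> u"
      unfolding norm by (rule V_interp_norm2_bounds(1)[OF d \<theta> imp[OF u]])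
    also have "\<dots> < \<infinity>" using u False by (simp add: V_space_def)
    finally have "wsum d (iweight d n \<theta>) u < \<infinity>"
      using \<kappa> by (auto simp: ennreal_mult_less_top)
    then show "integrable (gmeas (dalpha d) 0) u \<and> summable (\<lambda>l. (dcoef d u l)\<^sup>2 * iweight d n \<theta> l)"
      using imp[OF u] unfolding sf by (simp add: V_nat_iff[OF d])
  next
    assume *: "integrable (gmeas (dalpha d) 0) u \<and> summable (\<lambda>l. (dcoef d u l)\<^sup>2 * iweight d n \<theta> l)"
    have "summable (\<lambda>l. (dcoef d u l)\<^sup>2 * vweight d n l)"
    proof (rule summable_comparison_test')
      show "summable (\<lambda>l. (dcoef d u l)\<^sup>2 * iweight d n \<theta> l)" using * by blast
      show "norm ((dcoef d u l)\<^sup>2 * vweight d n l) \<le> (dcoef d u l)\<^sup>2 * iweight d n \<theta> l" for l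
        using vweight_le_iweight[OF d \<theta>, of n l] vweight_pos[OF d, of n l] by (simp add: mult_left_mono)
    qed
    then have u: "u \<in> V_nat d n" using * by (simp add: V_nat_iff[OF d])
    have "wsum d (iweight d n \<theta>) u < \<infinity>"
      using * unfolding sf by blast
    then have "ennreal (2 * ?\<kappa>) * wsum d (iweight d n \<theta>) u < \<infinity>"
      by (simp add: ennreal_mult_less_top)
    then have "V_norm2 d \<eta> u < \<infinity>"
      unfolding norm using V_interp_norm2_bounds(2)[OF d \<theta> u] by (rule le_less_trans[rotated])
    then show "u \<in> V_space d \<eta>" using False by (simp add: V_space_def)
  qed
  show thesis
  proof (rule that[of "1 / 2 * ?\<kappa>" "2 * ?\<kappa>" "iweight d n \<theta>"])
    show "\<exists>c>0. \<exists>C>0. \<forall>l\<ge>1. c * real l powr (real d - 2 + 2 * \<eta>) \<le> iweight d n \<theta> l \<and>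
        iweight d n \<theta> l \<le> C * real l powr (real d - 2 + 2 * \<eta>)"
      unfolding \<eta>n by (rule iweight_bounds[OF d \<theta>])
    show "\<forall>u\<in>V_space d \<eta>. ennreal (1 / 2 * ?\<kappa>) * wsum d (iweight d n \<theta>) u \<le> V_norm2 d \<eta> u \<and>
       V_norm2 d \<eta> u \<le> ennreal (2 * ?\<kappa>) * wsum d (iweight d n \<theta>) u"
      unfolding norm by (intro ballI conjI V_interp_norm2_bounds[OF d \<theta> imp])
  qed (use \<kappa> iweight_pos[OF d] iff in simp_all)
qed

lemma weight_bounds_all_l:
  fixes w :: "nat \<Rightarrow> real"
  assumes s: "s \<ge> 0" and w: "\<And>l. 0 < w l" and c: "c > 0" "C > 0"
    and b: "\<And>l. l \<ge> 1 \<Longrightarrow> c * real l powr s \<le> w l \<and> w l \<le> C * real l powr s"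
  shows "\<exists>c>0. \<exists>C>0. \<forall>l. c * w l \<le> 1 + real l powr s \<and> 1 + real l powr s \<le> C * w l"
proof (intro exI conjI allI)
  show "0 < min (1 / C) (1 / w 0)" "0 < max (2 / c) (1 / w 0)" using c w[of 0] by (auto simp: less_max_iff_disj)
  fix l
  have "min (1 / C) (1 / w 0) * w l \<le> 1 + real l powr s \<and> 1 + real l powr s \<le> max (2 / c) (1 / w 0) * w l"
  proof (cases "l = 0")
    case True
    have "min (1 / C) (1 / w 0) * w 0 \<le> 1 / w 0 * w 0" "1 / w 0 * w 0 \<le> max (2 / c) (1 / w 0) * w 0"
      using w[of 0] by (intro mult_right_mono; simp)+
    then show ?thesis using True w[of 0] by simp
  next
    case False
    then have l: "l \<ge> 1" by simp
    have p: "1 \<le> real l powr s" using l s by (simp add: ge_one_powr_ge_zero)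
    have "min (1 / C) (1 / w 0) * w l \<le> 1 / C * w l" using w[of l] by (intro mult_right_mono) auto
    also have "\<dots> \<le> real l powr s" using b[OF l] c by (simp add: field_simps)
    finally have 1: "min (1 / C) (1 / w 0) * w l \<le> 1 + real l powr s" by simp
    have "1 + real l powr s \<le> 2 * real l powr s" using p by simp
    also have "\<dots> \<le> 2 / c * w l" using b[OF l] c by (simp add: field_simps)
    also have "\<dots> \<le> max (2 / c) (1 / w 0) * w l" using w[of l] by (intro mult_right_mono) auto
    finally show ?thesis using 1 by simp
  qed
  then show "min (1 / C) (1 / w 0) * w l \<le> 1 + real l powr s" "1 + real l powr s \<le> max (2 / c) (1 / w 0) * w l"
    by auto
qed

lemma V_space_equivalent_norm:
  assumes d: "d \<ge> 2" and \<eta>: "\<eta> \<ge> 0"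
  shows "\<And>u. u \<in> V_space d \<eta> \<longleftrightarrow> integrable (gmeas (dalpha d) 0) u \<and>
      summable (\<lambda>l. (dcoef d u l)\<^sup>2 * (1 + real l powr (real d - 2 + 2 * \<eta>)))"
    and "\<exists>c>0. \<exists>C>0. \<forall>u\<in>V_space d \<eta>.
      ennreal c * (\<Sum>l. ennreal ((dcoef d u l)\<^sup>2 * (1 + real l powr (real d - 2 + 2 * \<eta>)))) \<le> V_norm2 d \<eta> u \<and>
      V_norm2 d \<eta> u \<le> ennreal C * (\<Sum>l. ennreal ((dcoef d u l)\<^sup>2 * (1 + real l powr (real d - 2 + 2 * \<eta>))))"
proof -
  let ?s = "real d - 2 + 2 * \<eta>" and ?c = "dcoef d"
  obtain w k K where kK: "k > 0" "K > 0" and w_all: "\<forall>l. 0 < w l"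
    and b: "\<exists>c>0. \<exists>C>0. \<forall>l\<ge>1. c * real l powr ?s \<le> w l \<and> w l \<le> C * real l powr ?s"
    and iff_all: "\<forall>u. u \<in> V_space d \<eta> \<longleftrightarrow> integrable (gmeas (dalpha d) 0) u \<and> summable (\<lambda>l. (?c u l)\<^sup>2 * w l)"
    and nrm_all: "\<forall>u\<in>V_space d \<eta>. ennreal k * (\<Sum>l. ennreal ((?c u l)\<^sup>2 * w l)) \<le> V_norm2 d \<eta> u \<and>
       V_norm2 d \<eta> u \<le> ennreal K * (\<Sum>l. ennreal ((?c u l)\<^sup>2 * w l))"
    by (rule V_space_eq_weighted_l2[OF d \<eta>]) (rule that; assumption)
  note w = w_all[rule_format] and iff = iff_all[rule_format] and nrm = nrm_all[rule_format]
  have s: "?s \<ge> 0" using d \<eta> by simp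
  obtain c C where cC: "c > 0" "C > 0" "\<And>l. c * w l \<le> 1 + real l powr ?s" "\<And>l. 1 + real l powr ?s \<le> C * w l"
  proof -
    obtain c0 C0 where "c0 > 0" "C0 > 0" "\<And>l. l \<ge> 1 \<Longrightarrow> c0 * real l powr ?s \<le> w l \<and> w l \<le> C0 * real l powr ?s"
      using b by blast
    from weight_bounds_all_l[OF s w this] show thesis using that by blast
  qed
  have le1: "c * ((?c u l)\<^sup>2 * w l) \<le> (?c u l)\<^sup>2 * (1 + real l powr ?s)" for u l
    using mult_left_mono[OF cC(3)[of l], of "(?c u l)\<^sup>2"] by (simp add: mult.left_commute)
  have le2: "(?c u l)\<^sup>2 * (1 + real l powr ?s) \<le> C * ((?c u l)\<^sup>2 * w l)" for u l
    using mult_left_mono[OF cC(4)[of l], of "(?c u l)\<^sup>2"] by (simp add: mult.left_commute)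
  have nn: "0 \<le> (?c u l)\<^sup>2 * w l" "0 \<le> (?c u l)\<^sup>2 * (1 + real l powr ?s)" for u l
    using w[of l] by simp_all
  have sum_iff: "summable (\<lambda>l. (?c u l)\<^sup>2 * w l) \<longleftrightarrow> summable (\<lambda>l. (?c u l)\<^sup>2 * (1 + real l powr ?s))" for u
  proof
    assume "summable (\<lambda>l. (?c u l)\<^sup>2 * w l)"
    then have "summable (\<lambda>l. C * ((?c u l)\<^sup>2 * w l))" by (rule summable_mult)
    then show "summable (\<lambda>l. (?c u l)\<^sup>2 * (1 + real l powr ?s))"
      by (rule summable_comparison_test') (use le2 nn(2) in \<open>simp only: real_norm_def abs_of_nonneg\<close>)
  next
    assume "summable (\<lambda>l. (?c u l)\<^sup>2 * (1 + real l powr ?s))"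
    then have "summable (\<lambda>l. c * ((?c u l)\<^sup>2 * w l))"
    proof (rule summable_comparison_test')
      fix l
      have "0 \<le> c * ((?c u l)\<^sup>2 * w l)" using nn(1) cC(1) by simp
      then show "norm (c * ((?c u l)\<^sup>2 * w l)) \<le> (?c u l)\<^sup>2 * (1 + real l powr ?s)"
        using le1 by (simp only: real_norm_def abs_of_nonneg)
    qed
    then show "summable (\<lambda>l. (?c u l)\<^sup>2 * w l)" using cC(1) by (simp add: summable_cmult_iff)
  qed
  show "u \<in> V_space d \<eta> \<longleftrightarrow> integrable (gmeas (dalpha d) 0) u \<and> summable (\<lambda>l. (?c u l)\<^sup>2 * (1 + real l powr ?s))" for u
    unfolding iff sum_iff ..
  show "\<exists>c>0. \<exists>C>0. \<forall>u\<in>V_space d \<eta>.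
      ennreal c * (\<Sum>l. ennreal ((?c u l)\<^sup>2 * (1 + real l powr ?s))) \<le> V_norm2 d \<eta> u \<and>
      V_norm2 d \<eta> u \<le> ennreal C * (\<Sum>l. ennreal ((?c u l)\<^sup>2 * (1 + real l powr ?s)))"
  proof (rule exI[of _ "k / C"], rule conjI[OF divide_pos_pos[OF kK(1) cC(2)]],
      rule exI[of _ "K / c"], rule conjI[OF divide_pos_pos[OF kK(2) cC(1)]], rule ballI, rule conjI)
    fix u assume u: "u \<in> V_space d \<eta>"
    let ?S = "\<Sum>l. ennreal ((?c u l)\<^sup>2 * (1 + real l powr ?s))" and ?W = "\<Sum>l. ennreal ((?c u l)\<^sup>2 * w l)"
    have "?S \<le> (\<Sum>l. ennreal C * ennreal ((?c u l)\<^sup>2 * w l))"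
      using cC(2) nn(1) le2 by (intro suminf_le) (auto simp: ennreal_mult[symmetric] intro!: ennreal_leI)
    then have "?S \<le> ennreal C * ?W" by (simp add: ennreal_suminf_cmult)
    then have "ennreal (k / C) * ?S \<le> ennreal (k / C) * (ennreal C * ?W)" by (rule mult_left_mono) simp
    also have "\<dots> = ennreal k * ?W"
      using kK cC by (simp add: mult.assoc[symmetric] ennreal_mult[symmetric])
    also have "\<dots> \<le> V_norm2 d \<eta> u" using nrm[OF u] by blast
    finally show "ennreal (k / C) * ?S \<le> V_norm2 d \<eta> u" .
    have "(\<Sum>l. ennreal c * ennreal ((?c u l)\<^sup>2 * w l)) \<le> ?S"
      using cC(1) nn(1) le1 by (intro suminf_le) (auto simp: ennreal_mult[symmetric] intro!: ennreal_leI)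
    then have "ennreal c * ?W \<le> ?S" by (simp add: ennreal_suminf_cmult)
    then have le: "ennreal (K / c) * (ennreal c * ?W) \<le> ennreal (K / c) * ?S" by (rule mult_left_mono) simp
    have "V_norm2 d \<eta> u \<le> ennreal K * ?W" using nrm[OF u] by blast
    also have "\<dots> = ennreal (K / c) * (ennreal c * ?W)"
      using kK cC by (simp add: mult.assoc[symmetric] ennreal_mult[symmetric])
    also note le
    finally show "V_norm2 d \<eta> u \<le> ennreal (K / c) * ?S" .
  qed
qed

lemma summable_one_plus_powr_iff:
  fixes c :: "nat \<Rightarrow> real"
  assumes "s \<ge> 0"
  shows "summable (\<lambda>l. (c l)\<^sup>2 * (1 + real l powr s)) \<longleftrightarrow> summable (\<lambda>l. (c l)\<^sup>2 * real l powr s)"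
proof
  assume "summable (\<lambda>l. (c l)\<^sup>2 * (1 + real l powr s))"
  then show "summable (\<lambda>l. (c l)\<^sup>2 * real l powr s)"
    by (rule summable_comparison_test') (simp add: mult_left_mono)
next
  assume "summable (\<lambda>l. (c l)\<^sup>2 * real l powr s)"
  then have "summable (\<lambda>l. 2 * ((c l)\<^sup>2 * real l powr s))" by (rule summable_mult)
  then show "summable (\<lambda>l. (c l)\<^sup>2 * (1 + real l powr s))"
  proof (rule summable_comparison_test'[where N=1])
    fix l :: nat assume l: "1 \<le> l"
    have "1 \<le> real l powr s" using l assms by (simp add: ge_one_powr_ge_zero)
    then have "(c l)\<^sup>2 * (1 + real l powr s) \<le> (c l)\<^sup>2 * (2 * real l powr s)" by (intro mult_left_mono) auto
    then show "norm ((c l)\<^sup>2 * (1 + real l powr s)) \<le> 2 * ((c l)\<^sup>2 * real l powr s)" by simp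
  qed
qed

subsection \<open>Covariance kernels\<close>

lemma harmonic_dim_nonneg: "d \<ge> 2 \<Longrightarrow> 0 \<le> harmonic_dim l d"
  by (auto simp: harmonic_dim_def)

text \<open>Since \<open>\<bar>P\<^sub>l\<bar> \<le> 1\<close>, the kernel is the sum of a series that converges uniformly and may be integrated term
by term.\<close>

lemma gcoef_covariance_kernel:
  assumes d: "d \<ge> 2" and A: "\<And>l. 0 \<le> A l" and sm: "summable (\<lambda>l. A l * harmonic_dim l d)"
  shows "dcoef d (covariance_kernel d A) m = A m * harmonic_dim m d * gnorm (dalpha d) m / sphere_area d"
proof -
  let ?M = "gmeas (dalpha d) 0" and ?P = "\<lambda>l. poly (gpoly (dalpha d) l)"
  note \<alpha> = dalpha_nonneg[OF d]
  interpret finite_measure ?M by (rule finite_measure_gmeas[OF \<alpha>])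
  define a where "a = (\<lambda>l. A l * harmonic_dim l d)"
  have a: "0 \<le> a l" for l unfolding a_def using A harmonic_dim_nonneg[OF d] by simp
  have P1: "\<bar>?P l x\<bar> \<le> 1" if "x \<in> space ?M" for l x
    using that by (intro gpoly_bounded \<alpha>) (simp add: abs_le_iff)
  have bnd: "norm (a l * ?P l x * ?P m x) \<le> a l" if "x \<in> space ?M" for l x
  proof -
    have "\<bar>?P l x\<bar> * \<bar>?P m x\<bar> \<le> 1 * 1" using P1[OF that] by (intro mult_mono) auto
    from mult_left_mono[OF this a[of l]] show ?thesis using a[of l] by (simp add: abs_mult mult.assoc)
  qed
  have sms: "summable (\<lambda>l. a l * ?P l x)" if "x \<in> space ?M" for x
  proof (rule summable_comparison_test')
    show "summable a" using sm by (simp add: a_def)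
    show "norm (a l * ?P l x) \<le> a l" for l
      using mult_left_mono[OF P1[OF that, of l] a[of l]] a[of l] by (simp add: abs_mult)
  qed
  have ii: "integrable ?M (\<lambda>x. a l * ?P l x * ?P m x)" for l
    by (intro integrable_gmeas_times_poly Bochner_Integration.integrable_mult_right integrable_gmeas_poly[OF \<alpha>])
  have "dcoef d (covariance_kernel d A) m = (\<integral>x. 1 / sphere_area d * (\<Sum>l. a l * ?P l x * ?P m x) \<partial>?M)"
    unfolding gcoef_def
  proof (rule Bochner_Integration.integral_cong[OF refl])
    fix x assume x: "x \<in> space ?M"
    have "(\<Sum>l. a l * ?P l x) * ?P m x = (\<Sum>l. a l * ?P l x * ?P m x)"
      by (rule suminf_mult2[OF sms[OF x]])
    then show "covariance_kernel d A x * poly (gderiv (dalpha d) 0 m) x = 1 / sphere_area d * (\<Sum>l. a l * ?P l x * ?P m x)"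
      unfolding covariance_kernel_def gegenbauer_normalized_eq_poly[OF d] a_def
      by (simp add: gderiv_def mult.assoc)
  qed
  also have "\<dots> = 1 / sphere_area d * (\<integral>x. (\<Sum>l. a l * ?P l x * ?P m x) \<partial>?M)"
    by (rule integral_mult_right_zero)
  also have "(\<integral>x. (\<Sum>l. a l * ?P l x * ?P m x) \<partial>?M) = (\<Sum>l. \<integral>x. a l * ?P l x * ?P m x \<partial>?M)"
  proof (rule integral_suminf[OF ii])
    show "AE x in ?M. summable (\<lambda>l. norm (a l * ?P l x * ?P m x))"
    proof (rule AE_I2)
      fix x assume x: "x \<in> space ?M"
      show "summable (\<lambda>l. norm (a l * ?P l x * ?P m x))"
        by (rule summable_comparison_test'[where g=a]) (use sm bnd[OF x] in \<open>simp_all add: a_def\<close>)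
    qed
    show "summable (\<lambda>l. \<integral>x. norm (a l * ?P l x * ?P m x) \<partial>?M)"
    proof (rule summable_comparison_test')
      show "summable (\<lambda>l. a l * measure ?M (space ?M))" using sm by (simp add: a_def summable_mult2)
      fix l
      have "(\<integral>x. norm (a l * ?P l x * ?P m x) \<partial>?M) \<le> (\<integral>x. a l \<partial>?M)"
        using ii bnd by (intro integral_mono) auto
      then show "norm (\<integral>x. norm (a l * ?P l x * ?P m x) \<partial>?M) \<le> a l * measure ?M (space ?M)"
        by (simp add: mult.commute)
    qed
  qed
  also have "(\<Sum>l. \<integral>x. a l * ?P l x * ?P m x \<partial>?M) = (\<Sum>l. if l = m then a m * gnorm (dalpha d) m else 0)"
  proof (rule suminf_cong)
    fix l
    have "(\<integral>x. a l * ?P l x * ?P m x \<partial>?M) = a l * (\<integral>x. ?P l x * ?P m x \<partial>?M)"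
      unfolding mult.assoc by (rule integral_mult_right_zero)
    then show "(\<integral>x. a l * ?P l x * ?P m x \<partial>?M) = (if l = m then a m * gnorm (dalpha d) m else 0)"
      using gpoly_orthogonal[OF \<alpha>, of l m] by (auto simp: gnorm_def power2_eq_square)
  qed
  also have "\<dots> = a m * gnorm (dalpha d) m"
    using sums_single[of m "\<lambda>l. a m * gnorm (dalpha d) m"] by (subst sums_unique[symmetric]) auto
  finally show ?thesis by (simp add: a_def)
qed

text \<open>For \<open>l \<ge> 1\<close> the coefficients of the kernel are the constant multiples \<open>K A\<^sub>l\<close> of the spectrum, as
\<open>h(l,d) N\<^sub>l\<close> is constant.\<close>

lemma summable_spectrum_of_V_nat:
  assumes d: "d \<ge> 2" and A: "\<And>l. 0 \<le> A l" and sm: "summable (\<lambda>l. A l * harmonic_dim l d)"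
    and V: "covariance_kernel d A \<in> V_nat d n"
  shows "summable (\<lambda>l. (real l powr (real d / 2 - 1 + real n) * A l)\<^sup>2)"
proof -
  let ?\<alpha> = "dalpha d" and ?c = "dcoef d (covariance_kernel d A)" and ?s = "real d - 2 + 2 * real n"
  define K where "K = harmonic_dim 1 d * gnorm ?\<alpha> 1 / sphere_area d"
  have "sphere_area d > 0" unfolding sphere_area_def using d by (intro divide_pos_pos mult_pos_pos Gamma_real_pos) auto
  moreover have "harmonic_dim 1 d > 0"
    using harmonic_dim_bounds[OF d] by (force intro: less_le_trans)
  ultimately have K: "K > 0" unfolding K_def using gnorm_pos[OF dalpha_nonneg[OF d], of 1] by simp
  have c: "?c l = K * A l" if "l \<ge> 1" for l
  proof -
    obtain k where k: "l = Suc k" using \<open>l \<ge> 1\<close> by (cases l) auto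
    have "harmonic_dim l d * gnorm ?\<alpha> l = harmonic_dim 1 d * gnorm ?\<alpha> 1"
      unfolding k by (rule harmonic_dim_times_gnorm[OF d])
    then show ?thesis unfolding gcoef_covariance_kernel[OF d A sm] K_def by (simp add: mult.assoc)
  qed
  have "summable (\<lambda>l. (?c l)\<^sup>2 * (1 + real l powr ?s))"
    using V_space_equivalent_norm(1)[OF d, of "real n"] V by simp
  then have "summable (\<lambda>l. (?c l)\<^sup>2 * real l powr ?s)"
    using d by (subst (asm) summable_one_plus_powr_iff) auto
  then have "summable (\<lambda>l. 1 / K\<^sup>2 * ((?c l)\<^sup>2 * real l powr ?s))" by (rule summable_mult)
  then show ?thesis
  proof (rule summable_comparison_test'[where N=1])
    fix l :: nat assume l: "1 \<le> l"
    have "(real l powr (real d / 2 - 1 + real n))\<^sup>2 = real l powr ?s"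
      by (simp add: power2_eq_square powr_add[symmetric]) (simp add: algebra_simps)
    then show "norm ((real l powr (real d / 2 - 1 + real n) * A l)\<^sup>2) \<le> 1 / K\<^sup>2 * ((?c l)\<^sup>2 * real l powr ?s)"
      unfolding c[OF l] using K by (simp add: power_mult_distrib)
  qed
qed

lemma weighted_weak_deriv_in_L2:
  assumes d: "d \<ge> 2" and u: "u \<in> V_nat d n"
  shows "(\<lambda>\<mu>. (1 - \<mu>\<^sup>2) powr ((real d - 3) / 4 + real n / 2) * weak_deriv n u \<mu>) \<in> L2_11"
proof -
  let ?e = "(real d - 3) / 4 + real n / 2"
  have fin: "V_nat_norm2 d n u < \<infinity>" using u by (simp add: V_nat_def)
  have ex: "\<forall>j\<le>n. \<exists>v. has_weak_deriv j u v"
    using fin unfolding V_nat_norm2_def by (rule contrapos_pp) auto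
  then have w: "has_weak_deriv n u (weak_deriv n u)" using has_weak_deriv_weak_deriv by blast
  have m: "(\<lambda>\<mu>. (1 - \<mu>\<^sup>2) powr ?e * weak_deriv n u \<mu>) \<in> borel_measurable leb11"
    by (intro borel_measurable_times weight_measurable has_weak_deriv_measurable(2)[OF w])
  have "(\<integral>\<^sup>+ \<mu>. ennreal ((weak_deriv n u \<mu>)\<^sup>2 * (1 - \<mu>\<^sup>2) powr ((real d - 3) / 2 + real n)) \<partial>leb11)
      \<le> (\<Sum>j\<le>n. \<integral>\<^sup>+ \<mu>. ennreal ((weak_deriv j u \<mu>)\<^sup>2 * (1 - \<mu>\<^sup>2) powr ((real d - 3) / 2 + real j)) \<partial>leb11)"
    by (rule member_le_sum) auto
  also have "\<dots> = V_nat_norm2 d n u" using ex by (simp add: V_nat_norm2_def)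
  also note fin
  also have "(\<integral>\<^sup>+ \<mu>. ennreal ((weak_deriv n u \<mu>)\<^sup>2 * (1 - \<mu>\<^sup>2) powr ((real d - 3) / 2 + real n)) \<partial>leb11)
      = (\<integral>\<^sup>+ \<mu>. ennreal (((1 - \<mu>\<^sup>2) powr ?e * weak_deriv n u \<mu>)\<^sup>2) \<partial>leb11)"
  proof (rule nn_integral_cong)
    fix \<mu> :: real
    have "((1 - \<mu>\<^sup>2) powr ?e)\<^sup>2 = (1 - \<mu>\<^sup>2) powr ((real d - 3) / 2 + real n)"
      by (simp add: power2_eq_square powr_add[symmetric])
    then show "ennreal ((weak_deriv n u \<mu>)\<^sup>2 * (1 - \<mu>\<^sup>2) powr ((real d - 3) / 2 + real n)) = ennreal (((1 - \<mu>\<^sup>2) powr ?e * weak_deriv n u \<mu>)\<^sup>2)"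
      by (simp add: power_mult_distrib mult.commute)
  qed
  finally show ?thesis
    using m sqint_iff_nn_integral[OF m] by (simp add: L2_11_def sqint_def)
qed

theorem theorem3p2:
  fixes d :: nat and \<eta> :: real
  assumes "d = CARD('n::finite)" and "d \<ge> 2" and "\<eta> \<ge> 0"
  shows "(\<forall>u\<in>L2_11. u \<in> V_space d \<eta> \<longleftrightarrow>
            gegenbauer_coeffs_exist d u \<and>
            summable (\<lambda>l. (gegenbauer_coeff d u l)\<^sup>2 * real l powr (real d - 2 + 2 * \<eta>)))
       \<and> (\<exists>c>0. \<exists>C>0. \<forall>u\<in>V_space d \<eta>.
            ennreal c * (\<Sum>l. ennreal ((gegenbauer_coeff d u l)\<^sup>2
                                        * (1 + real l powr (real d - 2 + 2 * \<eta>)))) \<le> V_norm2 d \<eta> u \<and>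
            V_norm2 d \<eta> u \<le> ennreal C * (\<Sum>l. ennreal ((gegenbauer_coeff d u l)\<^sup>2
                                        * (1 + real l powr (real d - 2 + 2 * \<eta>)))))
       \<and> (\<forall>(M :: 'b measure) (T :: real ^ 'n \<Rightarrow> 'b \<Rightarrow> real) A n.
            centered_isotropic_field M T \<and> mean_square_continuous M T \<and>
            angular_power_spectrum M T A \<and>
            covariance_kernel d A \<in> V_space d (real n) \<longrightarrow>
            ((\<lambda>l. (real l powr (real d / 2 - 1 + real n) * A l)\<^sup>2) summable_on {n..}
             \<longleftrightarrow> (\<lambda>\<mu>. (1 - \<mu>\<^sup>2) powr ((real d - 3) / 4 + real n / 2)
                         * weak_deriv n (covariance_kernel d A) \<mu>) \<in> L2_11))"
proof (intro conjI ballI allI impI)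
  note d = assms(2) and \<eta> = assms(3)
  have s: "real d - 2 + 2 * \<eta> \<ge> 0" using d \<eta> by simp
  have meas: "u \<in> borel_measurable leb11" if "u \<in> V_space d \<eta>" for u
  proof -
    have "integrable (gmeas (dalpha d) 0) u" using that V_space_equivalent_norm(1)[OF d \<eta>] by blast
    from borel_measurable_integrable[OF this] show ?thesis by simp
  qed
  {
    fix u assume "u \<in> L2_11"
    then have um: "u \<in> borel_measurable leb11" by (simp add: L2_11_def)
    show "u \<in> V_space d \<eta> \<longleftrightarrow> gegenbauer_coeffs_exist d u \<and>
            summable (\<lambda>l. (gegenbauer_coeff d u l)\<^sup>2 * real l powr (real d - 2 + 2 * \<eta>))"
      unfolding V_space_equivalent_norm(1)[OF d \<eta>] gegenbauer_coeffs_exist_iff[OF d um]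
        gegenbauer_coeff_eq_gcoef[OF d um] summable_one_plus_powr_iff[OF s] ..
  next
    show "\<exists>c>0. \<exists>C>0. \<forall>u\<in>V_space d \<eta>.
            ennreal c * (\<Sum>l. ennreal ((gegenbauer_coeff d u l)\<^sup>2
                                        * (1 + real l powr (real d - 2 + 2 * \<eta>)))) \<le> V_norm2 d \<eta> u \<and>
            V_norm2 d \<eta> u \<le> ennreal C * (\<Sum>l. ennreal ((gegenbauer_coeff d u l)\<^sup>2
                                        * (1 + real l powr (real d - 2 + 2 * \<eta>))))"
      using V_space_equivalent_norm(2)[OF d \<eta>]
      by (simp only: gegenbauer_coeff_eq_gcoef[OF d meas] cong: ball_cong)
  next
    fix M :: "'b measure" and T :: "real ^ 'n \<Rightarrow> 'b \<Rightarrow> real" and A n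
    assume *: "centered_isotropic_field M T \<and> mean_square_continuous M T \<and>
            angular_power_spectrum M T A \<and> covariance_kernel d A \<in> V_space d (real n)"
    then have V: "covariance_kernel d A \<in> V_nat d n" and A: "\<And>l. 0 \<le> A l"
      and sm: "summable (\<lambda>l. A l * harmonic_dim l d)"
      by (auto simp: angular_power_spectrum_def assms(1))
    have "(\<lambda>l. (real l powr (real d / 2 - 1 + real n) * A l)\<^sup>2) summable_on UNIV"
      by (rule summable_nonneg_imp_summable_on[OF summable_spectrum_of_V_nat[OF d A sm V]]) simp
    then have "(\<lambda>l. (real l powr (real d / 2 - 1 + real n) * A l)\<^sup>2) summable_on {n..}"
      by (rule summable_on_subset_banach) simp
    note both = this weighted_weak_deriv_in_L2[OF d V]
    show "((\<lambda>l. (real l powr (real d / 2 - 1 + real n) * A l)\<^sup>2) summable_on {n..}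
             \<longleftrightarrow> (\<lambda>\<mu>. (1 - \<mu>\<^sup>2) powr ((real d - 3) / 4 + real n / 2)
                         * weak_deriv n (covariance_kernel d A) \<mu>) \<in> L2_11)"
      by (rule iffI) (rule both)+
  }
qed

end
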